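(* Let $X_t=x-\frac12\int_0^t\sigma_s^2\,ds+\int_0^t\sigma_s\,dZ_s$, $S_t=e^{X_t}$, where $Z=\rho W+\sqrt{1-\rho^2}\,B$ with $W,B$ independent standard Brownian motions and $\rho\in(-1,1)$, and where $\sigma$ is given by the Rough Bergomi model $$\sigma_t^2=\sigma_0^2\exp\left(\nu W_t^H-\frac{\nu^2t^{2H}}{2}\right),\qquad W_t^H=\sqrt{2H}\int_0^t(t-s)^{H-1/2}\,dW_s,$$ with $\sigma_0>0$, $\nu>0$, $H\in(0,\tfrac12)$. Let $B^{\ast}>S_0$ and $K>0$. Then for every $m>0$, $$\lim_{T\to0}\frac{\mathbb{P}\left(\sup_{t\in[0,T]}S_t\ge B^{\ast}\right)}{T^m}=0,$$ and the up-and-in barrier call price $C_0^b(T)=\mathbb{E}\left[(S_T-K)_+\mathbf{1}_{\{\sup_{t\in[0,T]}S_t\ge B^{\ast}\}}\right]$ tends to zero faster than any polynomial, i.e. $C_0^b(T)=o(T^m)$ as $T\to0$ for every $m>0$.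
   Context: $x\in\mathbb{R}$ is the initial log-price, $S_0=e^x$; $B^{\ast}$ is the barrier level and $K$ the strike. Processes are taken with continuous paths. *)

theory Defs
  imports "HOL-Probability.Probability" "HOL-Library.Landau_Symbols"
begin

text \<open>Processes are functions \<^typ>\<open>real \<Rightarrow> 'a \<Rightarrow> real\<close> of time and scenario; only times
  \<open>t \<ge> 0\<close> matter.\<close>

definition continuous_process :: "'a measure \<Rightarrow> (real \<Rightarrow> 'a \<Rightarrow> real) \<Rightarrow> bool" where
  "continuous_process M X \<longleftrightarrow>
     (\<forall>t\<ge>0. X t \<in> borel_measurable M) \<and>
     (\<forall>\<omega>\<in>space M. continuous_on {0..} (\<lambda>t. X t \<omega>))"

definition standard_BM :: "'a measure \<Rightarrow> (real \<Rightarrow> 'a \<Rightarrow> real) \<Rightarrow> bool" where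
  "standard_BM M W \<longleftrightarrow>
     continuous_process M W \<and>
     (AE \<omega> in M. W 0 \<omega> = 0) \<and>
     (\<forall>s t. 0 \<le> s \<and> s < t \<longrightarrow>
        distributed M lborel (\<lambda>\<omega>. W t \<omega> - W s \<omega>) (normal_density 0 (sqrt (t - s)))) \<and>
     (\<forall>n p. 0 \<le> p 0 \<and> (\<forall>i<n. p i < p (Suc i)) \<longrightarrow>
        prob_space.indep_vars M (\<lambda>_. borel) (\<lambda>i \<omega>. W (p (Suc i)) \<omega> - W (p i) \<omega>) {..<n::nat})"

definition indep_processes ::
    "'a measure \<Rightarrow> (real \<Rightarrow> 'a \<Rightarrow> real) \<Rightarrow> (real \<Rightarrow> 'a \<Rightarrow> real) \<Rightarrow> bool" where
  "indep_processes M W B \<longleftrightarrow>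
     prob_space.indep_var M
       (Pi\<^sub>M {0..} (\<lambda>_. borel)) (\<lambda>\<omega>. \<lambda>t\<in>{0..}. W t \<omega>)
       (Pi\<^sub>M {0..} (\<lambda>_. borel)) (\<lambda>\<omega>. \<lambda>t\<in>{0..}. B t \<omega>)"

text \<open>The filtration generated by \<open>W\<close> and \<open>B\<close>, augmented by the null sets so that versions of
  stochastic integrals, which are only determined almost surely, are adapted.\<close>

definition BM_filtration ::
    "'a measure \<Rightarrow> (real \<Rightarrow> 'a \<Rightarrow> real) \<Rightarrow> (real \<Rightarrow> 'a \<Rightarrow> real) \<Rightarrow> real \<Rightarrow> 'a measure" where
  "BM_filtration M W B t = sigma (space M)
     ({W s -` A \<inter> space M | s A. s \<in> {0..t} \<and> A \<in> sets borel} \<union>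
      {B s -` A \<inter> space M | s A. s \<in> {0..t} \<and> A \<in> sets borel} \<union>
      null_sets M)"

text \<open>A simple predictable process \<open>\<Sum>i<n. \<xi>\<^sub>i 1\<^bsub>(p\<^sub>i, p\<^sub>i\<^sub>+\<^sub>1]\<^esub>\<close> is represented by the data
  \<open>n\<close>, \<open>p\<close>, \<open>\<xi>\<close>.\<close>

definition simple_integrand ::
    "(real \<Rightarrow> 'a measure) \<Rightarrow> nat \<Rightarrow> (nat \<Rightarrow> real) \<Rightarrow> (nat \<Rightarrow> 'a \<Rightarrow> real) \<Rightarrow> bool" where
  "simple_integrand F n p \<xi> \<longleftrightarrow>
     0 \<le> p 0 \<and> (\<forall>i<n. p i \<le> p (Suc i)) \<and>
     (\<forall>i<n. \<xi> i \<in> borel_measurable (F (p i)) \<and>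
            (\<exists>c. \<forall>\<omega>\<in>space (F (p i)). \<bar>\<xi> i \<omega>\<bar> \<le> c))"

definition simple_process ::
    "nat \<Rightarrow> (nat \<Rightarrow> real) \<Rightarrow> (nat \<Rightarrow> 'a \<Rightarrow> real) \<Rightarrow> real \<Rightarrow> 'a \<Rightarrow> real" where
  "simple_process n p \<xi> s \<omega> = (\<Sum>i<n. \<xi> i \<omega> * indicator {p i<..p (Suc i)} s)"

definition simple_integral ::
    "(real \<Rightarrow> 'a \<Rightarrow> real) \<Rightarrow> nat \<Rightarrow> (nat \<Rightarrow> real) \<Rightarrow> (nat \<Rightarrow> 'a \<Rightarrow> real) \<Rightarrow> real \<Rightarrow> 'a \<Rightarrow> real" where
  "simple_integral Z n p \<xi> t \<omega> =
     (\<Sum>i<n. \<xi> i \<omega> * (Z (min t (p (Suc i))) \<omega> - Z (min t (p i)) \<omega>))"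

definition progressive_on ::
    "(real \<Rightarrow> 'a measure) \<Rightarrow> real \<Rightarrow> (real \<Rightarrow> 'a \<Rightarrow> real) \<Rightarrow> bool" where
  "progressive_on F T h \<longleftrightarrow>
     (\<forall>t\<in>{0..T}. (\<lambda>(s, \<omega>). h s \<omega>) \<in> borel_measurable (restrict_space borel {0..t} \<Otimes>\<^sub>M F t))"

text \<open>\<open>ito_integral M F Z T h Y\<close> says that the random variable \<open>Y\<close> is a version of the It\^o
  integral of \<open>h\<close> with respect to the \<open>F\<close>-Brownian motion \<open>Z\<close> over \<open>[0, T]\<close>: the integrand
  is progressively measurable and almost surely square integrable in time, and \<open>Y\<close> is the limit in
  probability of the elementary integrals of simple processes that approximate \<open>h\<close>
  in \<open>L\<^sup>2([0, T])\<close> in probability. The approximation error is a nonnegative extended real, so no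
  junk value of a divergent integral enters.\<close>

definition ito_integral ::
    "'a measure \<Rightarrow> (real \<Rightarrow> 'a measure) \<Rightarrow> (real \<Rightarrow> 'a \<Rightarrow> real) \<Rightarrow> real \<Rightarrow>
     (real \<Rightarrow> 'a \<Rightarrow> real) \<Rightarrow> ('a \<Rightarrow> real) \<Rightarrow> bool" where
  "ito_integral M F Z T h Y \<longleftrightarrow>
     Y \<in> borel_measurable M \<and>
     progressive_on F T h \<and>
     (AE \<omega> in M. (\<integral>\<^sup>+s\<in>{0..T}. ennreal ((h s \<omega>)\<^sup>2) \<partial>lborel) < \<infinity>) \<and>
     (\<exists>n p \<xi>. (\<forall>k::nat. simple_integrand F (n k) (p k) (\<xi> k)) \<and>
        (\<forall>\<epsilon>>0. (\<lambda>k. measure M {\<omega>\<in>space M.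
            (\<integral>\<^sup>+s\<in>{0..T}. ennreal ((simple_process (n k) (p k) (\<xi> k) s \<omega> - h s \<omega>)\<^sup>2) \<partial>lborel)
              > ennreal \<epsilon>}) \<longlonglongrightarrow> 0) \<and>
        (\<forall>\<epsilon>>0. (\<lambda>k. measure M {\<omega>\<in>space M.
            \<bar>simple_integral Z (n k) (p k) (\<xi> k) T \<omega> - Y \<omega>\<bar> > \<epsilon>}) \<longlonglongrightarrow> 0))"

text \<open>The integral process \<open>I\<^sub>t = \<integral>\<^sub>0\<^sup>t h\<^sub>s dZ\<^sub>s\<close> in its continuous version.\<close>

definition ito_integral_process ::
    "'a measure \<Rightarrow> (real \<Rightarrow> 'a measure) \<Rightarrow> (real \<Rightarrow> 'a \<Rightarrow> real) \<Rightarrow>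
     (real \<Rightarrow> 'a \<Rightarrow> real) \<Rightarrow> (real \<Rightarrow> 'a \<Rightarrow> real) \<Rightarrow> bool" where
  "ito_integral_process M F Z h I \<longleftrightarrow>
     continuous_process M I \<and> (\<forall>t\<ge>0. ito_integral M F Z t h (I t))"

text \<open>\<open>V\<^sub>t = sqrt (2H) \<integral>\<^sub>0\<^sup>t (t - s)\<^bsup>H - 1/2\<^esup> dW\<^sub>s\<close>, in its continuous version. The integrand
  depends on \<open>t\<close>, so each \<open>V\<^sub>t\<close> is described by its own integral.\<close>

definition volterra_fBM ::
    "'a measure \<Rightarrow> (real \<Rightarrow> 'a measure) \<Rightarrow> (real \<Rightarrow> 'a \<Rightarrow> real) \<Rightarrow> real \<Rightarrow>
     (real \<Rightarrow> 'a \<Rightarrow> real) \<Rightarrow> bool" where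
  "volterra_fBM M F W H V \<longleftrightarrow>
     continuous_process M V \<and>
     (\<forall>t\<ge>0. \<exists>Y. ito_integral M F W t (\<lambda>s \<omega>. (t - s) powr (H - 1/2)) Y \<and>
              (AE \<omega> in M. V t \<omega> = sqrt (2 * H) * Y \<omega>))"

end

theory Submission
  imports Defs "HOL-Real_Asymp.Real_Asymp"
begin

text \<open>
  Let \<open>\<langle>I\<rangle>\<^sub>t\<close> be the time integral of \<open>\<sigma>\<^sup>2\<close>, so that \<open>S = exp (x + I - \<langle>I\<rangle> / 2)\<close>. Everything rests on one
  inequality for the It\^o integral as defined by approximation: for \<open>s \<le> t\<close>, \<open>c\<close> real and \<open>g \<ge> 0\<close>
  measurable with respect to the past of \<open>s\<close>, the expectation of
  \<open>g exp (c (I\<^sub>t - I\<^sub>s) - c\<^sup>2 (\<langle>I\<rangle>\<^sub>t - \<langle>I\<rangle>\<^sub>s) / 2)\<close> is at most that of \<open>g\<close>. It is an identity for step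
  processes, where it also gives Lenglart's inequality (hence independence of the approximating
  sequence), and it passes to the limit by Fatou's lemma.

  Hitting probability: optional stopping bounds \<open>P(sup I \<ge> y, \<langle>I\<rangle>\<^sub>T \<le> d)\<close> by \<open>exp (- y\<^sup>2 / (2 d))\<close>, used
  with \<open>d = \<surd>T\<close>. The same inequality for the deterministic Volterra kernel gives exponential
  moments of the Volterra process, so all moments of \<open>\<sigma>\<^sup>2\<close> are bounded near time 0 and
  \<open>P(\<langle>I\<rangle>\<^sub>T > \<surd>T)\<close> is \<open>O(T\<^sup>n)\<close> for every \<open>n\<close>.

  Option price: higher moments of \<open>S\<^sub>T\<close> may be infinite, so Hoelder's inequality is not available.
  Instead, \<open>S\<close> is a supermartingale and at its first passage above a level it equals that level, so
  the expectation of \<open>S\<^sub>T\<close> on the hitting event is at most a constant times the hitting probability.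
\<close>

section \<open>Step processes\<close>

text \<open>The variance is unbounded, so no deterministic bound on the quadratic variation is
  available, and the Volterra kernel depends on its end time, so that part has no integral process.
  Both integrals are reached only through limits in probability, at each time with its own
  approximating sequence. An inequality between expectations of nonnegative exponentials survives
  such limits: Fatou's lemma costs the equality, but stopping arguments only use a supermartingale.

  The threshold \<open>sqrt T\<close> lies between the typical size of the quadratic variation, of
  order \<open>T\<close>, and size 1. Exceeding it is paid for by a high moment; below it the
  Gaussian tail \<open>exp (- a / sqrt T)\<close> beats every power of \<open>T\<close>. Any
  \<open>T powr \<alpha>\<close> with \<open>0 < \<alpha> < 1\<close> would balance in the same way.

  Passage of a level in continuous time is read off on uniform grids, where a path that reaches a
  level is only seen to come close to it. Hence the estimates carry a second, slightly lower level,
  and the price for the normalised barrier \<open>b\<close> is bounded by the hitting probability of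
  a level strictly between 1 and \<open>b\<close>.\<close>

lemma (in prob_space) nn_integral_exp_indep_normal:
  fixes X \<xi> :: "'a \<Rightarrow> real" and g :: "'a \<Rightarrow> ennreal"
  assumes sub: "subalgebra M G"
    and X: "distributed M lborel X (normal_density 0 \<tau>)" and \<tau>: "0 < \<tau>"
    and indep: "\<And>A C. A \<in> sets G \<Longrightarrow> C \<in> sets borel \<Longrightarrow>
      prob (A \<inter> (X -` C \<inter> space M)) = prob A * prob (X -` C \<inter> space M)"
    and g [measurable]: "g \<in> borel_measurable G" and \<xi> [measurable]: "\<xi> \<in> borel_measurable G"
  shows "(\<integral>\<^sup>+\<omega>. g \<omega> * ennreal (exp (\<xi> \<omega> * X \<omega> - (\<xi> \<omega>)\<^sup>2 * \<tau>\<^sup>2 / 2)) \<partial>M) = (\<integral>\<^sup>+\<omega>. g \<omega> \<partial>M)"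
proof -
  let ?R = "restr_to_subalg M G"
  let ?N = "density lborel (\<lambda>x. ennreal (normal_density 0 \<tau> x))"
  interpret N: prob_space ?N by (rule prob_space_normal_density[OF \<tau>])
  interpret R: prob_space ?R
  proof (rule prob_spaceI)
    have "space M \<in> sets G"
      using sub sets.top[of G] by (simp add: subalgebra_def)
    then show "emeasure ?R (space ?R) = 1"
      by (simp add: space_restr_to_subalg emeasure_restr_to_subalg[OF sub] emeasure_space_1)
  qed
  have [measurable_cong]: "sets ?R = sets G" by (rule sets_restr_to_subalg[OF sub])
  have X_meas [measurable]: "X \<in> borel_measurable M"
    using distributed_measurable[OF X] by simp
  have id [measurable]: "(\<lambda>\<omega>. \<omega>) \<in> M \<rightarrow>\<^sub>M ?R"
    using sub by (intro measurableI) (auto simp: space_restr_to_subalg sets_restr_to_subalg subalgebra_def)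
  have pair [measurable]: "(\<lambda>\<omega>. (\<omega>, X \<omega>)) \<in> M \<rightarrow>\<^sub>M ?R \<Otimes>\<^sub>M ?N"
    by measurable
  \<comment> \<open>Independence of \<open>X\<close> from \<open>G\<close> says that the law of
    \<open>(\<omega>, X \<omega>)\<close>, with \<open>\<omega>\<close> seen only through
    \<open>G\<close>, is a product. The integral becomes an iterated one in which
    \<open>\<xi> \<omega>\<close> is frozen, and only a Gaussian exponential moment is left.\<close>
  have joint: "?R \<Otimes>\<^sub>M ?N = distr M (?R \<Otimes>\<^sub>M ?N) (\<lambda>\<omega>. (\<omega>, X \<omega>))"
  proof (rule pair_measure_eqI)
    fix A C assume A: "A \<in> sets ?R" and C: "C \<in> sets ?N"
    have A': "A \<in> sets G" "A \<in> events" and C': "C \<in> sets borel"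
      using A C sub by (auto simp: sets_restr_to_subalg subalgebra_def)
    have eN: "emeasure ?N C = emeasure M (X -` C \<inter> space M)"
      unfolding distributed_distr_eq_density[OF X, symmetric] using C' X_meas by (subst emeasure_distr) auto
    have vm: "(\<lambda>\<omega>. (\<omega>, X \<omega>)) -` (A \<times> C) \<inter> space M = A \<inter> (X -` C \<inter> space M)"
      by auto
    have "emeasure (distr M (?R \<Otimes>\<^sub>M ?N) (\<lambda>\<omega>. (\<omega>, X \<omega>))) (A \<times> C) = emeasure M (A \<inter> (X -` C \<inter> space M))"
      using A C by (subst emeasure_distr[OF pair]) (auto simp: vm)
    also have "\<dots> = ennreal (prob A) * ennreal (prob (X -` C \<inter> space M))"
      by (simp add: emeasure_eq_measure indep[OF A'(1) C'] ennreal_mult)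
    also have "\<dots> = emeasure ?R A * emeasure ?N C"
      by (simp add: eN emeasure_restr_to_subalg[OF sub A'(1)] emeasure_eq_measure)
    finally show "emeasure ?R A * emeasure ?N C = emeasure (distr M (?R \<Otimes>\<^sub>M ?N) (\<lambda>\<omega>. (\<omega>, X \<omega>))) (A \<times> C)"
      by simp
  qed (auto simp: R.sigma_finite_measure_axioms N.sigma_finite_measure_axioms)
  define \<psi> where "\<psi> = (\<lambda>(\<omega>, z). g \<omega> * ennreal (exp (\<xi> \<omega> * z - (\<xi> \<omega>)\<^sup>2 * \<tau>\<^sup>2 / 2)))"
  have \<psi> [measurable]: "\<psi> \<in> borel_measurable (?R \<Otimes>\<^sub>M ?N)"
    unfolding \<psi>_def by measurable
  have inner: "(\<integral>\<^sup>+z. ennreal (exp (a * z - a\<^sup>2 * \<tau>\<^sup>2 / 2)) \<partial>?N) = 1" for a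
  proof -
    have "(\<integral>\<^sup>+z. ennreal (exp (a * z - a\<^sup>2 * \<tau>\<^sup>2 / 2)) \<partial>?N)
        = (\<integral>\<^sup>+z. ennreal (normal_density 0 \<tau> z) * ennreal (exp (a * z - a\<^sup>2 * \<tau>\<^sup>2 / 2)) \<partial>lborel)"
      by (subst nn_integral_density) auto
    \<comment> \<open>Completing the square: the exponential tilt moves the mean of the centred
      normal density to \<open>a * \<tau>\<^sup>2\<close>.\<close>
    also have "\<dots> = (\<integral>\<^sup>+z. ennreal (normal_density (a * \<tau>\<^sup>2) \<tau> z) \<partial>lborel)"
    proof (intro nn_integral_cong)
      fix z :: real
      have "- z\<^sup>2 / (2 * \<tau>\<^sup>2) + (a * z - a\<^sup>2 * \<tau>\<^sup>2 / 2) = - (z - a * \<tau>\<^sup>2)\<^sup>2 / (2 * \<tau>\<^sup>2)"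
        using \<tau> by (simp add: field_simps power2_eq_square)
      then have "exp (- (z - a * \<tau>\<^sup>2)\<^sup>2 / (2 * \<tau>\<^sup>2)) =
          exp (- z\<^sup>2 / (2 * \<tau>\<^sup>2)) * exp (a * z - a\<^sup>2 * \<tau>\<^sup>2 / 2)"
        by (metis exp_add)
      then have "normal_density (a * \<tau>\<^sup>2) \<tau> z = normal_density 0 \<tau> z * exp (a * z - a\<^sup>2 * \<tau>\<^sup>2 / 2)"
        unfolding normal_density_def by simp
      then show "ennreal (normal_density 0 \<tau> z) * ennreal (exp (a * z - a\<^sup>2 * \<tau>\<^sup>2 / 2))
          = ennreal (normal_density (a * \<tau>\<^sup>2) \<tau> z)"
        by (simp only: ennreal_mult'[OF normal_density_nonneg])
    qed
    also have "\<dots> = 1"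
      using prob_space.emeasure_space_1[OF prob_space_normal_density[OF \<tau>, of "a * \<tau>\<^sup>2"]]
      by (simp add: emeasure_density)
    finally show ?thesis .
  qed
  have "(\<integral>\<^sup>+\<omega>. g \<omega> * ennreal (exp (\<xi> \<omega> * X \<omega> - (\<xi> \<omega>)\<^sup>2 * \<tau>\<^sup>2 / 2)) \<partial>M)
      = (\<integral>\<^sup>+\<omega>. \<psi> (\<omega>, X \<omega>) \<partial>M)"
    by (simp add: \<psi>_def)
  also have "\<dots> = (\<integral>\<^sup>+y. \<psi> y \<partial>distr M (?R \<Otimes>\<^sub>M ?N) (\<lambda>\<omega>. (\<omega>, X \<omega>)))"
    by (rule nn_integral_distr[symmetric, OF pair]) (use \<psi> in simp)
  also have "\<dots> = (\<integral>\<^sup>+y. \<psi> y \<partial>(?R \<Otimes>\<^sub>M ?N))"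
    using joint by simp
  also have "\<dots> = (\<integral>\<^sup>+\<omega>. (\<integral>\<^sup>+z. \<psi> (\<omega>, z) \<partial>?N) \<partial>?R)"
    by (rule N.nn_integral_fst[symmetric, OF \<psi>])
  also have "\<dots> = (\<integral>\<^sup>+\<omega>. g \<omega> \<partial>?R)"
  proof (intro nn_integral_cong)
    fix \<omega>
    show "(\<integral>\<^sup>+z. \<psi> (\<omega>, z) \<partial>?N) = g \<omega>"
      unfolding \<psi>_def prod.case by (subst nn_integral_cmult) (auto simp: inner)
  qed
  also have "\<dots> = (\<integral>\<^sup>+\<omega>. g \<omega> \<partial>M)"
    by (rule nn_integral_subalgebra2[OF sub g])
  finally show ?thesis .
qed

text \<open>Independence is required from all of \<open>F s\<close> and not just from the past of
  \<open>Z\<close>, because integrands may depend on a second Brownian motion. The null sets in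
  \<open>F_null\<close> keep almost sure limits of adapted variables adapted.\<close>

locale filtered_BM = prob_space M for M :: "'a measure" +
  fixes F :: "real \<Rightarrow> 'a measure" and Z :: "real \<Rightarrow> 'a \<Rightarrow> real"
  assumes F_sub: "0 \<le> t \<Longrightarrow> subalgebra M (F t)"
    and F_mono: "0 \<le> s \<Longrightarrow> s \<le> t \<Longrightarrow> sets (F s) \<subseteq> sets (F t)"
    and F_null: "0 \<le> t \<Longrightarrow> null_sets M \<subseteq> sets (F t)"
    and Z_adapted: "0 \<le> t \<Longrightarrow> Z t \<in> borel_measurable (F t)"
    and Z_indep: "0 \<le> s \<Longrightarrow> s < t \<Longrightarrow> A \<in> sets (F s) \<Longrightarrow> C \<in> sets borel \<Longrightarrow>
      prob (A \<inter> ((\<lambda>\<omega>. Z t \<omega> - Z s \<omega>) -` C \<inter> space M)) =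
      prob A * prob ((\<lambda>\<omega>. Z t \<omega> - Z s \<omega>) -` C \<inter> space M)"
    and Z_normal: "0 \<le> s \<Longrightarrow> s < t \<Longrightarrow>
      distributed M lborel (\<lambda>\<omega>. Z t \<omega> - Z s \<omega>) (normal_density 0 (sqrt (t - s)))"
begin

lemma space_F: "0 \<le> t \<Longrightarrow> space (F t) = space M"
  using F_sub by (auto simp: subalgebra_def)

lemma F_events: "0 \<le> t \<Longrightarrow> sets (F t) \<subseteq> events"
  using F_sub by (auto simp: subalgebra_def)

lemma measurable_F_M: "0 \<le> t \<Longrightarrow> f \<in> F t \<rightarrow>\<^sub>M N \<Longrightarrow> f \<in> M \<rightarrow>\<^sub>M N"
  by (rule measurable_from_subalg[OF F_sub])

lemma measurable_F_mono:
  assumes "0 \<le> s" "s \<le> t" "f \<in> F s \<rightarrow>\<^sub>M N"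
  shows "f \<in> F t \<rightarrow>\<^sub>M N"
  using assms F_mono[of s t] space_F[of s] space_F[of t] by (auto simp: measurable_def)

lemma Z_meas: "0 \<le> t \<Longrightarrow> Z t \<in> borel_measurable M"
  by (rule measurable_F_M[OF _ Z_adapted])

lemma exp_increment:
  assumes "0 \<le> s" "s \<le> t"
    and "g \<in> borel_measurable (F s)" "\<xi> \<in> borel_measurable (F s)"
  shows "(\<integral>\<^sup>+\<omega>. g \<omega> * ennreal (exp (\<xi> \<omega> * (Z t \<omega> - Z s \<omega>) - (\<xi> \<omega>)\<^sup>2 * (t - s) / 2)) \<partial>M)
    = (\<integral>\<^sup>+\<omega>. g \<omega> \<partial>M)"
\<comment> \<open>A zero increment has no density, so the normal law is available only for
  \<open>s < t\<close>, while \<open>exp_grid\<close> allows repeated grid points.\<close>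
proof (cases "s = t")
  case False
  with assms have "s < t" by simp
  then have "0 < sqrt (t - s)" "(sqrt (t - s))\<^sup>2 = t - s"
    by simp_all
  then show ?thesis
    using nn_integral_exp_indep_normal[where G="F s" and X="\<lambda>\<omega>. Z t \<omega> - Z s \<omega>" and \<tau>="sqrt (t - s)",
        OF F_sub[OF assms(1)] Z_normal[OF assms(1) \<open>s < t\<close>] _ _ assms(3,4)]
      Z_indep[OF assms(1) \<open>s < t\<close>] by metis
qed auto

text \<open>The last increment is integrated out first: \<open>g\<close> times the exponential of
  the earlier increments is measurable at time \<open>p n\<close> and serves as the weight in
  \<open>exp_increment\<close>.\<close>

lemma exp_grid:
  assumes p: "0 \<le> p 0" "\<And>j. j < n \<Longrightarrow> p j \<le> p (Suc j)"
    and g: "g \<in> borel_measurable (F (p 0))"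
    and \<eta>: "\<And>j. j < n \<Longrightarrow> \<eta> j \<in> borel_measurable (F (p j))"
  shows "(\<integral>\<^sup>+\<omega>. g \<omega> * ennreal (exp ((\<Sum>j<n. \<eta> j \<omega> * (Z (p (Suc j)) \<omega> - Z (p j) \<omega>))
      - (\<Sum>j<n. (\<eta> j \<omega>)\<^sup>2 * (p (Suc j) - p j)) / 2)) \<partial>M) = (\<integral>\<^sup>+\<omega>. g \<omega> \<partial>M)"
  using assms(2-)
proof (induction n)
  case 0
  then show ?case by simp
next
  case (Suc n)
  have mono: "p i \<le> p j" if "i \<le> j" "j \<le> Suc n" for i j
    using that(1,2)
  proof (induction j rule: dec_induct)
    case (step k)
    then show ?case
      using Suc.prems(1)[of k] by simp
  qed simp
  have nonneg: "0 \<le> p j" if "j \<le> Suc n" for j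
    using p(1) mono[OF le0 that] by (rule order_trans)
  let ?g = "\<lambda>\<omega>. g \<omega> * ennreal (exp ((\<Sum>j<n. \<eta> j \<omega> * (Z (p (Suc j)) \<omega> - Z (p j) \<omega>))
      - (\<Sum>j<n. (\<eta> j \<omega>)\<^sup>2 * (p (Suc j) - p j)) / 2))"
  have [measurable]: "g \<in> borel_measurable (F (p n))"
    by (rule measurable_F_mono[OF p(1) mono Suc.prems(2)]) simp_all
  have [measurable]: "\<eta> j \<in> borel_measurable (F (p n))" if "j \<le> n" for j
  proof -
    have j: "j \<le> Suc n" "j < Suc n" using that by simp_all
    show ?thesis
      by (rule measurable_F_mono[OF nonneg[OF j(1)] mono[OF that] Suc.prems(3)[OF j(2)]]) simp
  qed
  have [measurable]: "Z (p j) \<in> borel_measurable (F (p n))" if "j \<le> n" for j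
  proof -
    have j: "j \<le> Suc n" using that by simp
    show ?thesis
      by (rule measurable_F_mono[OF nonneg[OF j] mono[OF that] Z_adapted[OF nonneg[OF j]]]) simp
  qed
  have g': "?g \<in> borel_measurable (F (p n))"
    by measurable
  have "(\<integral>\<^sup>+\<omega>. g \<omega> * ennreal (exp ((\<Sum>j<Suc n. \<eta> j \<omega> * (Z (p (Suc j)) \<omega> - Z (p j) \<omega>))
      - (\<Sum>j<Suc n. (\<eta> j \<omega>)\<^sup>2 * (p (Suc j) - p j)) / 2)) \<partial>M)
    = (\<integral>\<^sup>+\<omega>. ?g \<omega> * ennreal (exp (\<eta> n \<omega> * (Z (p (Suc n)) \<omega> - Z (p n) \<omega>)
        - (\<eta> n \<omega>)\<^sup>2 * (p (Suc n) - p n) / 2)) \<partial>M)"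
  proof (intro nn_integral_cong)
    fix \<omega>
    have exp_split: "c * ennreal (exp (a + a' - (b + b') / 2)) = c * ennreal (exp (a - b / 2)) * ennreal (exp (a' - b' / 2))"
      for a a' b b' :: real and c :: ennreal
    proof -
      have "a + a' - (b + b') / 2 = (a - b / 2) + (a' - b' / 2)"
        by (simp add: field_simps)
      then show ?thesis
        by (simp only: exp_add ennreal_mult'[OF exp_ge_zero] mult.assoc)
    qed
    show "g \<omega> * ennreal (exp ((\<Sum>j<Suc n. \<eta> j \<omega> * (Z (p (Suc j)) \<omega> - Z (p j) \<omega>))
      - (\<Sum>j<Suc n. (\<eta> j \<omega>)\<^sup>2 * (p (Suc j) - p j)) / 2)) = ?g \<omega> * ennreal (exp (\<eta> n \<omega> * (Z (p (Suc n)) \<omega> - Z (p n) \<omega>)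
        - (\<eta> n \<omega>)\<^sup>2 * (p (Suc n) - p n) / 2))"
      unfolding sum.lessThan_Suc exp_split ..
  qed
  also have "\<dots> = (\<integral>\<^sup>+\<omega>. ?g \<omega> \<partial>M)"
    using exp_increment[OF nonneg[of n] mono[of n "Suc n"] g' Suc.prems(3)[of n]] by simp
  also have "\<dots> = (\<integral>\<^sup>+\<omega>. g \<omega> \<partial>M)"
  proof (rule Suc.IH)
    show "p j \<le> p (Suc j)" "\<eta> j \<in> borel_measurable (F (p j))" if "j < n" for j
      using that Suc.prems(1,3)[of j] by simp_all
  qed fact
  finally show ?case .
qed

end

section \<open>Overlapping intervals on a common grid\<close>

lemma finite_set_grid:
  fixes G :: "real set"
  assumes "finite G" "s \<in> G" "\<And>x. x \<in> G \<Longrightarrow> s \<le> x"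
  shows "\<exists>(n :: nat) p. p 0 = s \<and> p ` {..n} = G \<and> (\<forall>i j. i < j \<longrightarrow> j \<le> n \<longrightarrow> p i < (p j :: real))"
proof -
  define l where "l = sorted_list_of_set G"
  have set: "set l = G" and sorted: "sorted_wrt (<) l"
    using assms by (simp_all add: l_def)
  have len: "length l > 0"
    using set assms by auto
  have less: "l ! i < l ! j" if "i < j" "j \<le> length l - 1" for i j
    using sorted_wrt_nth_less[OF sorted that(1)] that len by simp
  have img: "(!) l ` {..length l - 1} = G"
  proof -
    have "{..length l - 1} = {..<length l}" using len by (cases "length l") auto
    then show ?thesis by (auto simp: set[symmetric] set_conv_nth)
  qed
  obtain k where k: "k < length l" "l ! k = s"
    using set assms by (metis in_set_conv_nth)
  have "k \<le> length l - 1" using k by simp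
  have "l ! 0 \<in> G"
    using len set by auto
  then have "s \<le> l ! 0" using assms by blast
  moreover have "k = 0"
    using less[of 0 k] k \<open>s \<le> l ! 0\<close> \<open>k \<le> length l - 1\<close> by (cases "k = 0") auto
  ultimately have "l ! 0 = s" using k by simp
  then show ?thesis
    using img less by blast
qed

text \<open>Strict monotonicity turns comparisons of grid points into comparisons of indices, so the
  cells inside the interval are exactly those with index from \<open>a\<close> up to but excluding
  \<open>b\<close>.\<close>

lemma sum_grid_telescope:
  fixes p :: "nat \<Rightarrow> real" and f :: "real \<Rightarrow> real"
  assumes less: "\<And>i j. i < j \<Longrightarrow> j \<le> n \<Longrightarrow> p i < p j"
    and ab: "a \<le> b" "b \<le> n"
  shows "(\<Sum>j<n. (if p a \<le> p j \<and> p (Suc j) \<le> p b then f (p (Suc j)) - f (p j) else 0)) = f (p b) - f (p a)"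
proof -
  have iff: "p i \<le> p j \<longleftrightarrow> i \<le> j" if "i \<le> n" "j \<le> n" for i j
    using less[of i j] less[of j i] that by (cases i j rule: linorder_cases) auto
  have "(\<Sum>j<n. (if p a \<le> p j \<and> p (Suc j) \<le> p b then f (p (Suc j)) - f (p j) else 0))
      = (\<Sum>j\<in>{a..<b}. f (p (Suc j)) - f (p j))"
    by (rule sum.mono_neutral_cong_right) (use ab iff in \<open>auto simp: Suc_le_eq\<close>)
  also have "\<dots> = f (p b) - f (p a)"
    by (rule sum_Suc_diff'[OF ab(1), of "\<lambda>j. f (p j)"])
  finally show ?thesis .
qed

lemma sum_orthogonal_square:
  fixes c :: "'i \<Rightarrow> real"
  assumes "finite J" "\<And>i j. i \<in> J \<Longrightarrow> j \<in> J \<Longrightarrow> i \<noteq> j \<Longrightarrow> c i * c j = 0"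
  shows "(\<Sum>j\<in>J. c j)\<^sup>2 = (\<Sum>j\<in>J. (c j)\<^sup>2)"
proof -
  have "(\<Sum>j\<in>J. c j)\<^sup>2 = (\<Sum>i\<in>J. \<Sum>j\<in>J. c i * c j)"
    by (simp add: power2_eq_square sum_product)
  also have "\<dots> = (\<Sum>i\<in>J. \<Sum>j\<in>J. if i = j then (c i)\<^sup>2 else 0)"
    by (intro sum.cong refl) (auto simp: assms power2_eq_square)
  also have "\<dots> = (\<Sum>j\<in>J. (c j)\<^sup>2)"
    using assms(1) by simp
  finally show ?thesis .
qed

context filtered_BM
begin

text \<open>The intervals \<open>(u i, v i]\<close> may overlap; the step function is rewritten on a common grid.\<close>

lemma exp_step_process:
  fixes u v :: "'i \<Rightarrow> real"
  assumes N: "finite N" and s: "0 \<le> s"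
    and u: "\<And>i. i \<in> N \<Longrightarrow> s \<le> u i" and uv: "\<And>i. i \<in> N \<Longrightarrow> u i \<le> v i"
    and \<xi>: "\<And>i. i \<in> N \<Longrightarrow> u i < v i \<Longrightarrow> \<xi> i \<in> borel_measurable (F (u i))"
    and g: "g \<in> borel_measurable (F s)"
  shows "(\<integral>\<^sup>+\<omega>. g \<omega> * ennreal (exp ((\<Sum>i\<in>N. \<xi> i \<omega> * (Z (v i) \<omega> - Z (u i) \<omega>))
      - (LINT r|lborel. (\<Sum>i\<in>N. \<xi> i \<omega> * indicator {u i<..v i} r)\<^sup>2) / 2)) \<partial>M) = (\<integral>\<^sup>+\<omega>. g \<omega> \<partial>M)"
proof -
  define G where "G = insert s (u ` N \<union> v ` N)"
  have "finite G" "s \<in> G" using N by (auto simp: G_def)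
  moreover have "s \<le> x" if "x \<in> G" for x
    using that order_trans[OF u uv] u by (auto simp: G_def)
  ultimately obtain n :: nat and p where p0: "p 0 = s" and img: "p ` {..n} = G"
    and less: "\<And>i j. i < j \<Longrightarrow> j \<le> n \<Longrightarrow> p i < p j"
    using finite_set_grid[of G s] by blast
  have le: "p i \<le> p j" if "i \<le> j" "j \<le> n" for i j
    using less[of i j] that by (cases "i = j") auto
  \<comment> \<open>The value of the step function on the cell from \<open>p j\<close> to
    \<open>p (Suc j)\<close>: the coefficients of all intervals that contain the cell.\<close>
  define \<eta> where "\<eta> j \<omega> = (\<Sum>i\<in>N. if u i \<le> p j \<and> p (Suc j) \<le> v i then \<xi> i \<omega> else 0)" for j \<omega>
  \<comment> \<open>Kept general in \<open>f\<close> because it serves twice. With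
    \<open>f q = Z q \<omega>\<close> it rewrites the stochastic integral; with
    \<open>f q = of_bool (q \<ge> r)\<close>, whose increments are the indicators of left-open
    intervals, it rewrites the step function.\<close>
  have tele: "(\<Sum>i\<in>N. \<xi> i \<omega> * (f (v i) - f (u i))) = (\<Sum>j<n. \<eta> j \<omega> * (f (p (Suc j)) - f (p j)))" for f \<omega>
  proof -
    have "f (v i) - f (u i) = (\<Sum>j<n. if u i \<le> p j \<and> p (Suc j) \<le> v i then f (p (Suc j)) - f (p j) else 0)"
      if "i \<in> N" for i
    proof -
      have "u i \<in> p ` {..n}" "v i \<in> p ` {..n}"
        using that by (auto simp: img G_def)
      then obtain a b where ab: "u i = p a" "v i = p b" "a \<le> n" "b \<le> n"
        by auto
      have "a \<le> b"
        using uv[OF that] less[of b a] ab by (metis not_le)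
      then show ?thesis
        using sum_grid_telescope[where p = p and f = f and a = a and b = b and n = n, OF less] ab by simp
    qed
    then have "(\<Sum>i\<in>N. \<xi> i \<omega> * (f (v i) - f (u i))) =
      (\<Sum>i\<in>N. \<Sum>j<n. (if u i \<le> p j \<and> p (Suc j) \<le> v i then \<xi> i \<omega> else 0) * (f (p (Suc j)) - f (p j)))"
      by (intro sum.cong refl) (auto simp: sum_distrib_left intro!: sum.cong)
    also have "\<dots> = (\<Sum>j<n. \<eta> j \<omega> * (f (p (Suc j)) - f (p j)))"
      unfolding \<eta>_def sum_distrib_right by (rule sum.swap)
    finally show ?thesis .
  qed
  have square: "(\<Sum>i\<in>N. \<xi> i \<omega> * indicator {u i<..v i} r)\<^sup>2
      = (\<Sum>j<n. (\<eta> j \<omega>)\<^sup>2 * indicator {p j<..p (Suc j)} r)" for \<omega> r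
  proof -
    have ind: "indicator {a<..b} r = (of_bool (b \<ge> r) :: real) - of_bool (a \<ge> r)" if "a \<le> b" for a b
      using that by (auto simp: indicator_def)
    have "(\<Sum>i\<in>N. \<xi> i \<omega> * indicator {u i<..v i} r) = (\<Sum>i\<in>N. \<xi> i \<omega> * (of_bool (v i \<ge> r) - of_bool (u i \<ge> r)))"
      by (intro sum.cong refl) (simp add: ind uv)
    also have "\<dots> = (\<Sum>j<n. \<eta> j \<omega> * (of_bool (p (Suc j) \<ge> r) - of_bool (p j \<ge> r)))"
      by (rule tele)
    also have "\<dots> = (\<Sum>j<n. \<eta> j \<omega> * indicator {p j<..p (Suc j)} r)"
      by (intro sum.cong refl) (simp add: ind le)
    finally have eq: "(\<Sum>i\<in>N. \<xi> i \<omega> * indicator {u i<..v i} r)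
      = (\<Sum>j<n. \<eta> j \<omega> * indicator {p j<..p (Suc j)} r)" .
    have disj: "indicator {p i<..p (Suc i)} r * indicator {p j<..p (Suc j)} r = (0::real)"
      if "i < j" "j < n" for i j
    proof -
      have "p (Suc i) \<le> p j" using that by (intro le) auto
      then show ?thesis by (auto simp: indicator_def)
    qed
    have indicator_power: "(indicator A r)\<^sup>2 = (indicator A r :: real)" for A
      by (simp add: indicator_def)
    have orth: "(\<eta> i \<omega> * indicator {p i<..p (Suc i)} r) * (\<eta> j \<omega> * indicator {p j<..p (Suc j)} r) = 0"
      if "i \<in> {..<n}" "j \<in> {..<n}" "i \<noteq> j" for i j
    proof (cases "i < j")
      case True
      then show ?thesis using disj[of i j] that by auto
    next
      case False
      then show ?thesis using disj[of j i] that by auto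
    qed
    have "(\<Sum>j<n. \<eta> j \<omega> * indicator {p j<..p (Suc j)} r)\<^sup>2
        = (\<Sum>j<n. (\<eta> j \<omega> * indicator {p j<..p (Suc j)} r)\<^sup>2)"
      by (rule sum_orthogonal_square[OF finite_lessThan orth])
    then show ?thesis
      unfolding eq by (simp add: power_mult_distrib indicator_power)
  qed
  have energy: "(LINT r|lborel. (\<Sum>i\<in>N. \<xi> i \<omega> * indicator {u i<..v i} r)\<^sup>2)
      = (\<Sum>j<n. (\<eta> j \<omega>)\<^sup>2 * (p (Suc j) - p j))" for \<omega>
    unfolding square using le by (subst Bochner_Integration.integral_sum) auto
  have nonneg: "0 \<le> p j" if "j \<le> n" for j
    using s le[OF le0 that] by (simp add: p0)
  have meas: "\<eta> j \<in> borel_measurable (F (p j))" if j: "j < n" for j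
    unfolding \<eta>_def
  proof (intro borel_measurable_sum)
    fix i assume i: "i \<in> N"
    show "(\<lambda>\<omega>. if u i \<le> p j \<and> p (Suc j) \<le> v i then \<xi> i \<omega> else 0) \<in> borel_measurable (F (p j))"
    proof (cases "u i \<le> p j \<and> p (Suc j) \<le> v i")
      case True
      \<comment> \<open>Grid cells are nondegenerate, so an interval containing one is nondegenerate
        as well and its coefficient is covered by the measurability hypothesis.\<close>
      have "p j < p (Suc j)" using less[of j "Suc j"] j by simp
      then have "u i < v i" using True by simp
      have "\<xi> i \<in> borel_measurable (F (p j))"
        by (rule measurable_F_mono[OF order_trans[OF s u[OF i]] conjunct1[OF True] \<xi>[OF i \<open>u i < v i\<close>]])
      then show ?thesis using True by simp
    qed auto
  qed
  have "(\<integral>\<^sup>+\<omega>. g \<omega> * ennreal (exp ((\<Sum>j<n. \<eta> j \<omega> * (Z (p (Suc j)) \<omega> - Z (p j) \<omega>))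
      - (\<Sum>j<n. (\<eta> j \<omega>)\<^sup>2 * (p (Suc j) - p j)) / 2)) \<partial>M) = (\<integral>\<^sup>+\<omega>. g \<omega> \<partial>M)"
  proof (rule exp_grid)
    show "0 \<le> p 0" "g \<in> borel_measurable (F (p 0))" using s g by (simp_all add: p0)
    show "p j \<le> p (Suc j)" if "j < n" for j using le[of j "Suc j"] that by simp
  qed (rule meas)
  then show ?thesis
    unfolding energy tele[of _ "\<lambda>q. Z q _"] .
qed

end

section \<open>Convergence in probability\<close>

context prob_space
begin

text \<open>Convergence to 0 in probability. Measurability is included because the measure of a
  non-measurable set defaults to 0; values are extended reals because an approximation error may be
  infinite.\<close>

definition vanish_prob :: "(nat \<Rightarrow> 'a \<Rightarrow> ennreal) \<Rightarrow> bool" where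
  "vanish_prob f \<longleftrightarrow> (\<forall>k. f k \<in> borel_measurable M) \<and>
     (\<forall>\<epsilon>>0. (\<lambda>k. prob {\<omega> \<in> space M. f k \<omega> > ennreal \<epsilon>}) \<longlonglongrightarrow> 0)"

lemma vanish_probD: "vanish_prob f \<Longrightarrow> f k \<in> borel_measurable M"
  by (simp add: vanish_prob_def)

lemma vanish_prob_mono:
  assumes f: "vanish_prob f" and g: "\<And>k. g k \<in> borel_measurable M"
    and le: "\<And>k \<omega>. \<omega> \<in> space M \<Longrightarrow> g k \<omega> \<le> f k \<omega>"
  shows "vanish_prob g"
  unfolding vanish_prob_def
proof (intro conjI allI impI)
  fix \<epsilon> :: real assume "\<epsilon> > 0"
  then have lim: "(\<lambda>k. prob {\<omega> \<in> space M. f k \<omega> > ennreal \<epsilon>}) \<longlonglongrightarrow> 0"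
    using f by (simp add: vanish_prob_def)
  have [measurable]: "f k \<in> borel_measurable M" for k
    using f by (rule vanish_probD)
  show "(\<lambda>k. prob {\<omega> \<in> space M. g k \<omega> > ennreal \<epsilon>}) \<longlonglongrightarrow> 0"
  proof (rule tendsto_sandwich[OF _ _ tendsto_const lim])
    show "\<forall>\<^sub>F k in sequentially. prob {\<omega> \<in> space M. ennreal \<epsilon> < g k \<omega>} \<le> prob {\<omega> \<in> space M. ennreal \<epsilon> < f k \<omega>}"
      by (intro always_eventually allI finite_measure_mono) (auto intro: less_le_trans le)
  qed simp
qed (rule g)

lemma vanish_prob_add:
  assumes f: "vanish_prob f" and g: "vanish_prob g"
  shows "vanish_prob (\<lambda>k \<omega>. f k \<omega> + g k \<omega>)"
  unfolding vanish_prob_def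
proof (intro conjI allI impI)
  have [measurable]: "f k \<in> borel_measurable M" "g k \<in> borel_measurable M" for k
    using f g by (auto intro: vanish_probD)
  show "(\<lambda>\<omega>. f k \<omega> + g k \<omega>) \<in> borel_measurable M" for k
    by measurable
  fix \<epsilon> :: real assume "\<epsilon> > 0"
  have lim: "(\<lambda>k. prob {\<omega> \<in> space M. f k \<omega> > ennreal (\<epsilon> / 2)} + prob {\<omega> \<in> space M. g k \<omega> > ennreal (\<epsilon> / 2)}) \<longlonglongrightarrow> 0 + 0"
    using f g \<open>\<epsilon> > 0\<close> by (intro tendsto_add) (simp_all add: vanish_prob_def)
  show "(\<lambda>k. prob {\<omega> \<in> space M. f k \<omega> + g k \<omega> > ennreal \<epsilon>}) \<longlonglongrightarrow> 0"
  proof (rule tendsto_sandwich[OF _ _ tendsto_const lim[simplified]])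
    show "\<forall>\<^sub>F k in sequentially. prob {\<omega> \<in> space M. ennreal \<epsilon> < f k \<omega> + g k \<omega>} \<le>
        prob {\<omega> \<in> space M. ennreal (\<epsilon> / 2) < f k \<omega>} + prob {\<omega> \<in> space M. ennreal (\<epsilon> / 2) < g k \<omega>}"
    proof (intro always_eventually allI)
      fix k
      have "{\<omega> \<in> space M. ennreal \<epsilon> < f k \<omega> + g k \<omega>} \<subseteq>
          {\<omega> \<in> space M. ennreal (\<epsilon> / 2) < f k \<omega>} \<union> {\<omega> \<in> space M. ennreal (\<epsilon> / 2) < g k \<omega>}"
      proof
        fix \<omega> assume "\<omega> \<in> {\<omega> \<in> space M. ennreal \<epsilon> < f k \<omega> + g k \<omega>}"
        moreover have "ennreal \<epsilon> = ennreal (\<epsilon> / 2) + ennreal (\<epsilon> / 2)"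
          using \<open>\<epsilon> > 0\<close> by (simp flip: ennreal_plus)
        ultimately have "\<not> (f k \<omega> \<le> ennreal (\<epsilon> / 2) \<and> g k \<omega> \<le> ennreal (\<epsilon> / 2))" "\<omega> \<in> space M"
          using add_mono[of "f k \<omega>" "ennreal (\<epsilon> / 2)" "g k \<omega>" "ennreal (\<epsilon> / 2)"] by auto
        then show "\<omega> \<in> {\<omega> \<in> space M. ennreal (\<epsilon> / 2) < f k \<omega>} \<union> {\<omega> \<in> space M. ennreal (\<epsilon> / 2) < g k \<omega>}"
          by (auto simp: not_le)
      qed
      then have "prob {\<omega> \<in> space M. ennreal \<epsilon> < f k \<omega> + g k \<omega>} \<le>
          prob ({\<omega> \<in> space M. ennreal (\<epsilon> / 2) < f k \<omega>} \<union> {\<omega> \<in> space M. ennreal (\<epsilon> / 2) < g k \<omega>})"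
        by (intro finite_measure_mono) auto
      also have "\<dots> \<le> prob {\<omega> \<in> space M. ennreal (\<epsilon> / 2) < f k \<omega>} + prob {\<omega> \<in> space M. ennreal (\<epsilon> / 2) < g k \<omega>}"
        by (intro measure_Un_le) auto
      finally show "prob {\<omega> \<in> space M. ennreal \<epsilon> < f k \<omega> + g k \<omega>} \<le> \<dots>" .
    qed
  qed simp
qed

text \<open>Along a suitable subsequence the probability of exceeding \<open>(1/2) ^ j\<close> is
  itself below \<open>(1/2) ^ j\<close>. These bounds are summable, so by Borel-Cantelli almost
  every scenario exceeds only finitely often.\<close>

lemma vanish_prob_AE_subseq:
  assumes f: "vanish_prob f"
  obtains r where "strict_mono r" "AE \<omega> in M. (\<lambda>k. f (r k) \<omega>) \<longlonglongrightarrow> 0"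
proof -
  have [measurable]: "f k \<in> borel_measurable M" for k
    using f by (rule vanish_probD)
  define P where "P j k \<longleftrightarrow> prob {\<omega> \<in> space M. f k \<omega> > ennreal ((1/2) ^ j)} < (1/2) ^ j" for j k
  have ev: "\<forall>\<^sub>F k in sequentially. P j k" for j
  proof -
    have "(\<lambda>k. prob {\<omega> \<in> space M. f k \<omega> > ennreal ((1/2) ^ j)}) \<longlonglongrightarrow> 0"
      using f by (simp add: vanish_prob_def)
    then show ?thesis
      unfolding P_def by (rule order_tendstoD) simp
  qed
  have "\<exists>r. \<forall>j. P j (r j) \<and> r j < r (Suc j)"
  proof (rule dependent_nat_choice)
    show "\<exists>k. P 0 k"
      using ev[of 0] by (rule eventually_happens'[OF sequentially_bot])
    show "\<exists>k'. P (Suc j) k' \<and> k < k'" for k j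
    proof -
      have "\<forall>\<^sub>F k' in sequentially. P (Suc j) k' \<and> k < k'"
        using ev[of "Suc j"] eventually_gt_at_top[of k] by (rule eventually_conj)
      then show ?thesis
        by (rule eventually_happens'[OF sequentially_bot])
    qed
  qed
  then obtain r where r': "\<forall>j. P j (r j) \<and> r j < r (Suc j)" ..
  have r: "P j (r j)" "r j < r (Suc j)" for j
    using r' by simp_all
  define A where "A j = {\<omega> \<in> space M. f (r j) \<omega> > ennreal ((1/2) ^ j)}" for j
  have "AE \<omega> in M. \<forall>\<^sub>F j in sequentially. \<omega> \<in> space M - A j"
  proof (rule borel_cantelli_AE1)
    show "summable (\<lambda>j. prob (A j))"
    proof (rule summable_comparison_test[OF _ summable_geometric[of "1/2 :: real"]])
      show "\<exists>N. \<forall>n\<ge>N. norm (prob (A n)) \<le> (1/2) ^ n"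
      proof (intro exI[of _ 0] allI impI)
        show "norm (prob (A n)) \<le> (1/2) ^ n" for n
          using r(1)[of n] by (simp add: A_def P_def)
      qed
    qed simp
  qed (auto simp: A_def emeasure_eq_measure)
  then have "AE \<omega> in M. (\<lambda>k. f (r k) \<omega>) \<longlonglongrightarrow> 0"
  proof eventually_elim
    case (elim \<omega>)
    have lim: "(\<lambda>j. ennreal ((1/2) ^ j)) \<longlonglongrightarrow> 0"
      using tendsto_ennrealI[OF LIMSEQ_power_zero[of "1/2 :: real"]] by simp
    have "\<forall>\<^sub>F j in sequentially. f (r j) \<omega> \<le> ennreal ((1/2) ^ j)"
      using elim by eventually_elim (auto simp: A_def not_less)
    then show ?case
      by (intro tendsto_sandwich[OF _ _ tendsto_const lim]) simp_all
  qed
  then show ?thesis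
    using that[of r] r(2) by (simp add: strict_mono_Suc_iff)
qed

lemma vanish_prob_abs_iff:
  "vanish_prob (\<lambda>k \<omega>. ennreal \<bar>X k \<omega>\<bar>) \<longleftrightarrow> (\<forall>k. (\<lambda>\<omega>. \<bar>X k \<omega>\<bar>) \<in> borel_measurable M) \<and>
    (\<forall>\<epsilon>>0. (\<lambda>k. prob {\<omega> \<in> space M. \<bar>X k \<omega>\<bar> > \<epsilon>}) \<longlonglongrightarrow> 0)"
proof -
  have "(\<lambda>\<omega>. \<bar>X k \<omega>\<bar>) \<in> borel_measurable M" if "(\<lambda>\<omega>. ennreal \<bar>X k \<omega>\<bar>) \<in> borel_measurable M" for k
  proof -
    have "(\<lambda>\<omega>. enn2real (ennreal \<bar>X k \<omega>\<bar>)) \<in> borel_measurable M"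
      using that by measurable
    then show ?thesis by simp
  qed
  then show ?thesis
    unfolding vanish_prob_def by (auto simp: ennreal_less_iff)
qed

end

context filtered_BM
begin

text \<open>The index type is arbitrary so that two step processes can be joined over a disjoint sum
  of index sets. Empty intervals carry no measurability condition: cutting a simple process off at
  time \<open>t\<close> collapses the intervals beyond \<open>t\<close>, whose coefficients are
  known only later.\<close>

definition step_data :: "real \<Rightarrow> 'i set \<Rightarrow> ('i \<Rightarrow> real) \<Rightarrow> ('i \<Rightarrow> real) \<Rightarrow> ('i \<Rightarrow> 'a \<Rightarrow> real) \<Rightarrow> bool" where
  "step_data s N u v \<xi> \<longleftrightarrow> finite N \<and> 0 \<le> s \<and> (\<forall>i\<in>N. s \<le> u i \<and> u i \<le> v i \<and>
     (u i < v i \<longrightarrow> \<xi> i \<in> borel_measurable (F (u i))))"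

definition step_int :: "'i set \<Rightarrow> ('i \<Rightarrow> real) \<Rightarrow> ('i \<Rightarrow> real) \<Rightarrow> ('i \<Rightarrow> 'a \<Rightarrow> real) \<Rightarrow> 'a \<Rightarrow> real" where
  "step_int N u v \<xi> \<omega> = (\<Sum>i\<in>N. \<xi> i \<omega> * (Z (v i) \<omega> - Z (u i) \<omega>))"

definition step_fun :: "'i set \<Rightarrow> ('i \<Rightarrow> real) \<Rightarrow> ('i \<Rightarrow> real) \<Rightarrow> ('i \<Rightarrow> 'a \<Rightarrow> real) \<Rightarrow> real \<Rightarrow> 'a \<Rightarrow> real" where
  "step_fun N u v \<xi> r \<omega> = (\<Sum>i\<in>N. \<xi> i \<omega> * indicator {u i<..v i} r)"

lemma step_measurable:
  assumes "step_data s N u v \<xi>"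
  shows step_int_measurable: "step_int N u v \<xi> \<in> borel_measurable M"
    and step_fun_measurable: "(\<lambda>(\<omega>, r). step_fun N u v \<xi> r \<omega>) \<in> borel_measurable (M \<Otimes>\<^sub>M lborel)"
proof -
  have nonneg: "0 \<le> u i" "0 \<le> v i" if "i \<in> N" for i
  proof -
    have "0 \<le> s" "s \<le> u i" "u i \<le> v i"
      using assms that by (simp_all add: step_data_def)
    then show "0 \<le> u i" "0 \<le> v i" by simp_all
  qed
  have \<xi>: "\<xi> i \<in> borel_measurable M" if "i \<in> N" "u i < v i" for i
  proof (rule measurable_F_M[OF nonneg(1)[OF that(1)]])
    show "\<xi> i \<in> borel_measurable (F (u i))"
      using assms that by (simp add: step_data_def)
  qed
  show "step_int N u v \<xi> \<in> borel_measurable M"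
    unfolding step_int_def[abs_def]
  proof (intro borel_measurable_sum)
    fix i assume i: "i \<in> N"
    show "(\<lambda>\<omega>. \<xi> i \<omega> * (Z (v i) \<omega> - Z (u i) \<omega>)) \<in> borel_measurable M"
    proof (cases "u i < v i")
      case True
      show ?thesis
        by (intro borel_measurable_times borel_measurable_diff \<xi>[OF i True] Z_meas nonneg i)
    next
      case False
      then have "v i = u i" using assms i by (auto simp: step_data_def)
      then show ?thesis by simp
    qed
  qed
  show "(\<lambda>(\<omega>, r). step_fun N u v \<xi> r \<omega>) \<in> borel_measurable (M \<Otimes>\<^sub>M lborel)"
    unfolding step_fun_def[abs_def] split_beta'
  proof (intro borel_measurable_sum)
    fix i assume i: "i \<in> N"
    show "(\<lambda>x. \<xi> i (fst x) * indicator {u i<..v i} (snd x)) \<in> borel_measurable (M \<Otimes>\<^sub>M lborel)"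
    proof (cases "u i < v i")
      case True
      note [measurable] = \<xi>[OF i True]
      show ?thesis by measurable
    next
      case False
      then have "{u i<..v i} = {}" by simp
      then show ?thesis by simp
    qed
  qed
qed

text \<open>Ensures that the Lebesgue integral of the square is genuine and not the default 0. The
  expanded square is a finite combination of indicators of bounded sets.\<close>

lemma step_energy:
  assumes "step_data s N u v \<xi>"
  shows "integrable lborel (\<lambda>r. (step_fun N u v \<xi> r \<omega>)\<^sup>2)"
proof -
  have "integrable lborel (\<lambda>r. step_fun N u v \<xi> r \<omega> * (\<xi> i \<omega> * indicator {u i<..v i} r))" if "i \<in> N" for i
  proof -
    have "integrable lborel (\<lambda>r. \<xi> j \<omega> * indicator {u j<..v j} r * (\<xi> i \<omega> * indicator {u i<..v i} r))"
      if "j \<in> N" for j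
    proof -
      have "integrable lborel (\<lambda>r. \<xi> j \<omega> * \<xi> i \<omega> * indicator ({u j<..v j} \<inter> {u i<..v i}) r)"
      proof (intro integrable_mult_right integrable_real_indicator)
        have "emeasure lborel ({u j<..v j} \<inter> {u i<..v i}) \<le> emeasure lborel {u j<..v j}"
          by (intro emeasure_mono) auto
        also have "\<dots> < \<infinity>"
          using assms that by (simp add: step_data_def)
        finally show "emeasure lborel ({u j<..v j} \<inter> {u i<..v i}) < \<infinity>" .
      qed auto
      also have "(\<lambda>r. \<xi> j \<omega> * \<xi> i \<omega> * indicator ({u j<..v j} \<inter> {u i<..v i}) r)
          = (\<lambda>r. \<xi> j \<omega> * indicator {u j<..v j} r * (\<xi> i \<omega> * indicator {u i<..v i} r))"
        by (simp only: indicator_inter_arith mult_ac)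
      finally show ?thesis .
    qed
    then show ?thesis
      unfolding step_fun_def sum_distrib_right by (intro Bochner_Integration.integrable_sum)
  qed
  then have "integrable lborel (\<lambda>r. \<Sum>i\<in>N. step_fun N u v \<xi> r \<omega> * (\<xi> i \<omega> * indicator {u i<..v i} r))"
    by (intro Bochner_Integration.integrable_sum)
  also have "(\<lambda>r. \<Sum>i\<in>N. step_fun N u v \<xi> r \<omega> * (\<xi> i \<omega> * indicator {u i<..v i} r))
      = (\<lambda>r. (step_fun N u v \<xi> r \<omega>)\<^sup>2)"
    by (simp add: power2_eq_square step_fun_def sum_distrib_left)
  finally show ?thesis .
qed

lemma exp_step:
  assumes data: "step_data s N u v \<xi>" and g: "g \<in> borel_measurable (F s)"
  shows "(\<integral>\<^sup>+\<omega>. g \<omega> * ennreal (exp (c * step_int N u v \<xi> \<omega>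
      - c\<^sup>2 * (LINT r|lborel. (step_fun N u v \<xi> r \<omega>)\<^sup>2) / 2)) \<partial>M) = (\<integral>\<^sup>+\<omega>. g \<omega> \<partial>M)"
proof -
  have int: "(\<Sum>i\<in>N. (c * \<xi> i \<omega>) * (Z (v i) \<omega> - Z (u i) \<omega>)) = c * step_int N u v \<xi> \<omega>" for \<omega>
    unfolding step_int_def by (simp only: sum_distrib_left mult.assoc)
  have fun_eq: "(\<Sum>i\<in>N. (c * \<xi> i \<omega>) * indicator {u i<..v i} r) = c * step_fun N u v \<xi> r \<omega>" for r \<omega>
    unfolding step_fun_def by (simp only: sum_distrib_left mult.assoc)
  have energy: "(LINT r|lborel. (\<Sum>i\<in>N. (c * \<xi> i \<omega>) * indicator {u i<..v i} r)\<^sup>2)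
      = c\<^sup>2 * (LINT r|lborel. (step_fun N u v \<xi> r \<omega>)\<^sup>2)" for \<omega>
    unfolding fun_eq power_mult_distrib by (rule integral_mult_right_zero)
  show ?thesis
    unfolding int[symmetric] energy[symmetric]
  proof (rule exp_step_process[OF _ _ _ _ _ g])
    show "finite N" "0 \<le> s" using data by (simp_all add: step_data_def)
    fix i assume i: "i \<in> N"
    show "s \<le> u i" "u i \<le> v i" using data i by (simp_all add: step_data_def)
    assume "u i < v i"
    with data i have "\<xi> i \<in> borel_measurable (F (u i))" by (simp add: step_data_def)
    then show "(\<lambda>\<omega>. c * \<xi> i \<omega>) \<in> borel_measurable (F (u i))"
      by (intro borel_measurable_times borel_measurable_const)
  qed
qed

end

context filtered_BM
begin

section \<open>Lenglart's inequality for step processes\<close>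

lemma step_energy_measurable:
  assumes "step_data s N u v \<xi>"
  shows "(\<lambda>\<omega>. LINT r|lborel. (step_fun N u v \<xi> r \<omega>)\<^sup>2) \<in> borel_measurable M"
proof -
  note [measurable] = step_fun_measurable[OF assms]
  have "(\<lambda>(\<omega>, r). (step_fun N u v \<xi> r \<omega>)\<^sup>2) \<in> borel_measurable (M \<Otimes>\<^sub>M lborel)"
    by measurable
  then show ?thesis
    by (rule lborel.borel_measurable_lebesgue_integral)
qed

lemma exp_step_Markov:
  assumes data: "step_data s N u v \<xi>"
  shows "prob {\<omega> \<in> space M. 1 \<le> b * exp (c * step_int N u v \<xi> \<omega>
      - c\<^sup>2 * (LINT r|lborel. (step_fun N u v \<xi> r \<omega>)\<^sup>2) / 2)} \<le> \<bar>b\<bar>"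
proof -
  note [measurable] = step_int_measurable[OF data] step_energy_measurable[OF data]
  let ?e = "\<lambda>\<omega>. exp (c * step_int N u v \<xi> \<omega>
      - c\<^sup>2 * (LINT r|lborel. (step_fun N u v \<xi> r \<omega>)\<^sup>2) / 2)"
  have e: "(\<integral>\<^sup>+\<omega>. ennreal (?e \<omega>) \<partial>M) = 1"
    using exp_step[OF data, of "\<lambda>_. 1" c] by (simp add: emeasure_space_1)
  have "emeasure M {\<omega> \<in> space M. 1 \<le> b * ?e \<omega>}
      \<le> emeasure M {\<omega> \<in> space M. 1 \<le> ennreal \<bar>b\<bar> * ennreal (?e \<omega>)}"
  proof (intro emeasure_mono)
    show "{\<omega> \<in> space M. 1 \<le> b * ?e \<omega>} \<subseteq> {\<omega> \<in> space M. 1 \<le> ennreal \<bar>b\<bar> * ennreal (?e \<omega>)}"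
    proof safe
      fix \<omega> assume "1 \<le> b * ?e \<omega>"
      also have "\<dots> \<le> \<bar>b\<bar> * ?e \<omega>" by (intro mult_right_mono) simp_all
      finally show "1 \<le> ennreal \<bar>b\<bar> * ennreal (?e \<omega>)"
        by (simp add: ennreal_1[symmetric] ennreal_mult[symmetric] del: ennreal_1)
    qed
  qed measurable
  also have "\<dots> \<le> ennreal \<bar>b\<bar> * (\<integral>\<^sup>+\<omega>. ennreal (?e \<omega>) * indicator (space M) \<omega> \<partial>M)"
    by (rule nn_integral_Markov_inequality) simp_all
  also have "\<dots> = ennreal \<bar>b\<bar>"
    using e by (simp add: nn_integral_set_ennreal[symmetric] cong: nn_integral_cong_simp)
  finally show ?thesis
    by (simp add: emeasure_eq_measure)
qed

text \<open>If the energy is at most \<open>\<delta>\<close> and the integral exceeds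
  \<open>\<epsilon>\<close> in absolute value, then the exponential with parameter \<open>c\<close>
  or the one with \<open>- c\<close> is at least
  \<open>exp (c * \<epsilon> - c\<^sup>2 * \<delta> / 2)\<close>. Both have expectation 1, so
  Markov's inequality bounds each case. The parameter \<open>c\<close> stays free for later
  tuning.\<close>

lemma step_int_tail:
  assumes data: "step_data s N u v \<xi>" and c: "0 \<le> c"
  shows "prob {\<omega> \<in> space M. \<epsilon> < \<bar>step_int N u v \<xi> \<omega>\<bar>}
    \<le> prob {\<omega> \<in> space M. \<delta> < (LINT r|lborel. (step_fun N u v \<xi> r \<omega>)\<^sup>2)} + 2 * exp (c\<^sup>2 * \<delta> / 2 - c * \<epsilon>)"
proof -
  note [measurable] = step_int_measurable[OF data] step_energy_measurable[OF data]
  define U where "U = step_int N u v \<xi>"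
  define R where "R \<omega> = (LINT r|lborel. (step_fun N u v \<xi> r \<omega>)\<^sup>2)" for \<omega>
  define b where "b = exp (c\<^sup>2 * \<delta> / 2 - c * \<epsilon>)"
  have [measurable]: "U \<in> borel_measurable M" "R \<in> borel_measurable M"
    unfolding U_def R_def[abs_def] by measurable
  define A where "A a = {\<omega> \<in> space M. 1 \<le> b * exp (a * U \<omega> - a\<^sup>2 * R \<omega> / 2)}" for a
  define D where "D = {\<omega> \<in> space M. \<delta> < R \<omega>}"
  have [measurable]: "A a \<in> events" "D \<in> events" for a
    unfolding A_def D_def by measurable
  have A: "prob (A a) \<le> b" for a
    using exp_step_Markov[OF data, of b a] by (simp add: A_def U_def R_def b_def)
  have "\<omega> \<in> D \<union> (A c \<union> A (- c))" if \<omega>: "\<omega> \<in> space M" "\<epsilon> < \<bar>U \<omega>\<bar>" for \<omega>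
  proof (cases "R \<omega> \<le> \<delta>")
    case True
    then have R: "c\<^sup>2 * R \<omega> \<le> c\<^sup>2 * \<delta>" by (rule mult_left_mono) simp
    have "c * \<epsilon> \<le> c * \<bar>U \<omega>\<bar>" using c \<omega>(2) by (intro mult_left_mono) simp_all
    then have "c * \<epsilon> \<le> c * U \<omega> \<or> c * \<epsilon> \<le> (- c) * U \<omega>"
      by (cases "0 \<le> U \<omega>") (simp_all add: abs_if)
    then have "\<exists>a\<in>{c, - c}. c * \<epsilon> \<le> a * U \<omega> \<and> a\<^sup>2 = c\<^sup>2" by auto
    then obtain a where a: "a \<in> {c, - c}" "c * \<epsilon> \<le> a * U \<omega>" "a\<^sup>2 = c\<^sup>2" by blast
    have "0 \<le> (c\<^sup>2 * \<delta> / 2 - c * \<epsilon>) + (a * U \<omega> - a\<^sup>2 * R \<omega> / 2)"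
      unfolding a(3) using R a(2) by linarith
    then have "1 \<le> b * exp (a * U \<omega> - a\<^sup>2 * R \<omega> / 2)"
      unfolding b_def exp_add[symmetric] by simp
    then show ?thesis using a(1) \<omega>(1) by (auto simp: A_def)
  qed (use \<omega> in \<open>auto simp: D_def\<close>)
  then have "prob {\<omega> \<in> space M. \<epsilon> < \<bar>U \<omega>\<bar>} \<le> prob (D \<union> (A c \<union> A (- c)))"
    by (intro finite_measure_mono) auto
  also have "\<dots> \<le> prob D + prob (A c \<union> A (- c))"
    by (rule measure_Un_le) measurable
  also have "prob (A c \<union> A (- c)) \<le> prob (A c) + prob (A (- c))"
    by (rule measure_Un_le) measurable
  finally have "prob {\<omega> \<in> space M. \<epsilon> < \<bar>U \<omega>\<bar>} \<le> prob D + (prob (A c) + prob (A (- c)))"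
    by simp
  then show ?thesis
    using A[of c] A[of "- c"] by (simp add: U_def D_def R_def b_def)
qed

lemma vanish_step_int:
  assumes data: "\<And>k. step_data s (N k) (u k) (v k) (\<xi> k)"
    and van: "vanish_prob (\<lambda>k \<omega>. ennreal (LINT r|lborel. (step_fun (N k) (u k) (v k) (\<xi> k) r \<omega>)\<^sup>2))"
  shows "vanish_prob (\<lambda>k \<omega>. ennreal \<bar>step_int (N k) (u k) (v k) (\<xi> k) \<omega>\<bar>)"
  unfolding vanish_prob_abs_iff
proof (intro conjI allI impI)
  show "(\<lambda>\<omega>. \<bar>step_int (N k) (u k) (v k) (\<xi> k) \<omega>\<bar>) \<in> borel_measurable M" for k
    using step_int_measurable[OF data[of k]] by measurable
  define R where "R k \<omega> = (LINT r|lborel. (step_fun (N k) (u k) (v k) (\<xi> k) r \<omega>)\<^sup>2)" for k \<omega>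
  have R: "(\<lambda>k. prob {\<omega> \<in> space M. \<delta> < R k \<omega>}) \<longlonglongrightarrow> 0" if "0 < \<delta>" for \<delta>
    using van that by (simp add: vanish_prob_def R_def ennreal_less_iff)
  fix \<epsilon> :: real assume \<epsilon>: "0 < \<epsilon>"
  show "(\<lambda>k. prob {\<omega> \<in> space M. \<epsilon> < \<bar>step_int (N k) (u k) (v k) (\<xi> k) \<omega>\<bar>}) \<longlonglongrightarrow> 0"
  proof (rule LIMSEQ_I)
    fix \<eta> :: real assume \<eta>: "0 < \<eta>"
    \<comment> \<open>With this \<open>c\<close> and \<open>c\<^sup>2 * \<delta> / 2 = 1\<close> the
      exponent in \<open>step_int_tail\<close> is exactly \<open>- (4 / \<eta>)\<close>, and
      \<open>4 / \<eta> < exp (4 / \<eta>)\<close> brings the exponential term below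
      \<open>\<eta> / 2\<close>.\<close>
    define c where "c = (1 + 4 / \<eta>) / \<epsilon>"
    have c: "0 < c" using \<epsilon> \<eta> by (simp add: c_def add_pos_pos)
    define \<delta> where "\<delta> = 2 / c\<^sup>2"
    have "0 < \<delta>" using c by (simp add: \<delta>_def)
    have "c\<^sup>2 * \<delta> / 2 = 1" "c * \<epsilon> = 1 + 4 / \<eta>"
      using c \<epsilon> by (simp_all add: \<delta>_def) (simp add: c_def)
    then have "c\<^sup>2 * \<delta> / 2 - c * \<epsilon> = - (4 / \<eta>)" by simp
    moreover have "2 * exp (- (4 / \<eta>)) < \<eta> / 2"
    proof -
      have "4 / \<eta> < exp (4 / \<eta>)" using exp_ge_add_one_self[of "4 / \<eta>"] by linarith
      then have "4 < \<eta> * exp (4 / \<eta>)" using \<eta> by (simp add: divide_less_eq mult.commute)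
      then show ?thesis by (simp add: exp_minus field_simps)
    qed
    ultimately have tail: "2 * exp (c\<^sup>2 * \<delta> / 2 - c * \<epsilon>) < \<eta> / 2" by simp
    have "0 < \<eta> / 2" using \<eta> by simp
    from LIMSEQ_D[OF R[OF \<open>0 < \<delta>\<close>] this]
    obtain K where K: "\<And>k. k \<ge> K \<Longrightarrow> prob {\<omega> \<in> space M. \<delta> < R k \<omega>} < \<eta> / 2" by auto
    show "\<exists>K. \<forall>k\<ge>K. norm (prob {\<omega> \<in> space M. \<epsilon> < \<bar>step_int (N k) (u k) (v k) (\<xi> k) \<omega>\<bar>} - 0) < \<eta>"
    proof (intro exI[of _ K] allI impI)
      fix k assume "K \<le> k"
      show "norm (prob {\<omega> \<in> space M. \<epsilon> < \<bar>step_int (N k) (u k) (v k) (\<xi> k) \<omega>\<bar>} - 0) < \<eta>"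
        using step_int_tail[OF data[of k] less_imp_le[OF c], of \<epsilon> \<delta>] K[OF \<open>K \<le> k\<close>] tail
        unfolding R_def by simp
    qed
  qed
qed

text \<open>Moving every grid point into \<open>[s, t]\<close> restricts a simple process to
  \<open>(s, t]\<close>: intervals outside become empty, and those across an end point are cut
  there.\<close>

abbreviation clipped where
  "clipped f s t n p \<equiv> f {..<n} (\<lambda>i. max s (min t (p i))) (\<lambda>i. max s (min t (p (Suc i))))"

lemma simple_integrand_nonneg:
  assumes "simple_integrand F n p \<xi>" "i \<le> n"
  shows "0 \<le> p i"
  using assms(2)
proof (induction i)
  case 0
  then show ?case using assms(1) by (simp add: simple_integrand_def)
next
  case (Suc i)
  then have "0 \<le> p i" "p i \<le> p (Suc i)"
    using assms(1) by (simp_all add: simple_integrand_def)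
  then show ?case by simp
qed

lemma simple_integrand_step_data:
  assumes F: "simple_integrand F n p \<xi>" and st: "0 \<le> s" "s \<le> t"
  shows "clipped (step_data s) s t n p \<xi>"
  unfolding step_data_def
proof (intro conjI ballI impI)
  fix i assume i: "i \<in> {..<n}"
  then have p: "p i \<le> p (Suc i)" "\<xi> i \<in> borel_measurable (F (p i))" "0 \<le> p i"
    using F simple_integrand_nonneg[OF F, of i] by (simp_all add: simple_integrand_def)
  show "max s (min t (p i)) \<le> max s (min t (p (Suc i)))"
    using p(1) by (simp add: min.coboundedI2 max.coboundedI2)
  assume "max s (min t (p i)) < max s (min t (p (Suc i)))"
  \<comment> \<open>If \<open>p i\<close> lay beyond \<open>t\<close>, both clipped end points would
    equal \<open>t\<close>. A nonempty clipped interval therefore starts no earlier than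
    \<open>p i\<close>, when the coefficient is already known.\<close>
  then have "p i \<le> max s (min t (p i))" using st by (auto simp: max_def min_def split: if_splits)
  then show "\<xi> i \<in> borel_measurable (F (max s (min t (p i))))"
    using measurable_F_mono[OF p(3) _ p(2)] by blast
qed (use st in auto)

lemma step_int_clip:
  assumes "s \<le> t"
  shows "clipped step_int s t n p \<xi> \<omega>
    = simple_integral Z n p \<xi> t \<omega> - simple_integral Z n p \<xi> s \<omega>"
proof -
  have eq: "Z (max s (min t q)) \<omega> = Z (min t q) \<omega> - Z (min s q) \<omega> + Z s \<omega>" for q
    using assms by (auto simp: max_def min_def)
  show ?thesis
    unfolding step_int_def simple_integral_def sum_subtractf[symmetric] eq
    by (intro sum.cong refl) (simp add: algebra_simps)
qed

lemma step_fun_clip: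
  assumes "s \<le> t"
  shows "clipped step_fun s t n p \<xi> r \<omega>
    = indicator {s<..t} r * simple_process n p \<xi> r \<omega>"
proof -
  have eq: "indicator {max s (min t a)<..max s (min t b)} r = (indicator {s<..t} r * indicator {a<..b} r :: real)" for a b
    using assms by (auto simp: indicator_def max_def min_def)
  show ?thesis
    unfolding step_fun_def simple_process_def sum_distrib_left eq
    by (intro sum.cong refl) simp
qed

lemma simple_integral_0:
  assumes "simple_integrand F n p \<xi>"
  shows "simple_integral Z n p \<xi> 0 \<omega> = 0"
proof -
  have "min 0 (p i) = 0" if "i \<le> n" for i
    using simple_integrand_nonneg[OF assms that] by simp
  then show ?thesis by (simp add: simple_integral_def)
qed

text \<open>The intervals are open on the left. This reconciles errors measured over
  \<open>{0..t}\<close> with clipped step functions, which live on \<open>{0<..t}\<close>.\<close>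

lemma simple_process_0:
  assumes "simple_integrand F n p \<xi>"
  shows "simple_process n p \<xi> 0 \<omega> = 0"
proof -
  have "indicator {p i<..p (Suc i)} (0::real) = (0::real)" if "i < n" for i
    using simple_integrand_nonneg[OF assms, of i] that by simp
  then show ?thesis by (simp add: simple_process_def)
qed

lemma simple_integral_measurable:
  assumes F: "simple_integrand F n p \<xi>" and t: "0 \<le> t"
  shows "simple_integral Z n p \<xi> t \<in> borel_measurable M"
proof -
  have "simple_integral Z n p \<xi> t = clipped step_int 0 t n p \<xi>"
    by (rule ext) (simp add: step_int_clip[OF t] simple_integral_0[OF F])
  then show ?thesis
    using step_int_measurable[OF simple_integrand_step_data[OF F order_refl t]] by simp
qed

text \<open>Progressive measurability speaks of a restricted time axis. Projecting the time onto
  \<open>[0, t]\<close> before evaluating \<open>h\<close> gives a function on the whole line, and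
  the indicator then removes the spurious values outside.\<close>

lemma progressive_measurable:
  assumes h: "progressive_on F T h" and t: "0 \<le> t" "t \<le> T"
  shows "(\<lambda>(\<omega>, r). indicator {0..t} r * h r \<omega>) \<in> borel_measurable (F t \<Otimes>\<^sub>M lborel)"
proof -
  have [measurable]: "(\<lambda>(s, \<omega>). h s \<omega>) \<in> borel_measurable (restrict_space borel {0..t} \<Otimes>\<^sub>M F t)"
    using h t by (simp add: progressive_on_def)
  have [measurable]: "(\<lambda>r. max 0 (min t r)) \<in> borel \<rightarrow>\<^sub>M restrict_space borel {0..t}"
    using t by (intro measurable_restrict_space2) auto
  have "(\<lambda>(\<omega>, r). (\<lambda>(s, \<omega>). h s \<omega>) (max 0 (min t r), \<omega>)) \<in> borel_measurable (F t \<Otimes>\<^sub>M borel)"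
    by measurable
  then have [measurable]: "(\<lambda>(\<omega>, r). h (max 0 (min t r)) \<omega>) \<in> borel_measurable (F t \<Otimes>\<^sub>M borel)"
    by simp
  have "(\<lambda>(\<omega>, r). indicator {0..t} r * h (max 0 (min t r)) \<omega>) \<in> borel_measurable (F t \<Otimes>\<^sub>M borel)"
    by measurable
  also have "(\<lambda>(\<omega>, r). indicator {0..t} r * h (max 0 (min t r)) \<omega>) = (\<lambda>(\<omega>, r). indicator {0..t} r * h r \<omega>)"
    by (auto simp: fun_eq_iff indicator_def max_def min_def)
  finally show ?thesis
    by (simp cong: measurable_cong_sets sets_pair_measure_cong)
qed

lemma measurable_F_pair:
  assumes "0 \<le> t" "f \<in> F t \<Otimes>\<^sub>M N \<rightarrow>\<^sub>M L"
  shows "f \<in> M \<Otimes>\<^sub>M N \<rightarrow>\<^sub>M L"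
proof -
  have id: "(\<lambda>\<omega>. \<omega>) \<in> M \<rightarrow>\<^sub>M F t"
    by (rule measurable_F_M[OF assms(1)]) simp
  have "(\<lambda>(\<omega>, r). (\<omega>, r)) \<in> M \<Otimes>\<^sub>M N \<rightarrow>\<^sub>M F t \<Otimes>\<^sub>M N"
    using id by measurable
  then show ?thesis
    using measurable_compose[OF _ assms(2)] by (simp add: split_beta')
qed

text \<open>Adds to the limits in the definition the measurability of the errors, without which
  their probabilities would carry no information.\<close>

lemma ito_integral_approx:
  assumes ito: "ito_integral M F Z t h Y" and t: "0 \<le> t"
  obtains n p \<xi> where "\<And>k::nat. simple_integrand F (n k) (p k) (\<xi> k)"
    "vanish_prob (\<lambda>k \<omega>. \<integral>\<^sup>+s\<in>{0..t}. ennreal ((simple_process (n k) (p k) (\<xi> k) s \<omega> - h s \<omega>)\<^sup>2) \<partial>lborel)"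
    "vanish_prob (\<lambda>k \<omega>. ennreal \<bar>simple_integral Z (n k) (p k) (\<xi> k) t \<omega> - Y \<omega>\<bar>)"
proof -
  obtain n p \<xi> where appr: "\<forall>k::nat. simple_integrand F (n k) (p k) (\<xi> k)"
      "\<forall>\<epsilon>>0. (\<lambda>k. prob {\<omega>\<in>space M.
            (\<integral>\<^sup>+s\<in>{0..t}. ennreal ((simple_process (n k) (p k) (\<xi> k) s \<omega> - h s \<omega>)\<^sup>2) \<partial>lborel)
              > ennreal \<epsilon>}) \<longlonglongrightarrow> 0"
      "\<forall>\<epsilon>>0. (\<lambda>k. prob {\<omega>\<in>space M.
            \<bar>simple_integral Z (n k) (p k) (\<xi> k) t \<omega> - Y \<omega>\<bar> > \<epsilon>}) \<longlonglongrightarrow> 0"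
    using ito unfolding ito_integral_def by (elim conjE exE) (rule that; assumption)
  note F = appr(1)[rule_format] and L2 = appr(2)[rule_format] and int = appr(3)[rule_format]
  have Y: "Y \<in> borel_measurable M" and h: "progressive_on F t h"
    using ito by (simp_all add: ito_integral_def)
  note [measurable] = measurable_F_pair[OF t progressive_measurable[OF h t order_refl]]
  have "(\<lambda>\<omega>. \<integral>\<^sup>+s\<in>{0..t}. ennreal ((simple_process (n k) (p k) (\<xi> k) s \<omega> - h s \<omega>)\<^sup>2) \<partial>lborel) \<in> borel_measurable M" for k
  proof -
    let ?S = "clipped step_fun 0 t (n k) (p k) (\<xi> k)"
    note [measurable] = step_fun_measurable[OF simple_integrand_step_data[OF F[of k] order_refl t]]
    have "(\<lambda>(\<omega>, r). ennreal ((?S r \<omega> - indicator {0..t} r * h r \<omega>)\<^sup>2)) \<in> borel_measurable (M \<Otimes>\<^sub>M lborel)"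
      by measurable
    then have meas: "(\<lambda>\<omega>. \<integral>\<^sup>+r. ennreal ((?S r \<omega> - indicator {0..t} r * h r \<omega>)\<^sup>2) \<partial>lborel) \<in> borel_measurable M"
      by (rule lborel.borel_measurable_nn_integral)
    have "ennreal ((simple_process (n k) (p k) (\<xi> k) r \<omega> - h r \<omega>)\<^sup>2) * indicator {0..t} r =
        ennreal ((?S r \<omega> - indicator {0..t} r * h r \<omega>)\<^sup>2)" for r \<omega>
    proof (cases "r = 0")
      case True
      then show ?thesis using t by (simp add: step_fun_clip[OF t] simple_process_0[OF F])
    next
      case False
      then show ?thesis by (auto simp: step_fun_clip[OF t] indicator_def)
    qed
    then show ?thesis using meas by simp
  qed
  then have "vanish_prob (\<lambda>k \<omega>. \<integral>\<^sup>+s\<in>{0..t}. ennreal ((simple_process (n k) (p k) (\<xi> k) s \<omega> - h s \<omega>)\<^sup>2) \<partial>lborel)"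
    using L2 by (simp add: vanish_prob_def)
  moreover have "vanish_prob (\<lambda>k \<omega>. ennreal \<bar>simple_integral Z (n k) (p k) (\<xi> k) t \<omega> - Y \<omega>\<bar>)"
    unfolding vanish_prob_abs_iff
    using int borel_measurable_diff[OF simple_integral_measurable[OF F t] Y] by simp
  ultimately show ?thesis by (rule that[of n p \<xi>, OF F])
qed

end

section \<open>The It\^o integral\<close>

text \<open>Young's inequality, weighted so that the main term keeps a factor close to 1;
  \<open>e\<close> is sent to 0 only after the passage to the limit.\<close>

lemma square_le_perturbed:
  fixes x y e :: real
  assumes "0 < e"
  shows "x\<^sup>2 \<le> (1 + e) * y\<^sup>2 + (1 + 1 / e) * (x - y)\<^sup>2"
proof -
  have "0 \<le> (e * y - (x - y))\<^sup>2 / e" using assms by simp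
  also have "\<dots> = (1 + e) * y\<^sup>2 + (1 + 1 / e) * (x - y)\<^sup>2 - x\<^sup>2"
    using assms by (simp add: power2_eq_square field_simps)
  finally show ?thesis by simp
qed

context filtered_BM
begin

lemma progressive_section:
  assumes h: "progressive_on F T h" and t: "0 \<le> t" "t \<le> T" and \<omega>: "\<omega> \<in> space M"
  shows "(\<lambda>r. indicator {0..t} r * h r \<omega>) \<in> borel_measurable lborel"
  using measurable_compose[OF measurable_Pair1'[OF \<omega>] measurable_F_pair[OF t(1) progressive_measurable[OF h t]]]
  by simp

text \<open>The integrals up to \<open>s\<close> and up to \<open>t\<close> come with unrelated
  approximating sequences. Over the disjoint sum of the two index sets the difference is a single
  step integral; its energy is at most twice the sum of the two errors, so Lenglart's inequality
  makes it vanish.\<close>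

lemma vanish_simple_integral_diff:
  assumes F: "\<And>k. simple_integrand F (n k) (p k) (\<xi> k)" and F': "\<And>k. simple_integrand F (n' k) (p' k) (\<xi>' k)"
    and st: "0 \<le> s" "s \<le> t"
    and L2: "vanish_prob (\<lambda>k \<omega>. \<integral>\<^sup>+r\<in>{0..t}. ennreal ((simple_process (n k) (p k) (\<xi> k) r \<omega> - h r \<omega>)\<^sup>2) \<partial>lborel)"
    and L2': "vanish_prob (\<lambda>k \<omega>. \<integral>\<^sup>+r\<in>{0..s}. ennreal ((simple_process (n' k) (p' k) (\<xi>' k) r \<omega> - h r \<omega>)\<^sup>2) \<partial>lborel)"
    and h: "progressive_on F t h"
  shows "vanish_prob (\<lambda>k \<omega>. ennreal \<bar>simple_integral Z (n k) (p k) (\<xi> k) s \<omega> - simple_integral Z (n' k) (p' k) (\<xi>' k) s \<omega>\<bar>)"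
proof -
  define N where "N k = {..<n k} <+> {..<n' k}" for k
  define u where "u k = case_sum (\<lambda>i. max 0 (min s (p k i))) (\<lambda>i. max 0 (min s (p' k i)))" for k
  define v where "v k = case_sum (\<lambda>i. max 0 (min s (p k (Suc i)))) (\<lambda>i. max 0 (min s (p' k (Suc i))))" for k
  define \<zeta> where "\<zeta> k = case_sum (\<xi> k) (\<lambda>i \<omega>. - \<xi>' k i \<omega>)" for k
  note D = simple_integrand_step_data[OF F order_refl st(1)] and D' = simple_integrand_step_data[OF F' order_refl st(1)]
  have data: "step_data 0 (N k) (u k) (v k) (\<zeta> k)" for k
    using D[of k] D'[of k] by (auto simp: step_data_def N_def u_def v_def \<zeta>_def)
  have int: "step_int (N k) (u k) (v k) (\<zeta> k) \<omega> =
      simple_integral Z (n k) (p k) (\<xi> k) s \<omega> - simple_integral Z (n' k) (p' k) (\<xi>' k) s \<omega>" for k \<omega>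
    using step_int_clip[OF st(1), of "n k" "p k" "\<xi> k" \<omega>] step_int_clip[OF st(1), of "n' k" "p' k" "\<xi>' k" \<omega>]
    by (simp add: step_int_def N_def u_def v_def \<zeta>_def sum.Plus sum_negf simple_integral_0[OF F] simple_integral_0[OF F'])
  have "fun": "step_fun (N k) (u k) (v k) (\<zeta> k) r \<omega> =
      indicator {0<..s} r * (simple_process (n k) (p k) (\<xi> k) r \<omega> - simple_process (n' k) (p' k) (\<xi>' k) r \<omega>)" for k r \<omega>
    unfolding right_diff_distrib step_fun_clip[OF st(1), symmetric] step_fun_def N_def u_def v_def \<zeta>_def
    by (simp only: sum.Plus[OF finite_lessThan finite_lessThan] comp_def sum.case
        mult_minus_left sum_negf add_uminus_conv_diff)
  let ?D = "\<lambda>k \<omega>. \<integral>\<^sup>+r\<in>{0..t}. ennreal ((simple_process (n k) (p k) (\<xi> k) r \<omega> - h r \<omega>)\<^sup>2) \<partial>lborel"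
  let ?D' = "\<lambda>k \<omega>. \<integral>\<^sup>+r\<in>{0..s}. ennreal ((simple_process (n' k) (p' k) (\<xi>' k) r \<omega> - h r \<omega>)\<^sup>2) \<partial>lborel"
  have "vanish_prob (\<lambda>k \<omega>. (?D k \<omega> + ?D k \<omega>) + (?D' k \<omega> + ?D' k \<omega>))"
    by (intro vanish_prob_add L2 L2')
  then have "vanish_prob (\<lambda>k \<omega>. ennreal (LINT r|lborel. (step_fun (N k) (u k) (v k) (\<zeta> k) r \<omega>)\<^sup>2))"
  proof (rule vanish_prob_mono)
    show "(\<lambda>\<omega>. ennreal (LINT r|lborel. (step_fun (N k) (u k) (v k) (\<zeta> k) r \<omega>)\<^sup>2)) \<in> borel_measurable M" for k
      using step_energy_measurable[OF data[of k]] by measurable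
    fix k \<omega> assume \<omega>: "\<omega> \<in> space M"
    note [measurable] = progressive_section[OF h order_trans[OF st] order_refl \<omega>] progressive_section[OF h st \<omega>]
    have [measurable]: "(\<lambda>r. simple_process (n k) (p k) (\<xi> k) r \<omega>) \<in> borel_measurable lborel"
      "(\<lambda>r. simple_process (n' k) (p' k) (\<xi>' k) r \<omega>) \<in> borel_measurable lborel"
      unfolding simple_process_def by measurable
    let ?d = "\<lambda>r. ennreal ((indicator {0..t} r * simple_process (n k) (p k) (\<xi> k) r \<omega> - indicator {0..t} r * h r \<omega>)\<^sup>2)"
    let ?d' = "\<lambda>r. ennreal ((indicator {0..s} r * simple_process (n' k) (p' k) (\<xi>' k) r \<omega> - indicator {0..s} r * h r \<omega>)\<^sup>2)"
    have D_eq: "?D k \<omega> = (\<integral>\<^sup>+r. ?d r \<partial>lborel)" "?D' k \<omega> = (\<integral>\<^sup>+r. ?d' r \<partial>lborel)"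
      by (auto intro!: nn_integral_cong simp: indicator_def)
    have "ennreal (LINT r|lborel. (step_fun (N k) (u k) (v k) (\<zeta> k) r \<omega>)\<^sup>2) =
        (\<integral>\<^sup>+r. ennreal ((step_fun (N k) (u k) (v k) (\<zeta> k) r \<omega>)\<^sup>2) \<partial>lborel)"
      by (rule nn_integral_eq_integral[symmetric, OF step_energy[OF data]]) simp
    also have "\<dots> \<le> (\<integral>\<^sup>+r. (?d r + ?d r) + (?d' r + ?d' r) \<partial>lborel)"
    proof (intro nn_integral_mono)
      fix r :: real
      have "(a - b)\<^sup>2 \<le> ((a - c)\<^sup>2 + (a - c)\<^sup>2) + ((b - c)\<^sup>2 + (b - c)\<^sup>2)" for a b c :: real
      proof -
        have "0 \<le> ((a - c) + (b - c))\<^sup>2" by simp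
        then show ?thesis by (simp add: power2_eq_square algebra_simps)
      qed
      then have "ennreal ((a - b)\<^sup>2) \<le> ennreal (((a - c)\<^sup>2 + (a - c)\<^sup>2) + ((b - c)\<^sup>2 + (b - c)\<^sup>2))" for a b c :: real
        by (rule ennreal_leI)
      then have "ennreal ((a - b)\<^sup>2) \<le> (ennreal ((a - c)\<^sup>2) + ennreal ((a - c)\<^sup>2)) + (ennreal ((b - c)\<^sup>2) + ennreal ((b - c)\<^sup>2))" for a b c :: real
        by (simp only: ennreal_plus add_nonneg_nonneg zero_le_power2)
      then show "ennreal ((step_fun (N k) (u k) (v k) (\<zeta> k) r \<omega>)\<^sup>2) \<le> (?d r + ?d r) + (?d' r + ?d' r)"
        unfolding "fun" using st by (cases "0 < r \<and> r \<le> s") simp_all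
    qed
    also have "\<dots> = (\<integral>\<^sup>+r. ?d r + ?d r \<partial>lborel) + (\<integral>\<^sup>+r. ?d' r + ?d' r \<partial>lborel)"
      by (rule nn_integral_add) measurable
    also have "(\<integral>\<^sup>+r. ?d r + ?d r \<partial>lborel) = ?D k \<omega> + ?D k \<omega>"
      unfolding D_eq by (rule nn_integral_add) measurable
    also have "(\<integral>\<^sup>+r. ?d' r + ?d' r \<partial>lborel) = ?D' k \<omega> + ?D' k \<omega>"
      unfolding D_eq by (rule nn_integral_add) measurable
    finally show "ennreal (LINT r|lborel. (step_fun (N k) (u k) (v k) (\<zeta> k) r \<omega>)\<^sup>2)
        \<le> (?D k \<omega> + ?D k \<omega>) + (?D' k \<omega> + ?D' k \<omega>)" .
  qed
  then have "vanish_prob (\<lambda>k \<omega>. ennreal \<bar>step_int (N k) (u k) (v k) (\<zeta> k) \<omega>\<bar>)"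
    by (rule vanish_step_int[OF data])
  then show ?thesis unfolding int .
qed

text \<open>The energy of \<open>h\<close> is finite only almost surely, hence finiteness appears as
  a hypothesis on the fixed scenario; it is what makes the real integral agree with the extended
  one.\<close>

lemma ito_energy:
  assumes h: "progressive_on F t h" and s: "0 \<le> s"  "s \<le> t" and \<omega>: "\<omega> \<in> space M"
    and fin: "(\<integral>\<^sup>+r\<in>{0..t}. ennreal ((h r \<omega>)\<^sup>2) \<partial>lborel) < \<infinity>"
  shows "set_integrable lborel {s<..t} (\<lambda>r. (h r \<omega>)\<^sup>2)"
    and "ennreal (LINT r:{s<..t}|lborel. (h r \<omega>)\<^sup>2) = (\<integral>\<^sup>+r. ennreal ((indicator {s<..t} r * h r \<omega>)\<^sup>2) \<partial>lborel)"
proof -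
  note [measurable] = progressive_section[OF h order_trans[OF s] order_refl \<omega>]
  have "(\<lambda>r. indicator {s<..t} r * (indicator {0..t} r * h r \<omega>)) \<in> borel_measurable lborel"
    by measurable
  also have "(\<lambda>r. indicator {s<..t} r * (indicator {0..t} r * h r \<omega>)) = (\<lambda>r. indicator {s<..t} r * h r \<omega>)"
    using s by (auto simp: fun_eq_iff indicator_def)
  finally have meas [measurable]: "(\<lambda>r. indicator {s<..t} r * h r \<omega>) \<in> borel_measurable lborel" .
  have "(\<integral>\<^sup>+r. ennreal ((indicator {s<..t} r * h r \<omega>)\<^sup>2) \<partial>lborel) \<le> (\<integral>\<^sup>+r\<in>{0..t}. ennreal ((h r \<omega>)\<^sup>2) \<partial>lborel)"
    using s by (intro nn_integral_mono) (auto simp: indicator_def)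
  then have lt: "(\<integral>\<^sup>+r. ennreal ((indicator {s<..t} r * h r \<omega>)\<^sup>2) \<partial>lborel) < \<infinity>"
    using fin by (rule le_less_trans)
  have int: "integrable lborel (\<lambda>r. (indicator {s<..t} r * h r \<omega>)\<^sup>2)"
    by (rule integrableI_nonneg) (use lt in auto)
  have eq: "(indicator {s<..t} r * h r \<omega>)\<^sup>2 = indicator {s<..t} r *\<^sub>R (h r \<omega>)\<^sup>2" for r
    by (simp add: indicator_def)
  show "set_integrable lborel {s<..t} (\<lambda>r. (h r \<omega>)\<^sup>2)"
    using int unfolding eq set_integrable_def .
  show "ennreal (LINT r:{s<..t}|lborel. (h r \<omega>)\<^sup>2) = (\<integral>\<^sup>+r. ennreal ((indicator {s<..t} r * h r \<omega>)\<^sup>2) \<partial>lborel)"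
    using nn_integral_eq_integral[OF int] by (simp add: eq set_lebesgue_integral_def)
qed

lemma ito_energy_measurable:
  assumes h: "progressive_on F t h" and s: "0 \<le> s"  "s \<le> t"
  shows "(\<lambda>\<omega>. LINT r:{s<..t}|lborel. (h r \<omega>)\<^sup>2) \<in> borel_measurable M"
proof -
  have t0: "0 \<le> t" using s by simp
  note [measurable] = measurable_F_pair[OF t0 progressive_measurable[OF h t0 order_refl]]
  have "(\<lambda>(\<omega>, r). indicator {s<..t} r * (indicator {0..t} r * h r \<omega>)\<^sup>2) \<in> borel_measurable (M \<Otimes>\<^sub>M lborel)"
    by measurable
  then have "(\<lambda>\<omega>. LINT r|lborel. indicator {s<..t} r * (indicator {0..t} r * h r \<omega>)\<^sup>2) \<in> borel_measurable M"
    by (rule lborel.borel_measurable_lebesgue_integral)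
  also have "(\<lambda>\<omega>. LINT r|lborel. indicator {s<..t} r * (indicator {0..t} r * h r \<omega>)\<^sup>2)
      = (\<lambda>\<omega>. LINT r:{s<..t}|lborel. (h r \<omega>)\<^sup>2)"
    unfolding set_lebesgue_integral_def using s
    by (intro ext Bochner_Integration.integral_cong) (auto simp: indicator_def)
  finally show ?thesis .
qed

text \<open>An upper bound on the energies of the approximations is a lower bound on their
  exponentials, which is the direction that Fatou's lemma requires. The factor \<open>1 + e\<close>
  stays in the limit, while the term with \<open>d\<close> disappears.\<close>

lemma simple_energy_le:
  assumes F: "simple_integrand F n p \<xi>" and h: "progressive_on F t h" and st: "0 \<le> s" "s \<le> t"
    and \<omega>: "\<omega> \<in> space M"
    and fin: "(\<integral>\<^sup>+r\<in>{0..t}. ennreal ((h r \<omega>)\<^sup>2) \<partial>lborel) < \<infinity>"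
    and D: "(\<integral>\<^sup>+r\<in>{0..t}. ennreal ((simple_process n p \<xi> r \<omega> - h r \<omega>)\<^sup>2) \<partial>lborel) \<le> ennreal d"
    and "0 < e" "0 \<le> d"
  shows "(LINT r|lborel. (clipped step_fun s t n p \<xi> r \<omega>)\<^sup>2)
    \<le> (1 + e) * (LINT r:{s<..t}|lborel. (h r \<omega>)\<^sup>2) + (1 + 1 / e) * d"
proof -
  note data = simple_integrand_step_data[OF F st]
  let ?S = "clipped step_fun s t n p \<xi>"
  let ?Q = "LINT r:{s<..t}|lborel. (h r \<omega>)\<^sup>2"
  note [measurable] = progressive_section[OF h order_trans[OF st] order_refl \<omega>]
  have "(\<lambda>r. indicator {s<..t} r * (indicator {0..t} r * h r \<omega>)) \<in> borel_measurable lborel"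
    by measurable
  also have "(\<lambda>r. indicator {s<..t} r * (indicator {0..t} r * h r \<omega>)) = (\<lambda>r. indicator {s<..t} r * h r \<omega>)"
    using st by (auto simp: fun_eq_iff indicator_def)
  finally have [measurable]: "(\<lambda>r. indicator {s<..t} r * h r \<omega>) \<in> borel_measurable lborel" .
  have [measurable]: "(\<lambda>r. ?S r \<omega>) \<in> borel_measurable lborel"
    unfolding step_fun_def by measurable
  have Q0: "0 \<le> ?Q" unfolding set_lebesgue_integral_def by (intro integral_nonneg_AE) simp
  have "ennreal (LINT r|lborel. (?S r \<omega>)\<^sup>2) = (\<integral>\<^sup>+r. ennreal ((?S r \<omega>)\<^sup>2) \<partial>lborel)"
    by (rule nn_integral_eq_integral[symmetric, OF step_energy[OF data]]) simp
  also have "\<dots> \<le> (\<integral>\<^sup>+r. ennreal (1 + e) * ennreal ((indicator {s<..t} r * h r \<omega>)\<^sup>2)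
      + ennreal (1 + 1 / e) * ennreal ((?S r \<omega> - indicator {s<..t} r * h r \<omega>)\<^sup>2) \<partial>lborel)"
  proof (intro nn_integral_mono)
    fix r :: real
    have "ennreal ((?S r \<omega>)\<^sup>2) \<le> ennreal ((1 + e) * (indicator {s<..t} r * h r \<omega>)\<^sup>2
        + (1 + 1 / e) * (?S r \<omega> - indicator {s<..t} r * h r \<omega>)\<^sup>2)"
      by (intro ennreal_leI square_le_perturbed \<open>0 < e\<close>)
    then show "ennreal ((?S r \<omega>)\<^sup>2) \<le> ennreal (1 + e) * ennreal ((indicator {s<..t} r * h r \<omega>)\<^sup>2)
      + ennreal (1 + 1 / e) * ennreal ((?S r \<omega> - indicator {s<..t} r * h r \<omega>)\<^sup>2)"
      using \<open>0 < e\<close> by (simp only: ennreal_plus ennreal_mult mult_nonneg_nonneg zero_le_power2 add_nonneg_nonneg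
          zero_le_one divide_nonneg_nonneg less_imp_le)
  qed
  also have "\<dots> = ennreal (1 + e) * (\<integral>\<^sup>+r. ennreal ((indicator {s<..t} r * h r \<omega>)\<^sup>2) \<partial>lborel)
      + ennreal (1 + 1 / e) * (\<integral>\<^sup>+r. ennreal ((?S r \<omega> - indicator {s<..t} r * h r \<omega>)\<^sup>2) \<partial>lborel)"
    by (subst nn_integral_add) (auto simp: nn_integral_cmult)
  also have "\<dots> \<le> ennreal (1 + e) * ennreal ?Q + ennreal (1 + 1 / e) * ennreal d"
  proof (intro add_mono mult_left_mono)
    show "(\<integral>\<^sup>+r. ennreal ((indicator {s<..t} r * h r \<omega>)\<^sup>2) \<partial>lborel) \<le> ennreal ?Q"
      by (simp add: ito_energy(2)[OF h st \<omega> fin])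
    have "(\<integral>\<^sup>+r. ennreal ((?S r \<omega> - indicator {s<..t} r * h r \<omega>)\<^sup>2) \<partial>lborel)
      \<le> (\<integral>\<^sup>+r\<in>{0..t}. ennreal ((simple_process n p \<xi> r \<omega> - h r \<omega>)\<^sup>2) \<partial>lborel)"
      unfolding step_fun_clip[OF st(2)] using st by (intro nn_integral_mono) (auto simp: indicator_def)
    then show "(\<integral>\<^sup>+r. ennreal ((?S r \<omega> - indicator {s<..t} r * h r \<omega>)\<^sup>2) \<partial>lborel) \<le> ennreal d"
      using D by (rule order_trans)
  qed simp_all
  also have "\<dots> = ennreal ((1 + e) * ?Q + (1 + 1 / e) * d)"
    using \<open>0 < e\<close> \<open>0 \<le> d\<close> Q0 by (simp add: ennreal_plus ennreal_mult)
  finally show ?thesis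
    using \<open>0 < e\<close> \<open>0 \<le> d\<close> Q0 by (subst (asm) ennreal_le_iff) auto
qed

text \<open>The clipped approximations start at \<open>s\<close>, so \<open>g\<close> is an
  admissible weight in the identity for step processes. Along an almost surely convergent
  subsequence Fatou's lemma gives the inequality with the energy inflated by \<open>1 + e\<close>; a
  second use of Fatou's lemma removes \<open>e\<close>.\<close>

lemma ito_integral_exp_le:
  assumes It: "ito_integral M F Z t h Y" and Is: "ito_integral M F Z s h Y'" and st: "0 \<le> s" "s \<le> t"
    and g: "g \<in> borel_measurable (F s)" and g0: "\<And>\<omega>. 0 \<le> g \<omega>"
  shows "(\<integral>\<^sup>+\<omega>. ennreal (g \<omega> * exp (c * (Y \<omega> - Y' \<omega>) - c\<^sup>2 * (LINT r:{s<..t}|lborel. (h r \<omega>)\<^sup>2) / 2)) \<partial>M)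
    \<le> (\<integral>\<^sup>+\<omega>. ennreal (g \<omega>) \<partial>M)"
proof -
  have t: "0 \<le> t" using st by simp
  have h: "progressive_on F t h" and Y [measurable]: "Y \<in> borel_measurable M" "Y' \<in> borel_measurable M"
    and fin: "AE \<omega> in M. (\<integral>\<^sup>+r\<in>{0..t}. ennreal ((h r \<omega>)\<^sup>2) \<partial>lborel) < \<infinity>"
    using It Is by (simp_all add: ito_integral_def)
  obtain n p \<xi> where F: "\<And>k::nat. simple_integrand F (n k) (p k) (\<xi> k)"
    and L2: "vanish_prob (\<lambda>k \<omega>. \<integral>\<^sup>+r\<in>{0..t}. ennreal ((simple_process (n k) (p k) (\<xi> k) r \<omega> - h r \<omega>)\<^sup>2) \<partial>lborel)"
    and int: "vanish_prob (\<lambda>k \<omega>. ennreal \<bar>simple_integral Z (n k) (p k) (\<xi> k) t \<omega> - Y \<omega>\<bar>)"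
    by (rule ito_integral_approx[OF It t]) (rule that; assumption)
  obtain n' p' \<xi>' where F': "\<And>k::nat. simple_integrand F (n' k) (p' k) (\<xi>' k)"
    and L2': "vanish_prob (\<lambda>k \<omega>. \<integral>\<^sup>+r\<in>{0..s}. ennreal ((simple_process (n' k) (p' k) (\<xi>' k) r \<omega> - h r \<omega>)\<^sup>2) \<partial>lborel)"
    and int': "vanish_prob (\<lambda>k \<omega>. ennreal \<bar>simple_integral Z (n' k) (p' k) (\<xi>' k) s \<omega> - Y' \<omega>\<bar>)"
    by (rule ito_integral_approx[OF Is st(1)]) (rule that; assumption)
  define S where "S k = clipped step_fun s t (n k) (p k) (\<xi> k)" for k
  define V where "V k = clipped step_int s t (n k) (p k) (\<xi> k)" for k
  define R where "R k \<omega> = (LINT r|lborel. (S k r \<omega>)\<^sup>2)" for k \<omega>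
  define Q where "Q \<omega> = (LINT r:{s<..t}|lborel. (h r \<omega>)\<^sup>2)" for \<omega>
  define D where "D k \<omega> = (\<integral>\<^sup>+r\<in>{0..t}. ennreal ((simple_process (n k) (p k) (\<xi> k) r \<omega> - h r \<omega>)\<^sup>2) \<partial>lborel)" for k \<omega>
  define E where "E k \<omega> = ennreal \<bar>V k \<omega> - (Y \<omega> - Y' \<omega>)\<bar>" for k \<omega>
  note data = simple_integrand_step_data[OF F st]
  have [measurable]: "V k \<in> borel_measurable M" "R k \<in> borel_measurable M" "g \<in> borel_measurable M"
    "Q \<in> borel_measurable M" for k
    unfolding V_def R_def[abs_def] S_def Q_def[abs_def]
    using step_int_measurable[OF data] step_energy_measurable[OF data] measurable_F_M[OF st(1) g]
      ito_energy_measurable[OF h st] by simp_all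
  let ?A = "\<lambda>k \<omega>. simple_integral Z (n k) (p k) (\<xi> k) t \<omega> - Y \<omega>"
  let ?B = "\<lambda>k \<omega>. simple_integral Z (n k) (p k) (\<xi> k) s \<omega> - simple_integral Z (n' k) (p' k) (\<xi>' k) s \<omega>"
  let ?C = "\<lambda>k \<omega>. simple_integral Z (n' k) (p' k) (\<xi>' k) s \<omega> - Y' \<omega>"
  have "vanish_prob E"
  proof (rule vanish_prob_mono)
    show "vanish_prob (\<lambda>k \<omega>. ennreal \<bar>?A k \<omega>\<bar> + (ennreal \<bar>?B k \<omega>\<bar> + ennreal \<bar>?C k \<omega>\<bar>))"
      by (intro vanish_prob_add int int' vanish_simple_integral_diff[OF F F' st L2 L2' h])
    show "E k \<in> borel_measurable M" for k
      unfolding E_def[abs_def] by measurable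
    fix k \<omega>
    have "\<bar>V k \<omega> - (Y \<omega> - Y' \<omega>)\<bar> \<le> \<bar>?A k \<omega>\<bar> + (\<bar>?B k \<omega>\<bar> + \<bar>?C k \<omega>\<bar>)"
      unfolding V_def step_int_clip[OF st(2)] by linarith
    then have "E k \<omega> \<le> ennreal (\<bar>?A k \<omega>\<bar> + (\<bar>?B k \<omega>\<bar> + \<bar>?C k \<omega>\<bar>))"
      unfolding E_def by (rule ennreal_leI)
    then show "E k \<omega> \<le> ennreal \<bar>?A k \<omega>\<bar> + (ennreal \<bar>?B k \<omega>\<bar> + ennreal \<bar>?C k \<omega>\<bar>)"
      by (simp only: ennreal_plus abs_ge_zero add_nonneg_nonneg)
  qed
  \<comment> \<open>The two errors are added so that one subsequence makes both converge almost
    surely.\<close>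
  with L2 have "vanish_prob (\<lambda>k \<omega>. D k \<omega> + E k \<omega>)"
    unfolding D_def by (rule vanish_prob_add)
  then obtain r where "strict_mono r" and r: "AE \<omega> in M. (\<lambda>k. D (r k) \<omega> + E (r k) \<omega>) \<longlonglongrightarrow> 0"
    by (rule vanish_prob_AE_subseq)
  have exp_b: "(\<integral>\<^sup>+\<omega>. ennreal (g \<omega> * exp (c * V k \<omega> - c\<^sup>2 * R k \<omega> / 2)) \<partial>M) = (\<integral>\<^sup>+\<omega>. ennreal (g \<omega>) \<partial>M)" for k
    using exp_step[OF data[of k], where g = "\<lambda>\<omega>. ennreal (g \<omega>)" and c = c] g g0
    by (simp add: V_def R_def S_def ennreal_mult)
  have perturbed: "(\<integral>\<^sup>+\<omega>. ennreal (g \<omega> * exp (c * (Y \<omega> - Y' \<omega>) - c\<^sup>2 * ((1 + e) * Q \<omega>) / 2)) \<partial>M)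
      \<le> (\<integral>\<^sup>+\<omega>. ennreal (g \<omega>) \<partial>M)" if e: "0 < e" for e
  proof -
    have "(\<integral>\<^sup>+\<omega>. ennreal (g \<omega> * exp (c * (Y \<omega> - Y' \<omega>) - c\<^sup>2 * ((1 + e) * Q \<omega>) / 2)) \<partial>M)
      \<le> (\<integral>\<^sup>+\<omega>. liminf (\<lambda>k. ennreal (g \<omega> * exp (c * V (r k) \<omega> - c\<^sup>2 * R (r k) \<omega> / 2))) \<partial>M)"
    proof (rule nn_integral_mono_AE)
      show "AE \<omega> in M. ennreal (g \<omega> * exp (c * (Y \<omega> - Y' \<omega>) - c\<^sup>2 * ((1 + e) * Q \<omega>) / 2))
        \<le> liminf (\<lambda>k. ennreal (g \<omega> * exp (c * V (r k) \<omega> - c\<^sup>2 * R (r k) \<omega> / 2)))"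
        using r fin AE_space
      proof eventually_elim
        case (elim \<omega>)
        have D0: "(\<lambda>k. D (r k) \<omega>) \<longlonglongrightarrow> ennreal 0"
          unfolding ennreal_0 by (rule tendsto_sandwich[OF _ _ tendsto_const elim(1)]) simp_all
        have E0: "(\<lambda>k. E (r k) \<omega>) \<longlonglongrightarrow> ennreal 0"
          unfolding ennreal_0 by (rule tendsto_sandwich[OF _ _ tendsto_const elim(1)]) simp_all
        define d where "d k = enn2real (D (r k) \<omega>)" for k
        have d: "d \<longlonglongrightarrow> 0"
          unfolding d_def using D0 by (intro tendsto_enn2real) simp_all
        have "(\<lambda>k. enn2real (E (r k) \<omega>)) \<longlonglongrightarrow> 0"
          using E0 by (intro tendsto_enn2real) simp_all
        then have "(\<lambda>k. V (r k) \<omega> - (Y \<omega> - Y' \<omega>)) \<longlonglongrightarrow> 0"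
          unfolding E_def by (simp add: tendsto_rabs_zero_iff)
        then have V: "(\<lambda>k. V (r k) \<omega>) \<longlonglongrightarrow> Y \<omega> - Y' \<omega>"
          using LIM_zero_iff by blast
        have ev: "\<forall>\<^sub>F k in sequentially. D (r k) \<omega> < \<infinity>"
          using order_tendstoD(2)[OF D0, of \<infinity>] by simp
        let ?a = "\<lambda>k. g \<omega> * exp (c * V (r k) \<omega> - c\<^sup>2 * ((1 + e) * Q \<omega> + (1 + 1 / e) * d k) / 2)"
        let ?b = "\<lambda>k. g \<omega> * exp (c * V (r k) \<omega> - c\<^sup>2 * R (r k) \<omega> / 2)"
        have "?a \<longlonglongrightarrow> g \<omega> * exp (c * (Y \<omega> - Y' \<omega>) - c\<^sup>2 * ((1 + e) * Q \<omega> + (1 + 1 / e) * 0) / 2)"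
          by (intro tendsto_intros V d) simp
        then have lim: "(\<lambda>k. ennreal (?a k)) \<longlonglongrightarrow> ennreal (g \<omega> * exp (c * (Y \<omega> - Y' \<omega>) - c\<^sup>2 * ((1 + e) * Q \<omega>) / 2))"
          by (intro tendsto_ennrealI) simp
        have "\<forall>\<^sub>F k in sequentially. ennreal (?a k) \<le> ennreal (?b k)"
          using ev
        proof eventually_elim
          case (elim k)
          then have "D (r k) \<omega> \<le> ennreal (d k)" by (simp add: d_def)
          then have "R (r k) \<omega> \<le> (1 + e) * Q \<omega> + (1 + 1 / e) * d k"
            unfolding R_def S_def Q_def D_def
            using \<open>\<omega> \<in> space M\<close> \<open>(\<integral>\<^sup>+r\<in>{0..t}. ennreal ((h r \<omega>)\<^sup>2) \<partial>lborel) < \<infinity>\<close>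
            by (intro simple_energy_le F h st e) (simp_all add: d_def)
          then have "c\<^sup>2 * R (r k) \<omega> \<le> c\<^sup>2 * ((1 + e) * Q \<omega> + (1 + 1 / e) * d k)"
            by (rule mult_left_mono) simp
          then show ?case
            by (intro ennreal_leI mult_left_mono g0) simp
        qed
        then have "liminf (\<lambda>k. ennreal (?a k)) \<le> liminf (\<lambda>k. ennreal (?b k))"
          by (rule Liminf_mono)
        then show ?case
          using lim_imp_Liminf[OF sequentially_bot lim] by simp
      qed
    qed
    also have "\<dots> \<le> liminf (\<lambda>k. \<integral>\<^sup>+\<omega>. ennreal (g \<omega> * exp (c * V (r k) \<omega> - c\<^sup>2 * R (r k) \<omega> / 2)) \<partial>M)"
      by (rule nn_integral_liminf) measurable
    also have "\<dots> = (\<integral>\<^sup>+\<omega>. ennreal (g \<omega>) \<partial>M)"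
      unfolding exp_b by (rule lim_imp_Liminf[OF sequentially_bot tendsto_const])
    finally show ?thesis .
  qed
  \<comment> \<open>The inflation factors \<open>1 + 1 / (m + 1)\<close> tend to 1, so the
    integrands converge pointwise to the one without inflation.\<close>
  let ?e = "\<lambda>m. 1 / real (Suc m)"
  let ?f = "\<lambda>m \<omega>. g \<omega> * exp (c * (Y \<omega> - Y' \<omega>) - c\<^sup>2 * ((1 + ?e m) * Q \<omega>) / 2)"
  have "(\<integral>\<^sup>+\<omega>. ennreal (g \<omega> * exp (c * (Y \<omega> - Y' \<omega>) - c\<^sup>2 * Q \<omega> / 2)) \<partial>M)
    = (\<integral>\<^sup>+\<omega>. liminf (\<lambda>m. ennreal (?f m \<omega>)) \<partial>M)"
  proof (intro nn_integral_cong lim_imp_Liminf[symmetric] sequentially_bot tendsto_ennrealI)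
    fix \<omega>
    have "?e \<longlonglongrightarrow> 0" by (rule LIMSEQ_Suc[OF lim_1_over_n])
    then have "(\<lambda>m. ?f m \<omega>) \<longlonglongrightarrow> g \<omega> * exp (c * (Y \<omega> - Y' \<omega>) - c\<^sup>2 * ((1 + 0) * Q \<omega>) / 2)"
      by (intro tendsto_intros) simp_all
    then show "(\<lambda>m. ?f m \<omega>) \<longlonglongrightarrow> g \<omega> * exp (c * (Y \<omega> - Y' \<omega>) - c\<^sup>2 * Q \<omega> / 2)" by simp
  qed
  also have "\<dots> \<le> liminf (\<lambda>m. \<integral>\<^sup>+\<omega>. ennreal (?f m \<omega>) \<partial>M)"
    by (rule nn_integral_liminf) measurable
  also have "\<dots> \<le> liminf (\<lambda>m::nat. \<integral>\<^sup>+\<omega>. ennreal (g \<omega>) \<partial>M)"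
    by (intro Liminf_mono always_eventually allI perturbed) simp
  also have "\<dots> = (\<integral>\<^sup>+\<omega>. ennreal (g \<omega>) \<partial>M)"
    by (rule lim_imp_Liminf[OF sequentially_bot tendsto_const])
  finally show ?thesis unfolding Q_def .
qed

text \<open>Provides the starting value for a single integral that is not part of an integral
  process, as for the Volterra kernel. Any simple integrands approximate, since \<open>{0}\<close>
  is a null set and simple integrals vanish at time 0.\<close>

lemma ito_integral_at_0:
  assumes "ito_integral M F Z t h Y" "0 \<le> t"
  shows "ito_integral M F Z 0 h (\<lambda>_. 0)"
proof -
  obtain n p \<xi> where F: "\<And>k::nat. simple_integrand F (n k) (p k) (\<xi> k)"
    by (rule ito_integral_approx[OF assms]) (rule that; assumption)
  have [simp]: "(\<integral>\<^sup>+s\<in>{0::real}. f s \<partial>lborel) = 0" for f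
    by (rule nn_integral_null_set) auto
  have "progressive_on F t h"
    using assms by (simp add: ito_integral_def)
  then have "progressive_on F 0 h"
    unfolding progressive_on_def using assms(2) by (intro ballI) (elim bspec, simp)
  then show ?thesis
    unfolding ito_integral_def using F
    by (intro conjI exI[of _ n] exI[of _ p] exI[of _ \<xi>]) (simp_all add: simple_integral_0)
qed

lemma ito_integral_0_AE:
  assumes "ito_integral M F Z 0 h Y"
  shows "AE \<omega> in M. Y \<omega> = 0"
proof -
  obtain n p \<xi> where F: "\<And>k::nat. simple_integrand F (n k) (p k) (\<xi> k)"
    and int: "vanish_prob (\<lambda>k \<omega>. ennreal \<bar>simple_integral Z (n k) (p k) (\<xi> k) 0 \<omega> - Y \<omega>\<bar>)"
    by (rule ito_integral_approx[OF assms order_refl]) (rule that; assumption)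
  obtain r where r: "AE \<omega> in M. (\<lambda>k. ennreal \<bar>simple_integral Z (n (r k)) (p (r k)) (\<xi> (r k)) 0 \<omega> - Y \<omega>\<bar>) \<longlonglongrightarrow> 0"
    by (rule vanish_prob_AE_subseq[OF int])
  then show ?thesis
  proof eventually_elim
    case (elim \<omega>)
    then have "(\<lambda>k::nat. ennreal \<bar>Y \<omega>\<bar>) \<longlonglongrightarrow> 0"
      by (simp add: simple_integral_0[OF F])
    then show ?case by (simp add: LIMSEQ_const_iff)
  qed
qed

lemma AE_eq_measurable_F:
  assumes t: "0 \<le> t" and X: "X \<in> borel_measurable (F t)" and Y: "Y \<in> borel_measurable M"
    and eq: "AE \<omega> in M. X \<omega> = (Y \<omega> :: real)"
  shows "Y \<in> borel_measurable (F t)"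
proof (rule measurableI)
  fix A :: "real set" assume A: "A \<in> sets borel"
  obtain N where N: "N \<in> null_sets M" "{\<omega> \<in> space M. X \<omega> \<noteq> Y \<omega>} \<subseteq> N"
    using eq by (auto simp: eventually_ae_filter)
  let ?X = "X -` A \<inter> space (F t)" and ?Y = "Y -` A \<inter> space (F t)"
  have X': "?X \<in> sets (F t)" using X A by (rule measurable_sets)
  have "?Y \<in> events" using measurable_sets[OF Y A] by (simp add: space_F[OF t])
  \<comment> \<open>The space need not be complete, so a subset of \<open>N\<close> may fail to be
    an event; this one is an event because \<open>Y\<close> is measurable for
    \<open>M\<close>.\<close>
  then have "N \<inter> ?Y \<in> null_sets M" by (rule null_set_Int2[OF N(1)])
  then have "N \<inter> ?Y \<in> sets (F t)" "N \<in> sets (F t)" using F_null[OF t] N(1) by auto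
  then have "(?X - N) \<union> (N \<inter> ?Y) \<in> sets (F t)" using X' by auto
  also have "(?X - N) \<union> (N \<inter> ?Y) = ?Y" using N(2) by (auto simp: space_F[OF t])
  finally show "?Y \<in> sets (F t)" .
qed simp

lemma ito_integral_adapted:
  assumes ito: "ito_integral M F Z t h Y" and t: "0 \<le> t"
  shows "Y \<in> borel_measurable (F t)"
proof -
  obtain n p \<xi> where F: "\<And>k::nat. simple_integrand F (n k) (p k) (\<xi> k)"
    and int: "vanish_prob (\<lambda>k \<omega>. ennreal \<bar>simple_integral Z (n k) (p k) (\<xi> k) t \<omega> - Y \<omega>\<bar>)"
    by (rule ito_integral_approx[OF ito t]) (rule that; assumption)
  obtain r where r: "AE \<omega> in M. (\<lambda>k. ennreal \<bar>simple_integral Z (n (r k)) (p (r k)) (\<xi> (r k)) t \<omega> - Y \<omega>\<bar>) \<longlonglongrightarrow> 0"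
    by (rule vanish_prob_AE_subseq[OF int])
  define J where "J k = simple_integral Z (n (r k)) (p (r k)) (\<xi> (r k)) t" for k
  have [measurable]: "J k \<in> borel_measurable (F t)" for k
    unfolding J_def simple_integral_def[abs_def]
  proof (intro borel_measurable_sum)
    fix i assume i: "i \<in> {..<n (r k)}"
    let ?p = "p (r k)"
    have p: "0 \<le> ?p i" "0 \<le> ?p (Suc i)" "?p i \<le> ?p (Suc i)" "\<xi> (r k) i \<in> borel_measurable (F (?p i))"
      using simple_integrand_nonneg[OF F, of i "r k"] simple_integrand_nonneg[OF F, of "Suc i" "r k"] F[of "r k"] i
      by (simp_all add: simple_integrand_def)
    show "(\<lambda>\<omega>. \<xi> (r k) i \<omega> * (Z (min t (?p (Suc i))) \<omega> - Z (min t (?p i)) \<omega>)) \<in> borel_measurable (F t)"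
    proof (cases "?p i \<le> t")
      case True
      have "\<xi> (r k) i \<in> borel_measurable (F t)"
        by (rule measurable_F_mono[OF p(1) True p(4)])
      moreover have "Z (min t q) \<in> borel_measurable (F t)" if "0 \<le> q" for q
        by (rule measurable_F_mono[OF _ _ Z_adapted]) (use t that in simp_all)
      ultimately show ?thesis using p(1,2) by (intro borel_measurable_times borel_measurable_diff) simp_all
    next
      \<comment> \<open>An interval that starts after \<open>t\<close> contributes 0, because both
        of its end points are cut to \<open>t\<close>; its coefficient need not be known at time
        \<open>t\<close>.\<close>
      case False
      then show ?thesis using p(3) by simp
    qed
  qed
  \<comment> \<open>The pointwise \<open>lim\<close> is measurable even where the sequence diverges
    and takes a default value; it agrees with \<open>Y\<close> almost surely, and the null sets in
    the filtration do the rest.\<close>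
  have lim: "(\<lambda>\<omega>. lim (\<lambda>k. J k \<omega>)) \<in> borel_measurable (F t)"
    by measurable
  have Y: "Y \<in> borel_measurable M" using ito by (simp add: ito_integral_def)
  have "AE \<omega> in M. lim (\<lambda>k. J k \<omega>) = Y \<omega>"
    using r
  proof eventually_elim
    case (elim \<omega>)
    then have "(\<lambda>k. enn2real (ennreal \<bar>J k \<omega> - Y \<omega>\<bar>)) \<longlonglongrightarrow> 0"
      unfolding J_def by (intro tendsto_enn2real) simp_all
    then have "(\<lambda>k. J k \<omega> - Y \<omega>) \<longlonglongrightarrow> 0" by (simp add: tendsto_rabs_zero_iff)
    then have "(\<lambda>k. J k \<omega>) \<longlonglongrightarrow> Y \<omega>" using LIM_zero_iff by blast
    then show ?case by (rule limI)
  qed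
  then show ?thesis by (rule AE_eq_measurable_F[OF t lim Y])
qed

end

section \<open>The filtration of two Brownian motions\<close>

context prob_space
begin

abbreviation generated ("\<Sigma>") where
  "\<Sigma> \<equiv> sigma_sets (space M)"

definition var_events :: "('a \<Rightarrow> real) \<Rightarrow> 'a set set" where
  "var_events X = {X -` C \<inter> space M | C. C \<in> sets borel}"

lemma var_events_I: "C \<in> sets borel \<Longrightarrow> X -` C \<inter> space M \<in> var_events X"
  by (auto simp: var_events_def)

lemma var_events_Pow: "var_events X \<subseteq> Pow (space M)"
  by (auto simp: var_events_def)

lemma measurable_sigma_var_events:
  assumes "var_events X \<subseteq> \<Sigma> G" "G \<subseteq> Pow (space M)"
  shows "X \<in> borel_measurable (sigma (space M) G)"
  using assms by (intro measurableI) (auto simp: space_measure_of_conv sets_measure_of var_events_def)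

lemma var_events_sigma_sets:
  assumes "X \<in> borel_measurable (sigma (space M) G)" "G \<subseteq> Pow (space M)"
  shows "var_events X \<subseteq> \<Sigma> G"
  using measurable_sets[OF assms(1)] assms(2) by (auto simp: space_measure_of_conv sets_measure_of var_events_def)

lemma Int_stable_var_events: "Int_stable (var_events X)"
  unfolding Int_stable_def var_events_def
proof safe
  fix C D :: "real set" assume "C \<in> sets borel" "D \<in> sets borel"
  then show "\<exists>E. X -` C \<inter> space M \<inter> (X -` D \<inter> space M) = X -` E \<inter> space M \<and> E \<in> sets borel"
    by (intro exI[of _ "C \<inter> D"]) auto
qed

lemma indep_set_mono:
  "indep_set A B \<Longrightarrow> A' \<subseteq> A \<Longrightarrow> B' \<subseteq> B \<Longrightarrow> indep_set A' B'"
  unfolding indep_sets2_eq by blast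

lemma standard_BM_measurable: "standard_BM M W \<Longrightarrow> 0 \<le> t \<Longrightarrow> W t \<in> borel_measurable M"
  by (simp add: standard_BM_def continuous_process_def)

text \<open>Generators of the past, as increments from time 0: these are sums of increments over a
  grid, whereas \<open>W u\<close> itself would bring in the variable \<open>W 0\<close>.\<close>

definition BM_past :: "(real \<Rightarrow> 'a \<Rightarrow> real) \<Rightarrow> real set \<Rightarrow> 'a set set" where
  "BM_past W J = (\<Union>u\<in>J. var_events (\<lambda>\<omega>. W u \<omega> - W 0 \<omega>))"

lemma BM_past_Pow: "BM_past W J \<subseteq> Pow (space M)"
  using var_events_Pow by (auto simp: BM_past_def)

text \<open>Independent increments are given only along strictly increasing grids. The finitely many
  times are therefore sorted together with 0 and \<open>s\<close>, and \<open>t\<close> is appended;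
  the increments from 0 telescope over the part of the grid up to \<open>s\<close>.\<close>

lemma BM_finite_past_indep:
  assumes W: "standard_BM M W" and st: "0 \<le> s" "s < t" and J: "finite J" "J \<subseteq> {0..s}"
  shows "indep_set (\<Sigma> (BM_past W J)) (\<Sigma> (var_events (\<lambda>\<omega>. W t \<omega> - W s \<omega>)))"
proof -
  let ?G = "insert 0 (insert s J)"
  have "\<exists>(n::nat) p. p 0 = 0 \<and> p ` {..n} = ?G \<and> (\<forall>i j. i < j \<longrightarrow> j \<le> n \<longrightarrow> p i < (p j :: real))"
    by (rule finite_set_grid) (use J st in auto)
  then obtain n :: nat and p where p0: "p 0 = 0" and img: "p ` {..n} = ?G"
    and less: "\<And>i j. i < j \<Longrightarrow> j \<le> n \<Longrightarrow> p i < p j" by blast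
  have pn: "p n = s"
  proof -
    have "s \<in> p ` {..n}" unfolding img by simp
    then obtain k where k: "k \<le> n" "s = p k" by auto
    have "p n \<in> ?G" unfolding img[symmetric] by simp
    then have "p n \<le> s" using J(2) st by auto
    then have "k = n" using less[of k n] k by (cases "k = n") auto
    then show ?thesis using k by simp
  qed
  \<comment> \<open>The index \<open>Suc n\<close> carries the time \<open>t\<close>. As
    \<open>p n = s\<close>, the increment with index \<open>n\<close> is the one from
    \<open>s\<close> to \<open>t\<close>.\<close>
  define q where "q i = (if i \<le> n then p i else t)" for i
  have q: "q i < q (Suc i)" if "i < Suc n" for i
    using less[of i "Suc i"] that pn st(2) by (cases "i = n") (auto simp: q_def)
  define inc where "inc i \<omega> = W (q (Suc i)) \<omega> - W (q i) \<omega>" for i \<omega>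
  have "0 \<le> q 0 \<and> (\<forall>i<Suc n. q i < q (Suc i))" using q p0 by (simp add: q_def)
  then have "indep_vars (\<lambda>_. borel) inc {..<Suc n}"
    using W unfolding standard_BM_def inc_def[abs_def] by blast
  then have ind: "indep_sets (\<lambda>i. var_events (inc i)) {..<Suc n}"
    unfolding indep_vars_def2 var_events_def by blast
  \<comment> \<open>Grouping by a Boolean: \<open>True\<close> collects the increments up to
    \<open>s\<close>, \<open>False\<close> the single one after it.\<close>
  have "indep_sets (\<lambda>b. \<Sigma> (\<Union>i\<in>(if b then {..<n} else {n}). var_events (inc i))) UNIV"
  proof (rule indep_sets_collect_sigma)
    have "(\<Union>b\<in>UNIV. if b then {..<n} else {n}) = {..<Suc n}"
      by (auto simp: UNIV_bool)
    then show "indep_sets (\<lambda>i. var_events (inc i)) (\<Union>b\<in>UNIV. if b then {..<n} else {n})"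
      using ind by simp
    show "disjoint_family_on (\<lambda>b. if b then {..<n} else {n}) UNIV"
      by (auto simp: disjoint_family_on_def)
  qed (rule Int_stable_var_events)
  then have "indep_set (\<Sigma> (\<Union>i\<in>{..<n}. var_events (inc i))) (\<Sigma> (\<Union>i\<in>{n}. var_events (inc i)))"
    unfolding indep_set_def by (rule indep_sets_mono_sets) (auto split: bool.splits)
  then show ?thesis
  proof (rule indep_set_mono)
    have "inc n = (\<lambda>\<omega>. W t \<omega> - W s \<omega>)"
      by (simp add: inc_def[abs_def] q_def pn)
    then show "\<Sigma> (var_events (\<lambda>\<omega>. W t \<omega> - W s \<omega>)) \<subseteq> \<Sigma> (\<Union>i\<in>{n}. var_events (inc i))"
      by simp
    let ?E = "\<Union>i\<in>{..<n}. var_events (inc i)"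
    have E: "?E \<subseteq> Pow (space M)" using var_events_Pow by auto
    have [measurable]: "inc i \<in> borel_measurable (sigma (space M) ?E)" if "i < n" for i
      by (rule measurable_sigma_var_events[OF _ E]) (use that in \<open>auto intro!: sigma_sets.Basic\<close>)
    have "BM_past W J \<subseteq> \<Sigma> ?E"
      unfolding BM_past_def
    proof (rule UN_least)
      fix u assume "u \<in> J"
      then have "u \<in> p ` {..n}" unfolding img by simp
      then obtain k where k: "k \<le> n" "u = p k" by auto
      have "W u \<omega> - W 0 \<omega> = (\<Sum>i<k. inc i \<omega>)" for \<omega>
      proof -
        have "(\<Sum>i<k. inc i \<omega>) = (\<Sum>i<k. W (q (Suc i)) \<omega> - W (q i) \<omega>)" by (simp add: inc_def)
        also have "\<dots> = W (q k) \<omega> - W (q 0) \<omega>" by (rule sum_lessThan_telescope)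
        finally show ?thesis using k p0 by (simp add: q_def)
      qed
      moreover have "(\<lambda>\<omega>. \<Sum>i<k. inc i \<omega>) \<in> borel_measurable (sigma (space M) ?E)"
        using k by (intro borel_measurable_sum) auto
      ultimately have "(\<lambda>\<omega>. W u \<omega> - W 0 \<omega>) \<in> borel_measurable (sigma (space M) ?E)" by simp
      then show "var_events (\<lambda>\<omega>. W u \<omega> - W 0 \<omega>) \<subseteq> \<Sigma> ?E"
        by (rule var_events_sigma_sets[OF _ E])
    qed
    then show "\<Sigma> (BM_past W J) \<subseteq> \<Sigma> ?E"
      by (rule sigma_sets_mono)
  qed
qed

text \<open>The sigma-algebras over finite sets of times form a directed family, since two of them
  lie in the one over the union. Their union is thus stable under intersection, and independence
  extends from it to the generated sigma-algebra.\<close>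

lemma BM_past_indep:
  assumes W: "standard_BM M W" and st: "0 \<le> s" "s < t"
  shows "indep_set (\<Sigma> (BM_past W {0..s})) (\<Sigma> (var_events (\<lambda>\<omega>. W t \<omega> - W s \<omega>)))"
proof -
  let ?I = "\<Sigma> (var_events (\<lambda>\<omega>. W t \<omega> - W s \<omega>))"
  define P where "P = (\<Union>J\<in>{J. finite J \<and> J \<subseteq> {0..s}}. \<Sigma> (BM_past W J))"
  have J: "indep_set (\<Sigma> (BM_past W J)) ?I" if "finite J" "J \<subseteq> {0..s}" for J
    by (rule BM_finite_past_indep[OF W st that])
  have "indep_set P ?I"
    using J J[of "{}"] unfolding indep_sets2_eq P_def by blast
  then have "indep_set (\<Sigma> P) (\<Sigma> ?I)"
  proof (rule indep_set_sigma_sets)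
    show "Int_stable P"
    proof (rule Int_stableI)
      fix a b assume "a \<in> P" "b \<in> P"
      then obtain J K where JK: "finite J" "J \<subseteq> {0..s}" "a \<in> \<Sigma> (BM_past W J)"
        "finite K" "K \<subseteq> {0..s}" "b \<in> \<Sigma> (BM_past W K)"
        by (auto simp: P_def)
      interpret sigma_algebra "space M" "\<Sigma> (BM_past W (J \<union> K))"
        by (rule sigma_algebra_sigma_sets[OF BM_past_Pow])
      have "\<Sigma> (BM_past W J) \<subseteq> \<Sigma> (BM_past W (J \<union> K))"
        "\<Sigma> (BM_past W K) \<subseteq> \<Sigma> (BM_past W (J \<union> K))"
        unfolding BM_past_def by (rule sigma_sets_subseteq, blast)+
      with JK(3,6) have "a \<inter> b \<in> \<Sigma> (BM_past W (J \<union> K))" by (intro Int) blast+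
      then show "a \<inter> b \<in> P" unfolding P_def by (rule UN_I[rotated]) (use JK(1,2,4,5) in simp)
    qed
    show "Int_stable ?I"
    proof (rule Int_stableI)
      interpret sigma_algebra "space M" ?I
        by (rule sigma_algebra_sigma_sets[OF var_events_Pow])
      show "x \<inter> y \<in> ?I" if "x \<in> ?I" "y \<in> ?I" for x y
        using that by auto
    qed
  qed
  then show ?thesis
  proof (rule indep_set_mono)
    have "var_events (\<lambda>\<omega>. W u \<omega> - W 0 \<omega>) \<subseteq> P" if "u \<in> {0..s}" for u
    proof -
      have "var_events (\<lambda>\<omega>. W u \<omega> - W 0 \<omega>) \<subseteq> \<Sigma> (BM_past W {u})"
        by (auto simp: BM_past_def intro: sigma_sets.Basic)
      then show ?thesis using that unfolding P_def by (intro SUP_upper2[of "{u}"]) auto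
    qed
    then have "BM_past W {0..s} \<subseteq> \<Sigma> P"
      unfolding BM_past_def by (intro UN_least order_trans[OF _ sigma_sets_superset_generator])
    then show "\<Sigma> (BM_past W {0..s}) \<subseteq> \<Sigma> P"
      by (rule sigma_sets_mono)
  qed (rule sigma_sets_superset_generator)
qed

section \<open>Joining two independent Brownian motions\<close>

definition path_events :: "(real \<Rightarrow> 'a \<Rightarrow> real) \<Rightarrow> 'a set set" where
  "path_events W = {(\<lambda>\<omega>. \<lambda>t\<in>{0..}. W t \<omega>) -` A \<inter> space M | A. A \<in> sets (Pi\<^sub>M {0..} (\<lambda>_. borel))}"

lemma path_events_Pow: "path_events W \<subseteq> Pow (space M)"
  by (auto simp: path_events_def)

lemma path_increment_events:
  assumes "0 \<le> u" "0 \<le> v"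
  shows "var_events (\<lambda>\<omega>. W v \<omega> - W u \<omega>) \<subseteq> \<Sigma> (path_events W)"
proof (rule var_events_sigma_sets[OF _ path_events_Pow])
  let ?N = "sigma (space M) (path_events W)"
  have path: "(\<lambda>\<omega>. \<lambda>t\<in>{0..}. W t \<omega>) \<in> ?N \<rightarrow>\<^sub>M Pi\<^sub>M {0..} (\<lambda>_. borel)"
    by (rule measurableI)
       (use path_events_Pow in \<open>auto simp: space_measure_of_conv sets_measure_of space_PiM path_events_def intro!: sigma_sets.Basic\<close>)
  have "(\<lambda>\<omega>. (\<lambda>t\<in>{0..}. W t \<omega>) q) \<in> borel_measurable ?N" if "0 \<le> q" for q
    by (rule measurable_compose[OF path measurable_component_singleton]) (use that in simp)
  then have "(\<lambda>\<omega>. W q \<omega>) \<in> borel_measurable ?N" if "0 \<le> q" for q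
    using that by simp
  then show "(\<lambda>\<omega>. W v \<omega> - W u \<omega>) \<in> borel_measurable ?N"
    using assms by (intro borel_measurable_diff)
qed

text \<open>The probability of a fourfold intersection is first split between the two processes,
  then within each process between past and increment, and finally regrouped. Intersections of one
  event from each process form a stable generator, so the product formula on them is enough.\<close>

lemma indep_set_combine:
  assumes path: "indep_set SW SB" and indW: "indep_set PW IW" and indB: "indep_set PB IB"
    and past: "PW \<subseteq> SW" "PB \<subseteq> SB" and inc: "IW \<subseteq> SW" "IB \<subseteq> SB"
    and sa: "sigma_algebra (space M) SW" "sigma_algebra (space M) SB" "sigma_algebra (space M) PW"
      "sigma_algebra (space M) PB" "sigma_algebra (space M) IW" "sigma_algebra (space M) IB"
  shows "indep_set (\<Sigma> (PW \<union> PB)) (\<Sigma> (IW \<union> IB))"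
proof -
  interpret SW: sigma_algebra "space M" SW by fact
  interpret SB: sigma_algebra "space M" SB by fact
  interpret PW: sigma_algebra "space M" PW by fact
  interpret PB: sigma_algebra "space M" PB by fact
  interpret IW: sigma_algebra "space M" IW by fact
  interpret IB: sigma_algebra "space M" IB by fact
  define P where "P = {x \<inter> y | x y. x \<in> PW \<and> y \<in> PB}"
  define I where "I = {x \<inter> y | x y. x \<in> IW \<and> y \<in> IB}"
  note ev = indep_setD_ev1[OF path] indep_setD_ev2[OF path]
  have "indep_set P I"
  proof (rule indep_setI)
    have Int_events: "{x \<inter> y | x y. x \<in> X \<and> y \<in> Y} \<subseteq> events" if "X \<subseteq> SW" "Y \<subseteq> SB" for X Y
    proof (rule subsetI)
      fix z assume "z \<in> {x \<inter> y | x y. x \<in> X \<and> y \<in> Y}"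
      then obtain x y where z: "z = x \<inter> y" and xy: "x \<in> X" "y \<in> Y" by blast
      show "z \<in> events"
        unfolding z by (rule sets.Int[OF subsetD[OF ev(1) subsetD[OF that(1) xy(1)]] subsetD[OF ev(2) subsetD[OF that(2) xy(2)]]])
    qed
    show "P \<subseteq> events" "I \<subseteq> events"
      unfolding P_def I_def by (rule Int_events[OF past] Int_events[OF inc])+
    fix x y assume "x \<in> P" "y \<in> I"
    then obtain x1 x2 y1 y2 where xy: "x = x1 \<inter> x2" "y = y1 \<inter> y2" "x1 \<in> PW" "x2 \<in> PB" "y1 \<in> IW" "y2 \<in> IB"
      unfolding P_def I_def by blast
    have S: "x1 \<in> SW" "y1 \<in> SW" "x2 \<in> SB" "y2 \<in> SB"
      using xy past inc by blast+
    have "prob (x \<inter> y) = prob ((x1 \<inter> y1) \<inter> (x2 \<inter> y2))"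
      unfolding xy by (simp add: Int_ac)
    also have "\<dots> = prob (x1 \<inter> y1) * prob (x2 \<inter> y2)"
      by (rule indep_setD[OF path SW.Int[OF S(1,2)] SB.Int[OF S(3,4)]])
    also have "\<dots> = (prob x1 * prob y1) * (prob x2 * prob y2)"
      using indep_setD[OF indW xy(3) xy(5)] indep_setD[OF indB xy(4) xy(6)] by simp
    also have "\<dots> = (prob x1 * prob x2) * (prob y1 * prob y2)" by simp
    also have "\<dots> = prob x * prob y"
      using indep_setD[OF path S(1) S(3)] indep_setD[OF path S(2) S(4)] by (simp add: xy)
    finally show "prob (x \<inter> y) = prob x * prob y" .
  qed
  then have ind: "indep_set (\<Sigma> P) (\<Sigma> I)"
  proof (rule indep_set_sigma_sets)
    have stable: "Int_stable {x \<inter> y | x y. x \<in> X \<and> y \<in> Y}"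
      if "sigma_algebra (space M) X" "sigma_algebra (space M) Y" for X Y
    proof (rule Int_stableI)
      interpret X: sigma_algebra "space M" X by fact
      interpret Y: sigma_algebra "space M" Y by fact
      fix a b assume "a \<in> {x \<inter> y | x y. x \<in> X \<and> y \<in> Y}" "b \<in> {x \<inter> y | x y. x \<in> X \<and> y \<in> Y}"
      then obtain x1 x2 y1 y2 where xy: "a = x1 \<inter> x2" "b = y1 \<inter> y2" "x1 \<in> X" "x2 \<in> Y" "y1 \<in> X" "y2 \<in> Y"
        by blast
      have "a \<inter> b = (x1 \<inter> y1) \<inter> (x2 \<inter> y2)" unfolding xy by (simp add: Int_ac)
      then show "a \<inter> b \<in> {x \<inter> y | x y. x \<in> X \<and> y \<in> Y}"
        using X.Int[OF xy(3,5)] Y.Int[OF xy(4,6)] by blast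
    qed
    show "Int_stable P" "Int_stable I"
      unfolding P_def I_def by (rule stable[OF sa(3,4)] stable[OF sa(5,6)])+
  qed
  have sub: "X \<union> Y \<subseteq> {x \<inter> y | x y. x \<in> X \<and> y \<in> Y}"
    if "sigma_algebra (space M) X" "sigma_algebra (space M) Y" for X Y
  proof -
    interpret X: sigma_algebra "space M" X by fact
    interpret Y: sigma_algebra "space M" Y by fact
    have "x = x \<inter> space M" if "x \<in> X \<union> Y" for x
      using that X.sets_into_space Y.sets_into_space by blast
    moreover from this have "x = space M \<inter> x" if "x \<in> X \<union> Y" for x
      using that by blast
    ultimately show ?thesis using X.top Y.top by blast
  qed
  have "\<Sigma> (PW \<union> PB) \<subseteq> \<Sigma> P"
    "\<Sigma> (IW \<union> IB) \<subseteq> \<Sigma> I"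
    unfolding P_def I_def by (intro sigma_sets_subseteq sub sa)+
  with ind show ?thesis by (rule indep_set_mono)
qed

lemma BM_pair_past_indep:
  fixes a b :: real
  assumes W: "standard_BM M W" and B: "standard_BM M B" and WB: "indep_processes M W B"
    and st: "0 \<le> s" "s < t"
    and A: "A \<in> \<Sigma> (BM_past W {0..s} \<union> BM_past B {0..s})"
    and C: "C \<in> sets borel"
  shows "prob (A \<inter> ((\<lambda>\<omega>. a * (W t \<omega> - W s \<omega>) + b * (B t \<omega> - B s \<omega>)) -` C \<inter> space M))
    = prob A * prob ((\<lambda>\<omega>. a * (W t \<omega> - W s \<omega>) + b * (B t \<omega> - B s \<omega>)) -` C \<inter> space M)"
proof -
  let ?P = "\<lambda>X. \<Sigma> (BM_past X {0..s})"
  let ?I = "\<lambda>X. \<Sigma> (var_events (\<lambda>\<omega>. X t \<omega> - X s \<omega>))"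
  let ?S = "\<lambda>X. \<Sigma> (path_events X)"
  have path: "indep_set (?S W) (?S B)"
    using WB unfolding indep_processes_def indep_var_eq path_events_def by (rule conjunct2)
  have past: "?P X \<subseteq> ?S X" for X
    unfolding BM_past_def
  proof (intro sigma_sets_mono UN_least)
    show "var_events (\<lambda>\<omega>. X u \<omega> - X 0 \<omega>) \<subseteq> ?S X" if "u \<in> {0..s}" for u
      by (rule path_increment_events) (use that in simp_all)
  qed
  have "0 \<le> t" using st by simp
  have inc: "?I X \<subseteq> ?S X" for X
    by (rule sigma_sets_mono[OF path_increment_events[OF st(1) \<open>0 \<le> t\<close>]])
  have ind: "indep_set (\<Sigma> (?P W \<union> ?P B)) (\<Sigma> (?I W \<union> ?I B))"
    by (rule indep_set_combine[OF path BM_past_indep[OF W st] BM_past_indep[OF B st] past past inc inc])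
       (rule sigma_algebra_sigma_sets BM_past_Pow var_events_Pow path_events_Pow)+
  have "BM_past W {0..s} \<union> BM_past B {0..s} \<subseteq> ?P W \<union> ?P B"
    by (intro Un_mono sigma_sets_superset_generator)
  from subsetD[OF sigma_sets_subseteq[OF this] A]
  have A': "A \<in> \<Sigma> (?P W \<union> ?P B)" .
  let ?G = "?I W \<union> ?I B"
  have G: "?G \<subseteq> Pow (space M)"
    using sigma_sets_into_sp[OF var_events_Pow] by blast
  have "var_events (\<lambda>\<omega>. W t \<omega> - W s \<omega>) \<subseteq> ?G" "var_events (\<lambda>\<omega>. B t \<omega> - B s \<omega>) \<subseteq> ?G"
    by (rule le_supI1[OF sigma_sets_superset_generator] le_supI2[OF sigma_sets_superset_generator])+
  from this[THEN order_trans, OF sigma_sets_superset_generator, THEN measurable_sigma_var_events, OF G]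
  have "(\<lambda>\<omega>. W t \<omega> - W s \<omega>) \<in> borel_measurable (sigma (space M) ?G)"
    "(\<lambda>\<omega>. B t \<omega> - B s \<omega>) \<in> borel_measurable (sigma (space M) ?G)"
    .
  then have "(\<lambda>\<omega>. a * (W t \<omega> - W s \<omega>) + b * (B t \<omega> - B s \<omega>)) \<in> borel_measurable (sigma (space M) ?G)"
    by (intro borel_measurable_add borel_measurable_times borel_measurable_const)
  from subsetD[OF var_events_sigma_sets[OF this G] var_events_I[OF C]]
  have "(\<lambda>\<omega>. a * (W t \<omega> - W s \<omega>) + b * (B t \<omega> - B s \<omega>)) -` C \<inter> space M \<in> \<Sigma> ?G" .
  then show ?thesis by (rule indep_setD[OF ind A'])
qed

section \<open>The augmented joint filtration\<close>

definition BM_generators :: "(real \<Rightarrow> 'a \<Rightarrow> real) \<Rightarrow> (real \<Rightarrow> 'a \<Rightarrow> real) \<Rightarrow> real \<Rightarrow> 'a set set" where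
  "BM_generators W B t = (\<Union>s\<in>{0..t}. var_events (W s) \<union> var_events (B s)) \<union> null_sets M"

lemma BM_filtration_eq: "BM_filtration M W B t = sigma (space M) (BM_generators W B t)"
  unfolding BM_filtration_def BM_generators_def var_events_def
  by (rule arg_cong[where f = "sigma (space M)"]) blast

lemma BM_generators_Pow: "BM_generators W B t \<subseteq> Pow (space M)"
  using sets.sets_into_space by (auto simp: BM_generators_def var_events_def null_sets_def)

lemma sets_BM_filtration: "sets (BM_filtration M W B t) = \<Sigma> (BM_generators W B t)"
  unfolding BM_filtration_eq by (rule sets_measure_of[OF BM_generators_Pow])

lemma space_BM_filtration: "space (BM_filtration M W B t) = space M"
  unfolding BM_filtration_eq by (rule space_measure_of_conv)

text \<open>The variable \<open>W 0\<close> vanishes only almost surely, whence the increments from time 0 and the null sets.\<close>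

lemma BM_filtration_approx:
  assumes W: "standard_BM M W" and B: "standard_BM M B" and t: "0 \<le> t"
    and A: "A \<in> sets (BM_filtration M W B t)"
  shows "A \<in> events \<and> (\<exists>A'\<in>\<Sigma> (BM_past W {0..t} \<union> BM_past B {0..t}).
    (A - A') \<union> (A' - A) \<in> null_sets M)"
  using A unfolding sets_BM_filtration
proof (induction A rule: sigma_sets.induct)
  let ?S = "\<Sigma> (BM_past W {0..t} \<union> BM_past B {0..t})"
  interpret S: sigma_algebra "space M" ?S
    by (rule sigma_algebra_sigma_sets) (use BM_past_Pow in blast)
  have var: "X -` C \<inter> space M \<in> events \<and> (\<exists>A'\<in>?S. (X -` C \<inter> space M - A') \<union> (A' - X -` C \<inter> space M) \<in> null_sets M)"
    if X: "X \<in> borel_measurable M" and X': "X' \<in> borel_measurable M" and C: "C \<in> sets borel"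
      and eq: "AE \<omega> in M. X \<omega> = X' \<omega>" and S: "X' -` C \<inter> space M \<in> ?S" for X X' :: "'a \<Rightarrow> real" and C
  proof (intro conjI bexI[OF _ S])
    show 1: "X -` C \<inter> space M \<in> events" using X C by (rule measurable_sets)
    have 2: "X' -` C \<inter> space M \<in> events" using X' C by (rule measurable_sets)
    show "(X -` C \<inter> space M - X' -` C \<inter> space M) \<union> (X' -` C \<inter> space M - X -` C \<inter> space M) \<in> null_sets M"
    proof (rule iffD2[OF AE_iff_null_sets])
      show "(X -` C \<inter> space M - X' -` C \<inter> space M) \<union> (X' -` C \<inter> space M - X -` C \<inter> space M) \<in> events"
        using 1 2 by auto
      show "AE \<omega> in M. \<omega> \<notin> (X -` C \<inter> space M - X' -` C \<inter> space M) \<union> (X' -` C \<inter> space M - X -` C \<inter> space M)"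
        using eq by eventually_elim auto
    qed
  qed
  have BM: "X s -` C \<inter> space M \<in> events \<and> (\<exists>A'\<in>?S. (X s -` C \<inter> space M - A') \<union> (A' - X s -` C \<inter> space M) \<in> null_sets M)"
    if X: "standard_BM M X" "BM_past X {0..t} \<subseteq> ?S" and s: "s \<in> {0..t}" and C: "C \<in> sets borel" for X s C
  proof (rule var[OF _ _ C])
    show m: "X s \<in> borel_measurable M" "(\<lambda>\<omega>. X s \<omega> - X 0 \<omega>) \<in> borel_measurable M"
      using standard_BM_measurable[OF X(1)] s by simp_all
    have "AE \<omega> in M. X 0 \<omega> = 0" using X(1) by (simp add: standard_BM_def)
    then show "AE \<omega> in M. X s \<omega> = X s \<omega> - X 0 \<omega>" by eventually_elim simp
    have "(\<lambda>\<omega>. X s \<omega> - X 0 \<omega>) -` C \<inter> space M \<in> BM_past X {0..t}"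
      unfolding BM_past_def using s var_events_I[OF C] by blast
    then show "(\<lambda>\<omega>. X s \<omega> - X 0 \<omega>) -` C \<inter> space M \<in> ?S" using X(2) by blast
  qed
  {
    case (Basic A)
    then consider s C where "s \<in> {0..t}" "C \<in> sets borel" "A = W s -` C \<inter> space M"
      | s C where "s \<in> {0..t}" "C \<in> sets borel" "A = B s -` C \<inter> space M" | "A \<in> null_sets M"
      unfolding BM_generators_def var_events_def by blast
    then show ?case
    proof cases
      case 1
      then show ?thesis using BM[OF W _ 1(1,2)] by (auto intro: sigma_sets.Basic)
    next
      case 2
      then show ?thesis using BM[OF B _ 2(1,2)] by (auto intro: sigma_sets.Basic)
    next
      case 3
      then show ?thesis by (intro conjI bexI[of _ "{}"]) auto
    qed
  next
    case Empty
    show ?case by (intro conjI bexI[of _ "{}"]) auto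
  next
    case (Compl A)
    then obtain A' where A': "A' \<in> ?S" "(A - A') \<union> (A' - A) \<in> null_sets M" by blast
    have "(space M - A - (space M - A')) \<union> (space M - A' - (space M - A)) = (A - A') \<union> (A' - A)"
      using Compl A'(1) sets.sets_into_space S.sets_into_space by blast
    then show ?case using A' Compl by (intro conjI bexI[of _ "space M - A'"]) auto
  next
    case (Union A)
    then have "\<forall>i. \<exists>A'. A' \<in> ?S \<and> (A i - A') \<union> (A' - A i) \<in> null_sets M" by blast
    then obtain A' where A': "\<And>i. A' i \<in> ?S" "\<And>i. (A i - A' i) \<union> (A' i - A i) \<in> null_sets M" by metis
    have ev: "A i \<in> events" for i using Union by blast
    have "\<Sigma> (BM_past W {0..t} \<union> BM_past B {0..t}) \<subseteq> events"
    proof (rule sets.sigma_sets_subset)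
      have "var_events (\<lambda>\<omega>. X u \<omega> - X 0 \<omega>) \<subseteq> events" if "standard_BM M X" "u \<in> {0..t}" for X u
      proof -
        have "(\<lambda>\<omega>. X u \<omega> - X 0 \<omega>) \<in> borel_measurable M"
          using that(2) by (intro borel_measurable_diff standard_BM_measurable[OF that(1)]) simp_all
        then show ?thesis unfolding var_events_def by (auto intro: measurable_sets)
      qed
      then show "BM_past W {0..t} \<union> BM_past B {0..t} \<subseteq> events"
        using W B unfolding BM_past_def by blast
    qed
    then have ev': "A' i \<in> events" for i using A'(1) by blast
    have N: "(\<Union>i. (A i - A' i) \<union> (A' i - A i)) \<in> null_sets M"
      using A'(2) by (rule null_sets_UN)
    have "(\<Union>i. A i) - (\<Union>i. A' i) \<union> ((\<Union>i. A' i) - (\<Union>i. A i)) \<in> null_sets M"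
      by (rule null_sets_subset[OF N]) (use ev ev' in auto)
    then show ?case using A' ev by (intro conjI bexI[of _ "\<Union>i. A' i"]) auto
  }
qed

lemma normal_combination:
  fixes a b :: real
  assumes W: "standard_BM M W" and B: "standard_BM M B" and WB: "indep_processes M W B"
    and st: "0 \<le> s" "s < t" and ab: "a\<^sup>2 + b\<^sup>2 = 1"
  shows "distributed M lborel (\<lambda>\<omega>. a * (W t \<omega> - W s \<omega>) + b * (B t \<omega> - B s \<omega>)) (normal_density 0 (sqrt (t - s)))"
proof -
  let ?\<tau> = "sqrt (t - s)"
  have \<tau>: "0 < ?\<tau>" using st by simp
  have dW: "distributed M lborel (\<lambda>\<omega>. W t \<omega> - W s \<omega>) (normal_density 0 ?\<tau>)"
    and dB: "distributed M lborel (\<lambda>\<omega>. B t \<omega> - B s \<omega>) (normal_density 0 ?\<tau>)"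
    using W B st by (simp_all add: standard_BM_def)
  have scale: "distributed M lborel (\<lambda>\<omega>. c * X \<omega>) (normal_density 0 (\<bar>c\<bar> * ?\<tau>))"
    if "distributed M lborel X (normal_density 0 ?\<tau>)" "c \<noteq> 0" for c and X :: "'a \<Rightarrow> real"
    using normal_density_affine[OF that(1) \<tau> that(2), of 0] by simp
  \<comment> \<open>A vanishing coefficient would give a point mass, which has no density, so the
    sum rule for normal variables applies only when both coefficients are nonzero.\<close>
  consider "a = 0" "\<bar>b\<bar> = 1" | "b = 0" "\<bar>a\<bar> = 1" | "a \<noteq> 0" "b \<noteq> 0"
    using ab by (cases "a = 0"; cases "b = 0") (auto simp: power2_eq_1_iff)
  then show ?thesis
  proof cases
    case 1
    then show ?thesis using scale[OF dB, of b] by auto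
  next
    case 2
    then show ?thesis using scale[OF dW, of a] by auto
  next
    case 3
    have "indep_var borel (\<lambda>\<omega>. a * (W t \<omega> - W s \<omega>)) borel (\<lambda>\<omega>. b * (B t \<omega> - B s \<omega>))"
    proof -
      have "indep_var borel ((\<lambda>p. a * (p t - p s)) \<circ> (\<lambda>\<omega>. \<lambda>t\<in>{0..}. W t \<omega>))
          borel ((\<lambda>p. b * (p t - p s)) \<circ> (\<lambda>\<omega>. \<lambda>t\<in>{0..}. B t \<omega>))"
      proof (rule indep_var_compose[OF WB[unfolded indep_processes_def]])
        have "(\<lambda>p. p q) \<in> borel_measurable (Pi\<^sub>M {0..} (\<lambda>_. borel :: real measure))" if "0 \<le> q" for q :: real
          by (rule measurable_component_singleton) (use that in simp)
        then have "(\<lambda>p. c * (p t - p s)) \<in> borel_measurable (Pi\<^sub>M {0..} (\<lambda>_. borel))" for c :: real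
          using st by (intro borel_measurable_times borel_measurable_const borel_measurable_diff) simp_all
        then show "(\<lambda>p. a * (p t - p s)) \<in> borel_measurable (Pi\<^sub>M {0..} (\<lambda>_. borel))"
          "(\<lambda>p. b * (p t - p s)) \<in> borel_measurable (Pi\<^sub>M {0..} (\<lambda>_. borel))" by blast+
      qed
      then show ?thesis using st by (simp add: comp_def)
    qed
    then have "distributed M lborel (\<lambda>\<omega>. a * (W t \<omega> - W s \<omega>) + b * (B t \<omega> - B s \<omega>))
        (normal_density (0 + 0) (sqrt ((\<bar>a\<bar> * ?\<tau>)\<^sup>2 + (\<bar>b\<bar> * ?\<tau>)\<^sup>2)))"
      by (rule add_indep_normal) (use 3 \<tau> scale[OF dW 3(1)] scale[OF dB 3(2)] in simp_all)
    moreover have "(\<bar>a\<bar> * ?\<tau>)\<^sup>2 + (\<bar>b\<bar> * ?\<tau>)\<^sup>2 = t - s"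
      using ab st by (simp add: power_mult_distrib flip: distrib_right)
    ultimately show ?thesis by simp
  qed
qed

text \<open>Serves twice: the correlation coefficients give the driver \<open>Z\<close> of the
  price, and the coefficients 1 and 0 show that \<open>W\<close> remains a Brownian motion in the
  larger filtration, where the Volterra integral is taken.\<close>

lemma filtered_BM_combination:
  fixes a b :: real
  assumes W: "standard_BM M W" and B: "standard_BM M B" and WB: "indep_processes M W B"
    and ab: "a\<^sup>2 + b\<^sup>2 = 1"
  shows "filtered_BM M (BM_filtration M W B) (\<lambda>t \<omega>. a * W t \<omega> + b * B t \<omega>)"
proof unfold_locales
  let ?F = "BM_filtration M W B"
  have var: "var_events (X s) \<subseteq> events" if "standard_BM M X" "0 \<le> s" for X s
    using measurable_sets[OF standard_BM_measurable[OF that]] by (auto simp: var_events_def)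
  have gen: "BM_generators W B t \<subseteq> events" for t
  proof -
    have "var_events (W s) \<union> var_events (B s) \<subseteq> events" if "s \<in> {0..t}" for s
      using var[OF W, of s] var[OF B, of s] that by simp
    then show ?thesis unfolding BM_generators_def null_sets_def by blast
  qed
  have sets: "sets (?F t) \<subseteq> events" for t
    unfolding sets_BM_filtration by (rule sets.sigma_sets_subset[OF gen])
  show "subalgebra M (?F t)" for t
    using sets by (simp add: subalgebra_def space_BM_filtration)
  show "sets (?F s) \<subseteq> sets (?F t)" if "0 \<le> s" "s \<le> t" for s t
    unfolding sets_BM_filtration
  proof (rule sigma_sets_subseteq)
    have "{0..s} \<subseteq> {0..t}" using that by simp
    then show "BM_generators W B s \<subseteq> BM_generators W B t"
      unfolding BM_generators_def by blast
  qed
  show "null_sets M \<subseteq> sets (?F t)" for t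
    unfolding sets_BM_filtration BM_generators_def by (auto intro: sigma_sets.Basic)
  show "(\<lambda>\<omega>. a * W t \<omega> + b * B t \<omega>) \<in> borel_measurable (?F t)" if t: "0 \<le> t" for t
  proof -
    have "var_events (W t) \<subseteq> BM_generators W B t" "var_events (B t) \<subseteq> BM_generators W B t"
      using t by (auto simp: BM_generators_def)
    from this[THEN order_trans, OF sigma_sets_superset_generator, THEN measurable_sigma_var_events, OF BM_generators_Pow]
    have "W t \<in> borel_measurable (?F t)" "B t \<in> borel_measurable (?F t)"
      unfolding BM_filtration_eq .
    then show ?thesis by measurable
  qed
  fix s t :: real assume st: "0 \<le> s" "s < t"
  have eq: "(\<lambda>\<omega>. a * W t \<omega> + b * B t \<omega> - (a * W s \<omega> + b * B s \<omega>))
      = (\<lambda>\<omega>. a * (W t \<omega> - W s \<omega>) + b * (B t \<omega> - B s \<omega>))"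
    by (simp add: algebra_simps)
  show "distributed M lborel (\<lambda>\<omega>. a * W t \<omega> + b * B t \<omega> - (a * W s \<omega> + b * B s \<omega>)) (normal_density 0 (sqrt (t - s)))"
    unfolding eq by (rule normal_combination[OF W B WB st ab])
  fix A and C :: "real set" assume A: "A \<in> sets (?F s)" and C: "C \<in> sets borel"
  let ?E = "(\<lambda>\<omega>. a * W t \<omega> + b * B t \<omega> - (a * W s \<omega> + b * B s \<omega>)) -` C \<inter> space M"
  \<comment> \<open>Independence was proved for the past generated by increments. The event
    \<open>A\<close> of the augmented filtration differs from such an \<open>A'\<close> by a null
    set, so neither side of the product formula changes.\<close>
  obtain A' where A': "A' \<in> \<Sigma> (BM_past W {0..s} \<union> BM_past B {0..s})"
    "(A - A') \<union> (A' - A) \<in> null_sets M"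
    using BM_filtration_approx[OF W B st(1) A] by blast
  have "var_events (\<lambda>\<omega>. X u \<omega> - X 0 \<omega>) \<subseteq> events" if "standard_BM M X" "u \<in> {0..s}" for X u
  proof -
    have "(\<lambda>\<omega>. X u \<omega> - X 0 \<omega>) \<in> borel_measurable M"
      using that(2) by (intro borel_measurable_diff standard_BM_measurable[OF that(1)]) simp_all
    then show ?thesis unfolding var_events_def by (auto intro: measurable_sets)
  qed
  then have "BM_past W {0..s} \<union> BM_past B {0..s} \<subseteq> events"
    using W B unfolding BM_past_def by blast
  then have ev': "A' \<in> events" using A'(1) sets.sigma_sets_subset by blast
  have ev: "A \<in> events" using A sets by blast
  have E: "?E \<in> events"
    using st by (intro measurable_sets[OF _ C] borel_measurable_diff borel_measurable_add borel_measurable_times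
        borel_measurable_const standard_BM_measurable[OF W] standard_BM_measurable[OF B]) simp_all
  have AE: "AE \<omega> in M. \<omega> \<in> A \<longleftrightarrow> \<omega> \<in> A'"
    using AE_not_in[OF A'(2)] by eventually_elim auto
  have "prob (A \<inter> ?E) = prob (A' \<inter> ?E)"
    by (rule finite_measure_eq_AE) (use AE ev ev' E in auto)
  also have "\<dots> = prob A' * prob ?E"
    unfolding eq by (rule BM_pair_past_indep[OF W B WB st A'(1) C])
  also have "prob A' = prob A"
    by (rule finite_measure_eq_AE) (use AE ev ev' in auto)
  finally show "prob (A \<inter> ?E) = prob A * prob ?E" .
qed

end

section \<open>The exponential supermartingale\<close>

text \<open>Continuity of \<open>h\<close> makes the quadratic variation finite and continuous in
  time in every scenario, not just almost surely; the passage arguments work path by path.\<close>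

locale ito_exponential = filtered_BM M F Z for M :: "'a measure" and F Z +
  fixes h I :: "real \<Rightarrow> 'a \<Rightarrow> real"
  assumes ito: "ito_integral_process M F Z h I"
    and h_cont: "\<omega> \<in> space M \<Longrightarrow> continuous_on {0..} (\<lambda>t. h t \<omega>)"
begin

definition Q :: "real \<Rightarrow> 'a \<Rightarrow> real" where
  "Q t \<omega> = (LINT r:{0..t}|lborel. (h r \<omega>)\<^sup>2)"

text \<open>The Doleans-Dade exponential of \<open>c * I\<close>; for \<open>c = 1\<close> it is the
  price divided by its initial value.\<close>

definition E :: "real \<Rightarrow> real \<Rightarrow> 'a \<Rightarrow> real" where
  "E c t \<omega> = exp (c * I t \<omega> - c\<^sup>2 * Q t \<omega> / 2)"

lemma ito_I: "0 \<le> t \<Longrightarrow> ito_integral M F Z t h (I t)"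
  using ito by (simp add: ito_integral_process_def)

lemma prog_h: "0 \<le> t \<Longrightarrow> progressive_on F t h"
  using ito_I[of t] by (simp add: ito_integral_def)

lemma I_cont: "\<omega> \<in> space M \<Longrightarrow> continuous_on {0..} (\<lambda>t. I t \<omega>)"
  using ito by (simp add: ito_integral_process_def continuous_process_def)

lemma I_measurable_F: "0 \<le> t \<Longrightarrow> I t \<in> borel_measurable (F t)"
  by (rule ito_integral_adapted[OF ito_I])

lemma h_square_cont: "\<omega> \<in> space M \<Longrightarrow> 0 \<le> s \<Longrightarrow> continuous_on {s..t} (\<lambda>r. (h r \<omega>)\<^sup>2)"
  by (intro continuous_on_power continuous_on_subset[OF h_cont]) auto

lemma h_square_integrable: "\<omega> \<in> space M \<Longrightarrow> 0 \<le> s \<Longrightarrow> set_integrable lborel {s..t} (\<lambda>r. (h r \<omega>)\<^sup>2)"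
  by (intro borel_integrable_atLeastAtMost' h_square_cont)

lemma Q_eq_integral: "\<omega> \<in> space M \<Longrightarrow> Q t \<omega> = integral {0..t} (\<lambda>r. (h r \<omega>)\<^sup>2)"
  unfolding Q_def by (rule set_borel_integral_eq_integral(2)[OF h_square_integrable]) simp_all

lemma Q_Ioc: "Q t \<omega> = (LINT r:{0<..t}|lborel. (h r \<omega>)\<^sup>2)"
  unfolding Q_def by (rule set_integral_discrete_difference[where X = "{0}"]) auto

lemma Q_nonneg: "0 \<le> Q t \<omega>"
  unfolding Q_def set_lebesgue_integral_def by (intro integral_nonneg_AE) simp

lemma Q_split:
  assumes \<omega>: "\<omega> \<in> space M" and st: "0 \<le> s" "s \<le> t"
  shows "Q t \<omega> = Q s \<omega> + (LINT r:{s<..t}|lborel. (h r \<omega>)\<^sup>2)"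
proof -
  have "{0..t} = {0..s} \<union> {s<..t}" "{0..s} \<inter> {s<..t} = {}" using st by auto
  moreover have "set_integrable lborel {0..s} (\<lambda>r. (h r \<omega>)\<^sup>2)"
    by (rule h_square_integrable[OF \<omega> order_refl])
  moreover have "set_integrable lborel {s<..t} (\<lambda>r. (h r \<omega>)\<^sup>2)"
    by (rule set_integrable_subset[OF h_square_integrable[OF \<omega> st(1), of t]]) auto
  ultimately show ?thesis
    unfolding Q_def by (metis set_integral_Un)
qed

lemma Q_mono: "\<omega> \<in> space M \<Longrightarrow> 0 \<le> s \<Longrightarrow> s \<le> t \<Longrightarrow> Q s \<omega> \<le> Q t \<omega>"
  unfolding Q_split[of \<omega> s t] set_lebesgue_integral_def by (simp add: integral_nonneg_AE)

lemma Q_cont: "\<omega> \<in> space M \<Longrightarrow> continuous_on {0..T} (\<lambda>t. Q t \<omega>)"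
  unfolding Q_eq_integral
  by (intro indefinite_integral_continuous_1 integrable_continuous_real h_square_cont) simp_all

lemma Q_measurable_F:
  assumes t: "0 \<le> t"
  shows "Q t \<in> borel_measurable (F t)"
proof -
  note [measurable] = progressive_measurable[OF prog_h[OF t] t order_refl]
  have "(\<lambda>(\<omega>, r). (indicator {0..t} r * h r \<omega>)\<^sup>2) \<in> borel_measurable (F t \<Otimes>\<^sub>M lborel)"
    by measurable
  then have "(\<lambda>\<omega>. LINT r|lborel. (indicator {0..t} r * h r \<omega>)\<^sup>2) \<in> borel_measurable (F t)"
    by (rule lborel.borel_measurable_lebesgue_integral)
  also have "(\<lambda>\<omega>. LINT r|lborel. (indicator {0..t} r * h r \<omega>)\<^sup>2) = Q t"
    unfolding Q_def[abs_def] set_lebesgue_integral_def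
    by (intro ext Bochner_Integration.integral_cong) (auto simp: indicator_def)
  finally show ?thesis .
qed

lemma E_measurable_F: "0 \<le> t \<Longrightarrow> E c t \<in> borel_measurable (F t)"
  unfolding E_def[abs_def] using I_measurable_F[of t] Q_measurable_F[of t] by measurable

lemma E_measurable: "0 \<le> t \<Longrightarrow> E c t \<in> borel_measurable M"
  by (rule measurable_F_M[OF _ E_measurable_F])

lemma Q_measurable: "0 \<le> t \<Longrightarrow> Q t \<in> borel_measurable M"
  by (rule measurable_F_M[OF _ Q_measurable_F])

lemma I_measurable: "0 \<le> t \<Longrightarrow> I t \<in> borel_measurable M"
  by (rule measurable_F_M[OF _ I_measurable_F])

text \<open>The exponential inequality is applied with the weight
  \<open>indicator A * E c s\<close>, which belongs to the past of \<open>s\<close>; splitting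
  \<open>Q\<close> at \<open>s\<close> recombines the two factors into \<open>E c t\<close>.\<close>

lemma E_supermartingale:
  assumes st: "0 \<le> s" "s \<le> t" and A: "A \<in> sets (F s)"
  shows "(\<integral>\<^sup>+\<omega>\<in>A. ennreal (E c t \<omega>) \<partial>M) \<le> (\<integral>\<^sup>+\<omega>\<in>A. ennreal (E c s \<omega>) \<partial>M)"
proof -
  have t: "0 \<le> t" using st by simp
  have "(\<lambda>\<omega>. indicator A \<omega> * E c s \<omega>) \<in> borel_measurable (F s)"
    using A E_measurable_F[OF st(1), of c] by measurable
  from ito_integral_exp_le[OF ito_I[OF t] ito_I[OF st(1)] st this, of c]
  have "(\<integral>\<^sup>+\<omega>. ennreal (indicator A \<omega> * E c s \<omega> * exp (c * (I t \<omega> - I s \<omega>)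
      - c\<^sup>2 * (LINT r:{s<..t}|lborel. (h r \<omega>)\<^sup>2) / 2)) \<partial>M) \<le> (\<integral>\<^sup>+\<omega>. ennreal (indicator A \<omega> * E c s \<omega>) \<partial>M)"
    by (simp add: E_def)
  also have "(\<integral>\<^sup>+\<omega>. ennreal (indicator A \<omega> * E c s \<omega> * exp (c * (I t \<omega> - I s \<omega>)
      - c\<^sup>2 * (LINT r:{s<..t}|lborel. (h r \<omega>)\<^sup>2) / 2)) \<partial>M) = (\<integral>\<^sup>+\<omega>\<in>A. ennreal (E c t \<omega>) \<partial>M)"
  proof (intro nn_integral_cong)
    fix \<omega> assume \<omega>: "\<omega> \<in> space M"
    have "E c t \<omega> = E c s \<omega> * exp (c * (I t \<omega> - I s \<omega>) - c\<^sup>2 * (LINT r:{s<..t}|lborel. (h r \<omega>)\<^sup>2) / 2)"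
      unfolding E_def exp_add[symmetric] Q_split[OF \<omega> st] by (simp add: field_simps)
    then show "ennreal (indicator A \<omega> * E c s \<omega> * exp (c * (I t \<omega> - I s \<omega>)
        - c\<^sup>2 * (LINT r:{s<..t}|lborel. (h r \<omega>)\<^sup>2) / 2)) = ennreal (E c t \<omega>) * indicator A \<omega>"
      by (simp add: indicator_def)
  qed
  also have "(\<integral>\<^sup>+\<omega>. ennreal (indicator A \<omega> * E c s \<omega>) \<partial>M) = (\<integral>\<^sup>+\<omega>\<in>A. ennreal (E c s \<omega>) \<partial>M)"
    by (intro nn_integral_cong) (simp add: indicator_def)
  finally show ?thesis .
qed

lemma E_0: "AE \<omega> in M. E c 0 \<omega> = 1"
  using ito_integral_0_AE[OF ito_I[OF order_refl]]
proof eventually_elim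
  case (elim \<omega>)
  then show ?case by (simp add: E_def Q_Ioc set_lebesgue_integral_def)
qed

lemma nn_integral_E_0: "(\<integral>\<^sup>+\<omega>. ennreal (E c 0 \<omega>) \<partial>M) = 1"
proof -
  have "(\<integral>\<^sup>+\<omega>. ennreal (E c 0 \<omega>) \<partial>M) = (\<integral>\<^sup>+\<omega>. 1 \<partial>M)"
    by (rule nn_integral_cong_AE) (use E_0[of c] in eventually_elim, simp)
  then show ?thesis by (simp add: emeasure_space_1)
qed

text \<open>Optional stopping at the first grid time at which the level is reached: the first summand accounts
  for the paths stopped before \<open>t n\<close>, the second for the others.\<close>

lemma E_maximal_grid:
  assumes t: "0 \<le> t 0" "\<And>j. t j \<le> t (Suc j)"
  shows "ennreal a * emeasure M {\<omega> \<in> space M. \<exists>i<n. a \<le> E c (t i) \<omega>}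
    + (\<integral>\<^sup>+\<omega>\<in>{\<omega> \<in> space M. \<forall>i<n. E c (t i) \<omega> < a}. ennreal (E c (t n) \<omega>) \<partial>M)
    \<le> (\<integral>\<^sup>+\<omega>. ennreal (E c (t 0) \<omega>) \<partial>M)"
proof (induction n)
  case 0
  have "(\<integral>\<^sup>+\<omega>. ennreal (E c (t 0) \<omega>) * indicator (space M) \<omega> \<partial>M) = (\<integral>\<^sup>+\<omega>. ennreal (E c (t 0) \<omega>) \<partial>M)"
    by (intro nn_integral_cong) simp
  then show ?case by simp
next
  case (Suc n)
  have mono: "t i \<le> t j" if "i \<le> j" for i j
    using that t(2) by (rule lift_Suc_mono_le[rotated])
  have nonneg: "0 \<le> t j" for j
    using t(1) mono[of 0 j] by simp
  have [measurable]: "E c (t i) \<in> borel_measurable M" for i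
    by (rule E_measurable[OF nonneg])
  define D where "D n = {\<omega> \<in> space M. \<exists>i<n. a \<le> E c (t i) \<omega>}" for n
  define B where "B n = {\<omega> \<in> space M. \<forall>i<n. E c (t i) \<omega> < a}" for n
  define A where "A = B n \<inter> {\<omega> \<in> space M. a \<le> E c (t n) \<omega>}"
  have [measurable]: "D n \<in> events" "B n \<in> events" "A \<in> events" for n
    unfolding D_def B_def A_def by measurable
  \<comment> \<open>\<open>B (Suc n)\<close> constrains the values up to and including time
    \<open>t n\<close>. It is therefore known at \<open>t n\<close>, and the supermartingale step to
    \<open>t (Suc n)\<close> is allowed on it.\<close>
  have BF: "B (Suc n) \<in> sets (F (t n))"
  proof -
    have "E c (t i) \<in> borel_measurable (F (t n))" if "i < Suc n" for i
      by (rule measurable_F_mono[OF nonneg mono E_measurable_F[OF nonneg]]) (use that in simp)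
    then have "{\<omega> \<in> space (F (t n)). E c (t i) \<omega> < a} \<in> sets (F (t n))" if "i \<in> {..<Suc n}" for i
      using that by (intro borel_measurable_less borel_measurable_const) simp
    then have "{\<omega> \<in> space (F (t n)). \<forall>i\<in>{..<Suc n}. E c (t i) \<omega> < a} \<in> sets (F (t n))"
      by (rule sets.sets_Collect_finite_All[OF _ finite_lessThan])
    then show ?thesis by (simp only: B_def space_F[OF nonneg] lessThan_iff Ball_def)
  qed
  have D: "emeasure M (D (Suc n)) = emeasure M (D n) + emeasure M A"
  proof -
    have "D (Suc n) = D n \<union> A" "D n \<inter> A = {}"
      by (auto simp: D_def A_def B_def less_Suc_eq not_le)
    then show ?thesis by (simp add: plus_emeasure)
  qed
  have B: "(\<integral>\<^sup>+\<omega>\<in>B n. ennreal (E c (t n) \<omega>) \<partial>M)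
      = (\<integral>\<^sup>+\<omega>\<in>A. ennreal (E c (t n) \<omega>) \<partial>M) + (\<integral>\<^sup>+\<omega>\<in>B (Suc n). ennreal (E c (t n) \<omega>) \<partial>M)"
  proof -
    have ind: "indicator (B n) \<omega> = (indicator A \<omega> + indicator (B (Suc n)) \<omega> :: ennreal)" if "\<omega> \<in> space M" for \<omega>
      using that by (auto simp: A_def B_def indicator_def less_Suc_eq not_le)
    have "(\<integral>\<^sup>+\<omega>\<in>B n. ennreal (E c (t n) \<omega>) \<partial>M)
        = (\<integral>\<^sup>+\<omega>. ennreal (E c (t n) \<omega>) * indicator A \<omega> + ennreal (E c (t n) \<omega>) * indicator (B (Suc n)) \<omega> \<partial>M)"
      by (intro nn_integral_cong) (simp only: ind distrib_left)
    also have "\<dots> = (\<integral>\<^sup>+\<omega>\<in>A. ennreal (E c (t n) \<omega>) \<partial>M) + (\<integral>\<^sup>+\<omega>\<in>B (Suc n). ennreal (E c (t n) \<omega>) \<partial>M)"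
      by (rule nn_integral_add) measurable
    finally show ?thesis .
  qed
  have A: "ennreal a * emeasure M A \<le> (\<integral>\<^sup>+\<omega>\<in>A. ennreal (E c (t n) \<omega>) \<partial>M)"
  proof -
    have "ennreal a * emeasure M A = (\<integral>\<^sup>+\<omega>\<in>A. ennreal a \<partial>M)"
      by (subst nn_integral_cmult_indicator) auto
    also have "\<dots> \<le> (\<integral>\<^sup>+\<omega>\<in>A. ennreal (E c (t n) \<omega>) \<partial>M)"
      by (intro nn_integral_mono) (auto simp: A_def indicator_def intro: ennreal_leI)
    finally show ?thesis .
  qed
  have "ennreal a * emeasure M (D (Suc n)) + (\<integral>\<^sup>+\<omega>\<in>B (Suc n). ennreal (E c (t (Suc n)) \<omega>) \<partial>M)
    \<le> ennreal a * emeasure M (D n) + ((\<integral>\<^sup>+\<omega>\<in>A. ennreal (E c (t n) \<omega>) \<partial>M) + (\<integral>\<^sup>+\<omega>\<in>B (Suc n). ennreal (E c (t n) \<omega>) \<partial>M))"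
    unfolding D distrib_left add.assoc by (intro add_mono order_refl A E_supermartingale nonneg t BF)
  also have "\<dots> \<le> (\<integral>\<^sup>+\<omega>. ennreal (E c (t 0) \<omega>) \<partial>M)"
    unfolding B[symmetric] using Suc.IH by (simp add: D_def B_def)
  finally show ?case by (simp only: D_def B_def)
qed

end

section \<open>Uniform grids and continuous paths\<close>

definition grid :: "real \<Rightarrow> nat \<Rightarrow> nat \<Rightarrow> real" where
  "grid T n j = T * real j / real (Suc n)"

lemma grid_0 [simp]: "grid T n 0 = 0"
  by (simp add: grid_def)

lemma grid_mono: "0 \<le> T \<Longrightarrow> i \<le> j \<Longrightarrow> grid T n i \<le> grid T n j"
  unfolding grid_def by (intro divide_right_mono mult_left_mono) simp_all

lemma grid_nonneg: "0 \<le> T \<Longrightarrow> 0 \<le> grid T n j"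
  by (simp add: grid_def)

lemma grid_le: "0 \<le> T \<Longrightarrow> j \<le> Suc n \<Longrightarrow> grid T n j \<le> T"
  using grid_mono[of T j "Suc n" n] by (simp add: grid_def)

lemma grid_Suc: "grid T n (Suc j) - grid T n j = T / real (Suc n)"
  unfolding grid_def diff_divide_distrib[symmetric] right_diff_distrib[symmetric] by simp

lemma grid_near:
  assumes "0 < T" "0 \<le> t" "t \<le> T"
  shows "\<exists>j\<le>Suc n. \<bar>grid T n j - t\<bar> \<le> T / real (Suc n)"
proof (intro exI conjI)
  let ?q = "t * real (Suc n) / T"
  let ?j = "nat \<lfloor>?q\<rfloor>"
  have q: "0 \<le> ?q" "?q \<le> real (Suc n)"
    using assms by (simp_all add: divide_le_eq mult_right_mono)
  have j: "real ?j \<le> ?q" "?q < real ?j + 1"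
    using q(1) by linarith+
  show "?j \<le> Suc n" using j(1) q(2) by linarith
  have t: "t = T * ?q / real (Suc n)" using assms(1) by simp
  have "grid T n ?j - t = (T / real (Suc n)) * (real ?j - ?q)"
    unfolding grid_def by (subst t) (simp add: right_diff_distrib diff_divide_distrib)
  also have "\<bar>\<dots>\<bar> = (T / real (Suc n)) * \<bar>real ?j - ?q\<bar>"
    using assms(1) by (simp add: abs_mult)
  also have "\<dots> \<le> (T / real (Suc n)) * 1"
  proof (rule mult_left_mono)
    show "\<bar>real ?j - ?q\<bar> \<le> 1" using j by linarith
  qed (use assms(1) in simp)
  finally show "\<bar>grid T n ?j - t\<bar> \<le> T / real (Suc n)" by simp
qed

lemma eventually_grid_mesh:
  assumes "0 < \<delta>"
  shows "\<forall>\<^sub>F n in sequentially. T / real (Suc n) < \<delta>"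
proof -
  have "(\<lambda>n. T / real (Suc n)) \<longlonglongrightarrow> 0"
    by (rule LIMSEQ_Suc[OF lim_const_over_n])
  then show ?thesis using assms by (rule order_tendstoD)
qed

text \<open>The strict inequality is stable under a small change of time, and fine grids have points
  near \<open>t\<close>. A path that merely touches a level can be missed by every grid, so later
  estimates lower the level slightly.\<close>

lemma eventually_grid_cross:
  fixes f :: "real \<Rightarrow> real"
  assumes f: "continuous_on {0..T} f" and T: "0 < T" and t: "t \<in> {0..T}" and a: "a < f t"
  shows "\<forall>\<^sub>F n in sequentially. \<exists>j\<le>Suc n. a < f (grid T n j)"
proof -
  obtain \<delta> where \<delta>: "0 < \<delta>" "\<And>t'. t' \<in> {0..T} \<Longrightarrow> dist t' t < \<delta> \<Longrightarrow> dist (f t') (f t) < f t - a"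
    using f t a unfolding continuous_on_iff by (metis diff_gt_0_iff_gt)
  show ?thesis
    using eventually_grid_mesh[OF \<delta>(1), of T]
  proof eventually_elim
    case (elim n)
    obtain j where j: "j \<le> Suc n" "\<bar>grid T n j - t\<bar> \<le> T / real (Suc n)"
      using grid_near[OF T, of t n] t by auto
    have "grid T n j \<in> {0..T}" using T j(1) grid_nonneg[of T n j] grid_le[of T j n] by simp
    moreover have "dist (grid T n j) t < \<delta>" using j(2) elim by (simp add: dist_real_def)
    ultimately have "dist (f (grid T n j)) (f t) < f t - a" by (rule \<delta>(2))
    then have "a < f (grid T n j)" by (simp add: dist_real_def abs_if split: if_splits)
    then show ?case using j(1) by blast
  qed
qed

context prob_space
begin

text \<open>Transfers a bound that is uniform over grids to continuous time: the indicator of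
  \<open>H\<close> lies below the lower limit of the indicators of the \<open>A n\<close>, and
  Fatou's lemma applies.\<close>

lemma nn_integral_le_of_eventually_mem:
  assumes [measurable]: "\<And>n. A n \<in> events" "f \<in> borel_measurable M"
    and ev: "\<And>\<omega>. \<omega> \<in> H \<Longrightarrow> \<forall>\<^sub>F n in sequentially. \<omega> \<in> A n"
    and K: "\<And>n. (\<integral>\<^sup>+\<omega>\<in>A n. f \<omega> \<partial>M) \<le> K"
  shows "(\<integral>\<^sup>+\<omega>\<in>H. f \<omega> \<partial>M) \<le> K"
proof -
  have "(\<integral>\<^sup>+\<omega>\<in>H. f \<omega> \<partial>M) \<le> (\<integral>\<^sup>+\<omega>. liminf (\<lambda>n. f \<omega> * indicator (A n) \<omega>) \<partial>M)"
  proof (intro nn_integral_mono)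
    fix \<omega>
    show "f \<omega> * indicator H \<omega> \<le> liminf (\<lambda>n. f \<omega> * indicator (A n) \<omega>)"
    proof (cases "\<omega> \<in> H")
      case True
      have "\<forall>\<^sub>F n in sequentially. f \<omega> \<le> f \<omega> * indicator (A n) \<omega>"
        using ev[OF True] by eventually_elim simp
      then show ?thesis using True by (simp add: Liminf_bounded)
    qed simp
  qed
  also have "\<dots> \<le> liminf (\<lambda>n. \<integral>\<^sup>+\<omega>\<in>A n. f \<omega> \<partial>M)"
    by (rule nn_integral_liminf) measurable
  also have "\<dots> \<le> K"
    using Liminf_mono[OF always_eventually, of "\<lambda>n. \<integral>\<^sup>+\<omega>\<in>A n. f \<omega> \<partial>M" "\<lambda>_. K" sequentially] K
    by (simp add: Liminf_const)
  finally show ?thesis .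
qed

text \<open>A continuous path attains its maximum on \<open>[0, T]\<close>. The maximum is at least
  \<open>b\<close> exactly when grid values exceed every \<open>b - 1 / (m + 1)\<close>, a countable
  condition.\<close>

lemma level_set_events:
  fixes X :: "real \<Rightarrow> 'a \<Rightarrow> real"
  assumes T: "0 < T" and X: "\<And>t. 0 \<le> t \<Longrightarrow> X t \<in> borel_measurable M"
    and cont: "\<And>\<omega>. \<omega> \<in> space M \<Longrightarrow> continuous_on {0..T} (\<lambda>t. X t \<omega>)"
  shows "{\<omega> \<in> space M. \<exists>t\<in>{0..T}. b \<le> X t \<omega>} \<in> events"
proof -
  have [measurable]: "X (grid T n j) \<in> borel_measurable M" for n j
    by (rule X) (use T in \<open>simp add: grid_nonneg\<close>)
  have "{\<omega> \<in> space M. \<exists>t\<in>{0..T}. b \<le> X t \<omega>}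
      = {\<omega> \<in> space M. \<forall>m. \<exists>n. \<exists>j\<in>{..Suc n}. b - 1 / real (Suc m) < X (grid T n j) \<omega>}"
  proof (intro Collect_cong conj_cong refl iffI allI)
    fix \<omega> m assume \<omega>: "\<omega> \<in> space M" and "\<exists>t\<in>{0..T}. b \<le> X t \<omega>"
    then obtain t where t: "t \<in> {0..T}" and "b \<le> X t \<omega>" by blast
    moreover have "b - 1 / real (Suc m) < b" by simp
    ultimately have less: "b - 1 / real (Suc m) < X t \<omega>" by linarith
    have "\<exists>n. \<exists>j\<le>Suc n. b - 1 / real (Suc m) < X (grid T n j) \<omega>"
      by (rule eventually_happens'[OF sequentially_bot eventually_grid_cross[OF cont[OF \<omega>] T t less]])
    then show "\<exists>n. \<exists>j\<in>{..Suc n}. b - 1 / real (Suc m) < X (grid T n j) \<omega>" by auto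
  next
    fix \<omega> assume \<omega>: "\<omega> \<in> space M"
      and approx: "\<forall>m. \<exists>n. \<exists>j\<in>{..Suc n}. b - 1 / real (Suc m) < X (grid T n j) \<omega>"
    obtain s where s: "s \<in> {0..T}" "\<And>t. t \<in> {0..T} \<Longrightarrow> X t \<omega> \<le> X s \<omega>"
      using continuous_attains_sup[OF compact_Icc _ cont[OF \<omega>]] T by auto
    have "b - 1 / real (Suc m) < X s \<omega>" for m
    proof -
      obtain n j where j: "j \<le> Suc n" "b - 1 / real (Suc m) < X (grid T n j) \<omega>"
        using approx[rule_format, of m] by auto
      have "grid T n j \<in> {0..T}" using T j(1) by (simp add: grid_nonneg grid_le)
      from s(2)[OF this] show ?thesis using j(2) by simp
    qed
    then have "\<forall>\<^sub>F m in sequentially. b - 1 / real (Suc m) \<le> X s \<omega>"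
      by (intro always_eventually allI less_imp_le)
    moreover have "(\<lambda>m. b - 1 / real (Suc m)) \<longlonglongrightarrow> b - 0"
      by (intro tendsto_diff tendsto_const LIMSEQ_Suc[OF lim_const_over_n])
    ultimately have "b - 0 \<le> X s \<omega>" by (intro tendsto_upperbound[OF _ _ sequentially_bot])
    then have "b \<le> X s \<omega>" by simp
    then show "\<exists>t\<in>{0..T}. b \<le> X t \<omega>" using s(1) by blast
  qed
  also have "\<dots> \<in> events" by measurable
  finally show ?thesis .
qed

end

section \<open>Passage probabilities and the expectation on the hitting event\<close>

context ito_exponential
begin

lemma E_cont: "\<omega> \<in> space M \<Longrightarrow> continuous_on {0..T} (\<lambda>t. E c t \<omega>)"
  unfolding E_def
  by (intro continuous_on_exp continuous_on_diff continuous_on_mult continuous_on_divide continuous_on_const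
      Q_cont continuous_on_subset[OF I_cont]) auto

text \<open>When the final quadratic variation is at most \<open>d\<close>, so is every earlier one,
  and \<open>I\<close> above \<open>y'\<close> forces \<open>E c\<close> above a fixed constant. The
  maximal inequality on the grid bounds the probability of that by the reciprocal constant.\<close>

lemma sup_I_tail:
  assumes T: "0 < T" and d: "0 < d" and y: "0 < y'" "y' < y"
  shows "prob {\<omega> \<in> space M. (\<exists>t\<in>{0..T}. y \<le> I t \<omega>) \<and> Q T \<omega> \<le> d} \<le> exp (- y'\<^sup>2 / (2 * d))"
proof -
  have T0: "0 \<le> T" using T by simp
  \<comment> \<open>The maximiser of \<open>c * y' - c\<^sup>2 * d / 2\<close>, with maximum
    \<open>y'\<^sup>2 / (2 * d)\<close>.\<close>
  define c where "c = y' / d"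
  have c: "0 < c" using d y by (simp add: c_def)
  define a where "a = exp (c * y' - c\<^sup>2 * d / 2)"
  have "c * y' - c\<^sup>2 * d / 2 = y'\<^sup>2 / (2 * d)"
    using d by (simp add: c_def power2_eq_square field_simps)
  then have a: "0 < a" "inverse a = exp (- y'\<^sup>2 / (2 * d))"
    by (simp_all add: a_def exp_minus)
  define H where "H = {\<omega> \<in> space M. (\<exists>t\<in>{0..T}. y \<le> I t \<omega>) \<and> Q T \<omega> \<le> d}"
  \<comment> \<open>The indices run up to \<open>Suc n\<close>, the last of which is the time
    \<open>T\<close>.\<close>
  define A where "A n = {\<omega> \<in> space M. \<exists>i<Suc (Suc n). a \<le> E c (grid T n i) \<omega>}" for n
  have cont: "continuous_on {0..T} (\<lambda>t. I t \<omega>)" if "\<omega> \<in> space M" for \<omega>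
    by (rule continuous_on_subset[OF I_cont[OF that]]) auto
  have [measurable]: "E c (grid T n i) \<in> borel_measurable M" for n i
    by (rule E_measurable[OF grid_nonneg[OF T0]])
  have A [measurable]: "A n \<in> events" for n
    unfolding A_def by measurable
  have "{\<omega> \<in> space M. \<exists>t\<in>{0..T}. y \<le> I t \<omega>} \<in> events"
    by (rule level_set_events[OF T I_measurable cont])
  moreover have "{\<omega> \<in> space M. Q T \<omega> \<le> d} \<in> events"
    using Q_measurable[OF T0] by measurable
  moreover have "H = {\<omega> \<in> space M. \<exists>t\<in>{0..T}. y \<le> I t \<omega>} \<inter> {\<omega> \<in> space M. Q T \<omega> \<le> d}"
    by (auto simp: H_def)
  ultimately have H: "H \<in> events" by auto
  have bound: "emeasure M (A n) \<le> ennreal (inverse a)" for n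
  proof -
    \<comment> \<open>The added term, the expectation over the paths not stopped, is nonnegative.
      Its grid time lies beyond \<open>T\<close>, which is harmless because the supermartingale runs
      on.\<close>
    have "ennreal a * emeasure M (A n) \<le> ennreal a * emeasure M (A n)
        + (\<integral>\<^sup>+\<omega>\<in>{\<omega> \<in> space M. \<forall>i<Suc (Suc n). E c (grid T n i) \<omega> < a}. ennreal (E c (grid T n (Suc (Suc n))) \<omega>) \<partial>M)"
      by simp
    also have "\<dots> \<le> (\<integral>\<^sup>+\<omega>. ennreal (E c (grid T n 0) \<omega>) \<partial>M)"
      unfolding A_def by (rule E_maximal_grid) (simp_all add: grid_mono[OF T0])
    also have "\<dots> = 1"
      by (simp add: nn_integral_E_0)
    finally have "ennreal a * emeasure M (A n) \<le> 1" .
    then have "ennreal (a * prob (A n)) \<le> ennreal 1"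
      using a(1) by (simp add: emeasure_eq_measure ennreal_mult)
    then have "a * prob (A n) \<le> 1" by (subst (asm) ennreal_le_iff) simp_all
    then show ?thesis
      unfolding emeasure_eq_measure using a(1) by (intro ennreal_leI) (simp add: field_simps)
  qed
  have "(\<integral>\<^sup>+\<omega>\<in>H. 1 \<partial>M) \<le> ennreal (inverse a)"
  proof (rule nn_integral_le_of_eventually_mem[OF A])
    fix \<omega> assume "\<omega> \<in> H"
    then obtain t where \<omega>: "\<omega> \<in> space M" "Q T \<omega> \<le> d" and t: "t \<in> {0..T}" "y' < I t \<omega>"
      using y(2) by (auto simp: H_def)
    show "\<forall>\<^sub>F n in sequentially. \<omega> \<in> A n"
      using eventually_grid_cross[OF cont[OF \<omega>(1)] T t]
    proof eventually_elim
      case (elim n)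
      then obtain j where j: "j \<le> Suc n" "y' < I (grid T n j) \<omega>" by blast
      have "Q (grid T n j) \<omega> \<le> d"
        using Q_mono[OF \<omega>(1) grid_nonneg[OF T0] grid_le[OF T0 j(1)]] \<omega>(2) by (rule order_trans)
      then have "c\<^sup>2 * Q (grid T n j) \<omega> \<le> c\<^sup>2 * d" by (rule mult_left_mono) simp
      moreover have "c * y' \<le> c * I (grid T n j) \<omega>" using c j(2) by simp
      ultimately have "a \<le> E c (grid T n j) \<omega>" unfolding a_def E_def by simp
      then show ?case using \<omega>(1) j(1) by (auto simp: A_def less_Suc_eq_le)
    qed
  qed (use bound in simp_all)
  then have "prob H \<le> inverse a"
    using H a(1) by (simp add: emeasure_eq_measure)
  then show ?thesis by (simp add: H_def a(2))
qed

text \<open>The supermartingale is stopped at the first grid time above \<open>b'\<close>, where it exceeds \<open>b\<close> by at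
  most 1 once the grid is fine; no moments beyond the first are needed.\<close>

lemma E_hit_le:
  assumes T: "0 < T" and b: "0 < b'" "b' < b"
  shows "(\<integral>\<^sup>+\<omega>\<in>{\<omega> \<in> space M. \<exists>t\<in>{0..T}. b \<le> E 1 t \<omega>}. ennreal (E 1 T \<omega>) \<partial>M)
    \<le> ennreal (b + 1) * emeasure M {\<omega> \<in> space M. \<exists>t\<in>{0..T}. b' \<le> E 1 t \<omega>}"
proof -
  have T0: "0 \<le> T" using T by simp
  define G where "G = {\<omega> \<in> space M. \<exists>t\<in>{0..T}. b \<le> E 1 t \<omega>}"
  define G' where "G' = {\<omega> \<in> space M. \<exists>t\<in>{0..T}. b' \<le> E 1 t \<omega>}"
  have G': "G' \<in> events"
    unfolding G'_def by (rule level_set_events[OF T E_measurable E_cont])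
  \<comment> \<open>First passage above \<open>b'\<close> at grid index \<open>j\<close>, with a
    bounded overshoot. The overshoot condition concerns only the value at index \<open>j\<close>, so
    the event is known at that time.\<close>
  define A where "A n j = {\<omega> \<in> space M. (\<forall>i\<in>{..<j}. E 1 (grid T n i) \<omega> < b') \<and>
    b' \<le> E 1 (grid T n j) \<omega> \<and> E 1 (grid T n j) \<omega> \<le> b + 1}" for n j
  have AF: "A n j \<in> sets (F (grid T n j))" for n j
  proof -
    let ?F = "F (grid T n j)"
    have EF: "E 1 (grid T n i) \<in> borel_measurable (?F)" if "i \<le> j" for i
      by (rule measurable_F_mono[OF grid_nonneg[OF T0] grid_mono[OF T0 that] E_measurable_F[OF grid_nonneg[OF T0]]])
    have "{\<omega> \<in> space (?F). E 1 (grid T n i) \<omega> < b'} \<in> sets (?F)" if "i \<in> {..<j}" for i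
      using that by (intro borel_measurable_less EF borel_measurable_const) simp
    then have "{\<omega> \<in> space (?F). \<forall>i\<in>{..<j}. E 1 (grid T n i) \<omega> < b'} \<in> sets (?F)"
      by (rule sets.sets_Collect_finite_All[OF _ finite_lessThan])
    moreover note [measurable] = EF[OF order_refl]
    have "{\<omega> \<in> space (?F). b' \<le> E 1 (grid T n j) \<omega> \<and> E 1 (grid T n j) \<omega> \<le> b + 1} \<in> sets (?F)"
      by measurable
    ultimately have "{\<omega> \<in> space (?F). \<forall>i\<in>{..<j}. E 1 (grid T n i) \<omega> < b'} \<inter>
      {\<omega> \<in> space (?F). b' \<le> E 1 (grid T n j) \<omega> \<and> E 1 (grid T n j) \<omega> \<le> b + 1} \<in> sets (?F)"
      by (rule sets.Int)
    also have "{\<omega> \<in> space (?F). \<forall>i\<in>{..<j}. E 1 (grid T n i) \<omega> < b'} \<inter>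
      {\<omega> \<in> space (?F). b' \<le> E 1 (grid T n j) \<omega> \<and> E 1 (grid T n j) \<omega> \<le> b + 1} = A n j"
      unfolding A_def space_F[OF grid_nonneg[OF T0]] by blast
    finally show ?thesis .
  qed
  then have A [measurable]: "A n j \<in> events" for n j
    using F_events[OF grid_nonneg[OF T0]] by blast
  note [measurable] = E_measurable[OF T0]
  have disj: "disjoint_family_on (A n) {..Suc n}" for n
  proof -
    have "A n i \<inter> A n j = {}" if "i < j" for i j
    proof (rule equals0I)
      fix \<omega> assume "\<omega> \<in> A n i \<inter> A n j"
      then have "b' \<le> E 1 (grid T n i) \<omega>" "\<forall>k\<in>{..<j}. E 1 (grid T n k) \<omega> < b'"
        by (simp_all add: A_def)
      then show False using that by (simp add: not_less[symmetric])
    qed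
    then show ?thesis
      unfolding disjoint_family_on_def by (metis Int_commute linorder_neqE_nat)
  qed
  have bound: "(\<integral>\<^sup>+\<omega>\<in>(\<Union>j\<in>{..Suc n}. A n j). ennreal (E 1 T \<omega>) \<partial>M) \<le> ennreal (b + 1) * emeasure M G'" for n
  proof -
    have "(\<integral>\<^sup>+\<omega>\<in>(\<Union>j\<in>{..Suc n}. A n j). ennreal (E 1 T \<omega>) \<partial>M)
      \<le> (\<integral>\<^sup>+\<omega>. (\<Sum>j\<in>{..Suc n}. ennreal (E 1 T \<omega>) * indicator (A n j) \<omega>) \<partial>M)"
    proof (intro nn_integral_mono)
      fix \<omega>
      show "ennreal (E 1 T \<omega>) * indicator (\<Union>j\<in>{..Suc n}. A n j) \<omega> \<le> (\<Sum>j\<in>{..Suc n}. ennreal (E 1 T \<omega>) * indicator (A n j) \<omega>)"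
      proof (cases "\<omega> \<in> (\<Union>j\<in>{..Suc n}. A n j)")
        case True
        then obtain j where j: "j \<in> {..Suc n}" "\<omega> \<in> A n j" by blast
        have "ennreal (E 1 T \<omega>) * indicator (A n j) \<omega> \<le> (\<Sum>j\<in>{..Suc n}. ennreal (E 1 T \<omega>) * indicator (A n j) \<omega>)"
          by (rule member_le_sum[OF j(1)]) simp_all
        then show ?thesis using True j by simp
      qed simp
    qed
    also have "\<dots> = (\<Sum>j\<in>{..Suc n}. \<integral>\<^sup>+\<omega>\<in>A n j. ennreal (E 1 T \<omega>) \<partial>M)"
      by (rule nn_integral_sum) measurable
    also have "\<dots> \<le> (\<Sum>j\<in>{..Suc n}. ennreal (b + 1) * emeasure M (A n j))"
    proof (rule sum_mono)
      fix j assume j: "j \<in> {..Suc n}"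
      have "(\<integral>\<^sup>+\<omega>\<in>A n j. ennreal (E 1 T \<omega>) \<partial>M) \<le> (\<integral>\<^sup>+\<omega>\<in>A n j. ennreal (E 1 (grid T n j) \<omega>) \<partial>M)"
        by (rule E_supermartingale[OF grid_nonneg[OF T0] grid_le[OF T0] AF]) (use j in simp)
      also have "\<dots> \<le> (\<integral>\<^sup>+\<omega>\<in>A n j. ennreal (b + 1) \<partial>M)"
        by (intro nn_integral_mono) (auto simp: A_def indicator_def intro: ennreal_leI)
      also have "\<dots> = ennreal (b + 1) * emeasure M (A n j)"
        by (rule nn_integral_cmult_indicator) simp
      finally show "(\<integral>\<^sup>+\<omega>\<in>A n j. ennreal (E 1 T \<omega>) \<partial>M) \<le> ennreal (b + 1) * emeasure M (A n j)" .
    qed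
    also have "\<dots> = ennreal (b + 1) * emeasure M (\<Union>j\<in>{..Suc n}. A n j)"
      unfolding sum_distrib_left[symmetric] by (subst sum_emeasure) (use disj in auto)
    also have "\<dots> \<le> ennreal (b + 1) * emeasure M G'"
    proof (intro mult_left_mono emeasure_mono G')
      show "(\<Union>j\<in>{..Suc n}. A n j) \<subseteq> G'"
      proof
        fix \<omega> assume "\<omega> \<in> (\<Union>j\<in>{..Suc n}. A n j)"
        then obtain j where "j \<le> Suc n" "\<omega> \<in> space M" "b' \<le> E 1 (grid T n j) \<omega>" by (auto simp: A_def)
        then show "\<omega> \<in> G'" using grid_nonneg[OF T0] grid_le[OF T0] by (auto simp: G'_def)
      qed
    qed simp
    finally show ?thesis .
  qed
  \<comment> \<open>Passage at index 0 has no preceding grid value to control the overshoot. The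
    initial value 1, which holds almost surely, lies below \<open>b + 1\<close>.\<close>
  have "(\<integral>\<^sup>+\<omega>\<in>G. ennreal (E 1 T \<omega>) \<partial>M) = (\<integral>\<^sup>+\<omega>\<in>(G \<inter> {\<omega>. E 1 0 \<omega> = 1}). ennreal (E 1 T \<omega>) \<partial>M)"
    by (rule nn_integral_cong_AE) (use E_0[of 1] in eventually_elim, simp add: indicator_def)
  also have "\<dots> \<le> ennreal (b + 1) * emeasure M G'"
  proof (rule nn_integral_le_of_eventually_mem[OF _ _ _ bound])
    fix \<omega> assume "\<omega> \<in> G \<inter> {\<omega>. E 1 0 \<omega> = 1}"
    then obtain t where \<omega>: "\<omega> \<in> space M" "E 1 0 \<omega> = 1" and t: "t \<in> {0..T}" "b' < E 1 t \<omega>"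
      using b by (auto simp: G_def)
    \<comment> \<open>Once the mesh is finer than the modulus of continuity for 1, neighbouring grid
      values differ by less than 1; the value before the passage is below \<open>b'\<close>, so the
      value at the passage is below \<open>b + 1\<close>.\<close>
    have "uniformly_continuous_on {0..T} (\<lambda>t. E 1 t \<omega>)"
      by (rule compact_uniformly_continuous[OF E_cont[OF \<omega>(1)] compact_Icc])
    then obtain \<delta> where \<delta>: "0 < \<delta>" "\<And>u v. u \<in> {0..T} \<Longrightarrow> v \<in> {0..T} \<Longrightarrow> dist v u < \<delta> \<Longrightarrow> dist (E 1 v \<omega>) (E 1 u \<omega>) < 1"
      unfolding uniformly_continuous_on_def by (metis zero_less_one)
    show "\<forall>\<^sub>F n in sequentially. \<omega> \<in> (\<Union>j\<in>{..Suc n}. A n j)"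
      using eventually_grid_cross[OF E_cont[OF \<omega>(1)] T t] eventually_grid_mesh[OF \<delta>(1), of T]
    proof eventually_elim
      case (elim n)
      define j where "j = (LEAST j. b' \<le> E 1 (grid T n j) \<omega>)"
      obtain k where k: "k \<le> Suc n" "b' \<le> E 1 (grid T n k) \<omega>"
        using elim(1) less_imp_le by blast
      have j: "b' \<le> E 1 (grid T n j) \<omega>" unfolding j_def by (rule LeastI[of _ k]) (rule k(2))
      have "j \<le> k" unfolding j_def by (rule Least_le) (rule k(2))
      then have jn: "j \<le> Suc n" using k(1) by simp
      have less: "E 1 (grid T n i) \<omega> < b'" if "i < j" for i
        using not_less_Least[of i "\<lambda>j. b' \<le> E 1 (grid T n j) \<omega>"] that by (simp add: j_def not_le)
      have "E 1 (grid T n j) \<omega> \<le> b + 1"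
      proof (cases j)
        case 0
        then show ?thesis using \<omega>(2) b by simp
      next
        case (Suc i)
        have "grid T n i \<in> {0..T}" "grid T n j \<in> {0..T}"
          using jn Suc grid_nonneg[OF T0] grid_le[OF T0] by simp_all
        moreover have "dist (grid T n j) (grid T n i) < \<delta>"
          using grid_Suc[of T n i] elim(2) T by (simp add: dist_real_def Suc)
        ultimately have "dist (E 1 (grid T n j) \<omega>) (E 1 (grid T n i) \<omega>) < 1" by (rule \<delta>(2))
        then show ?thesis using less[of i] Suc b by (simp add: dist_real_def)
      qed
      then have "\<omega> \<in> A n j" using \<omega>(1) j less by (simp add: A_def)
      then show ?case using jn by blast
    qed
  qed measurable
  finally show ?thesis by (simp only: G_def G'_def)
qed

end

section \<open>Tails of the quadratic variation\<close>

text \<open>Above the threshold the ratio of \<open>y\<close> to \<open>b\<close> is at least 1, so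
  multiplying \<open>y\<close> by its \<open>n\<close>-th power only enlarges it.\<close>

lemma le_threshold_add_power:
  fixes y b :: real
  assumes "0 \<le> y" "0 < b"
  shows "y \<le> b + y ^ Suc n * (1 / b) ^ n"
proof (cases "y \<le> b")
  case True
  have "0 \<le> y ^ Suc n * (1 / b) ^ n" using assms by simp
  then show ?thesis using True by linarith
next
  case False
  then have "1 \<le> (y * (1 / b)) ^ n" using assms by (intro one_le_power) simp
  then have "y * 1 \<le> y * (y * (1 / b)) ^ n" using assms by (intro mult_left_mono)
  also have "\<dots> = y ^ Suc n * (1 / b) ^ n" by (simp add: power_divide)
  finally show ?thesis using assms by simp
qed

context ito_exponential
begin

text \<open>Values of the squared integrand below \<open>1 / (2 * sqrt T)\<close> contribute at most
  \<open>sqrt T / 2\<close> to \<open>Q T\<close>. Half of the excess over \<open>sqrt T\<close>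
  must come from the larger values, which are controlled by the power \<open>Suc n\<close>; its time
  integral is estimated by Tonelli's theorem and Markov's inequality.\<close>

lemma Q_tail:
  assumes T: "0 < T" and C: "0 \<le> C"
    and moment: "\<And>r. r \<in> {0<..T} \<Longrightarrow> (\<integral>\<^sup>+\<omega>. ennreal (((h r \<omega>)\<^sup>2) ^ Suc n) \<partial>M) \<le> ennreal C"
  shows "prob {\<omega> \<in> space M. sqrt T < Q T \<omega>} \<le> 2 * (2 * sqrt T) ^ n * C * sqrt T"
proof -
  have T0: "0 \<le> T" using T by simp
  \<comment> \<open>The inner indicator gives joint measurability from the progressive version of
    \<open>h\<close>; the outer one removes time 0, where no moment bound is assumed.\<close>
  define G where "G = (\<lambda>(\<omega>, r). indicator {0<..T} r * (indicator {0..T} r * h r \<omega>))"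
  have G_eq: "G (\<omega>, r) = indicator {0<..T} r * h r \<omega>" for \<omega> r
    by (simp add: G_def indicator_def)
  note [measurable] = measurable_F_pair[OF T0 progressive_measurable[OF prog_h[OF T0] T0 order_refl]]
  have G [measurable]: "G \<in> borel_measurable (M \<Otimes>\<^sub>M lborel)"
    unfolding G_def by measurable
  define J where "J \<omega> = (\<integral>\<^sup>+r. ennreal (((G (\<omega>, r))\<^sup>2) ^ Suc n) \<partial>lborel)" for \<omega>
  have [measurable]: "J \<in> borel_measurable M"
    unfolding J_def[abs_def] by measurable
  define \<kappa> where "\<kappa> = (2 * sqrt T) ^ n"
  have \<kappa>: "0 < \<kappa>" using T by (simp add: \<kappa>_def)
  have Q_le: "ennreal (Q T \<omega>) \<le> ennreal (sqrt T / 2) + ennreal \<kappa> * J \<omega>" if \<omega>: "\<omega> \<in> space M" for \<omega>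
  proof -
    have [measurable]: "(\<lambda>r. G (\<omega>, r)) \<in> borel_measurable lborel"
      by (rule measurable_compose[OF measurable_Pair1'[OF \<omega>] G])
    have "set_integrable lborel {0<..T} (\<lambda>r. (h r \<omega>)\<^sup>2)"
      by (rule set_integrable_subset[OF h_square_integrable[OF \<omega> order_refl, of T]]) auto
    moreover have "indicator {0<..T} r *\<^sub>R (h r \<omega>)\<^sup>2 = (G (\<omega>, r))\<^sup>2" for r
      by (simp add: G_eq indicator_def)
    ultimately have int: "integrable lborel (\<lambda>r. (G (\<omega>, r))\<^sup>2)" and "Q T \<omega> = (LINT r|lborel. (G (\<omega>, r))\<^sup>2)"
      unfolding Q_Ioc set_integrable_def set_lebesgue_integral_def by simp_all
    then have "ennreal (Q T \<omega>) = (\<integral>\<^sup>+r. ennreal ((G (\<omega>, r))\<^sup>2) \<partial>lborel)"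
      using nn_integral_eq_integral[OF int] by simp
    also have "\<dots> \<le> (\<integral>\<^sup>+r. ennreal (1 / (2 * sqrt T)) * indicator {0<..T} r + ennreal \<kappa> * ennreal (((G (\<omega>, r))\<^sup>2) ^ Suc n) \<partial>lborel)"
    proof (intro nn_integral_mono)
      fix r
      show "ennreal ((G (\<omega>, r))\<^sup>2) \<le> ennreal (1 / (2 * sqrt T)) * indicator {0<..T} r + ennreal \<kappa> * ennreal (((G (\<omega>, r))\<^sup>2) ^ Suc n)"
      proof (cases "r \<in> {0<..T}")
        case True
        have "(G (\<omega>, r))\<^sup>2 \<le> 1 / (2 * sqrt T) + ((G (\<omega>, r))\<^sup>2) ^ Suc n * (1 / (1 / (2 * sqrt T))) ^ n"
          by (rule le_threshold_add_power) (use T in simp_all)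
        then have "ennreal ((G (\<omega>, r))\<^sup>2) \<le> ennreal (1 / (2 * sqrt T) + \<kappa> * ((G (\<omega>, r))\<^sup>2) ^ Suc n)"
          by (intro ennreal_leI) (simp add: \<kappa>_def mult.commute)
        also have "\<dots> = ennreal (1 / (2 * sqrt T)) + ennreal \<kappa> * ennreal (((G (\<omega>, r))\<^sup>2) ^ Suc n)"
          using T \<kappa> by (subst ennreal_plus) (simp_all add: ennreal_mult)
        finally show ?thesis using True by simp
      qed (simp add: G_eq)
    qed
    also have "\<dots> = (\<integral>\<^sup>+r. ennreal (1 / (2 * sqrt T)) * indicator {0<..T} r \<partial>lborel) + ennreal \<kappa> * J \<omega>"
      unfolding J_def by (subst nn_integral_add) (simp_all add: nn_integral_cmult)
    also have "(\<integral>\<^sup>+r. ennreal (1 / (2 * sqrt T)) * indicator {0<..T} r \<partial>lborel) = ennreal (1 / (2 * sqrt T)) * ennreal T"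
      using T by (subst nn_integral_cmult_indicator) simp_all
    also have "\<dots> = ennreal (1 / (2 * sqrt T) * T)"
      using T by (intro ennreal_mult[symmetric]) simp_all
    also have "1 / (2 * sqrt T) * T = sqrt T / 2"
      using real_div_sqrt[OF T0] by simp
    finally show ?thesis .
  qed
  have sub: "{\<omega> \<in> space M. sqrt T < Q T \<omega>} \<subseteq> {\<omega> \<in> space M. 1 \<le> ennreal (2 / sqrt T * \<kappa>) * J \<omega>}"
  proof safe
    fix \<omega> assume \<omega>: "\<omega> \<in> space M" "sqrt T < Q T \<omega>"
    show "1 \<le> ennreal (2 / sqrt T * \<kappa>) * J \<omega>"
    \<comment> \<open>The integral of the power may be infinite in some scenarios; there the
      inequality is trivial since its coefficient is positive.\<close>
    proof (cases "J \<omega>")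
      case (real j)
      have "ennreal (Q T \<omega>) \<le> ennreal (sqrt T / 2 + \<kappa> * j)"
        using Q_le[OF \<omega>(1)] real \<kappa> T by (simp add: ennreal_plus ennreal_mult)
      then have "Q T \<omega> \<le> sqrt T / 2 + \<kappa> * j"
        using real \<kappa> T by (subst (asm) ennreal_le_iff) simp_all
      then have "sqrt T / 2 \<le> \<kappa> * j" using \<omega>(2) by simp
      then have "1 \<le> 2 / sqrt T * \<kappa> * j" using T by (simp add: field_simps)
      then have "ennreal 1 \<le> ennreal (2 / sqrt T * \<kappa> * j)" by (rule ennreal_leI)
      also have "\<dots> = ennreal (2 / sqrt T * \<kappa>) * J \<omega>"
        unfolding real(2) using T \<kappa> real(1) by (intro ennreal_mult) simp_all
      finally show ?thesis by simp
    next
      case top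
      then show ?thesis using T \<kappa> by (simp add: ennreal_mult_top)
    qed
  qed
  interpret MI: pair_sigma_finite M lborel
    by (rule pair_sigma_finite.intro) (rule sigma_finite_measure_axioms lborel.sigma_finite_measure_axioms)+
  have "(\<integral>\<^sup>+\<omega>. J \<omega> \<partial>M) = (\<integral>\<^sup>+r. (\<integral>\<^sup>+\<omega>. ennreal (((G (\<omega>, r))\<^sup>2) ^ Suc n) \<partial>M) \<partial>lborel)"
    unfolding J_def by (rule MI.Fubini[symmetric]) measurable
  also have "\<dots> \<le> (\<integral>\<^sup>+r. ennreal C * indicator {0<..T} r \<partial>lborel)"
  proof (intro nn_integral_mono)
    fix r
    show "(\<integral>\<^sup>+\<omega>. ennreal (((G (\<omega>, r))\<^sup>2) ^ Suc n) \<partial>M) \<le> ennreal C * indicator {0<..T} r"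
      using moment[of r] by (cases "r \<in> {0<..T}") (simp_all add: G_eq)
  qed
  also have "\<dots> = ennreal C * ennreal T"
    using T by (subst nn_integral_cmult_indicator) simp_all
  finally have EJ: "(\<integral>\<^sup>+\<omega>. J \<omega> \<partial>M) \<le> ennreal C * ennreal T" .
  have "emeasure M {\<omega> \<in> space M. sqrt T < Q T \<omega>} \<le> emeasure M {\<omega> \<in> space M. 1 \<le> ennreal (2 / sqrt T * \<kappa>) * J \<omega>}"
    by (rule emeasure_mono[OF sub]) measurable
  also have "\<dots> \<le> ennreal (2 / sqrt T * \<kappa>) * (\<integral>\<^sup>+\<omega>. J \<omega> * indicator (space M) \<omega> \<partial>M)"
    by (rule nn_integral_Markov_inequality) simp_all
  also have "(\<integral>\<^sup>+\<omega>. J \<omega> * indicator (space M) \<omega> \<partial>M) = (\<integral>\<^sup>+\<omega>. J \<omega> \<partial>M)"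
    by (intro nn_integral_cong) simp
  also have "ennreal (2 / sqrt T * \<kappa>) * (\<integral>\<^sup>+\<omega>. J \<omega> \<partial>M) \<le> ennreal (2 / sqrt T * \<kappa>) * (ennreal C * ennreal T)"
    by (rule mult_left_mono[OF EJ]) simp
  also have "\<dots> = ennreal (2 / sqrt T * \<kappa> * (C * T))"
  proof -
    have "ennreal C * ennreal T = ennreal (C * T)"
      by (rule ennreal_mult[symmetric]) (use C T in simp_all)
    moreover have "ennreal (2 / sqrt T * \<kappa>) * ennreal (C * T) = ennreal (2 / sqrt T * \<kappa> * (C * T))"
      by (rule ennreal_mult[symmetric]) (use C T \<kappa> in simp_all)
    ultimately show ?thesis by simp
  qed
  also have "2 / sqrt T * \<kappa> * (C * T) = 2 * \<kappa> * C * (T / sqrt T)"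
    by simp
  also have "T / sqrt T = sqrt T" by (rule real_div_sqrt[OF T0])
  finally have "ennreal (prob {\<omega> \<in> space M. sqrt T < Q T \<omega>}) \<le> ennreal (2 * \<kappa> * C * sqrt T)"
    by (simp only: emeasure_eq_measure)
  then show ?thesis
    unfolding \<kappa>_def using C T by (subst (asm) ennreal_le_iff) simp_all
qed

lemma hit_prob_little_o:
  assumes moments: "\<And>n. \<exists>C\<ge>0. \<forall>r\<in>{0<..1}. (\<integral>\<^sup>+\<omega>. ennreal (((h r \<omega>)\<^sup>2) ^ Suc n) \<partial>M) \<le> ennreal C"
    and b: "1 < b"
  shows "((\<lambda>T. prob {\<omega> \<in> space M. \<exists>t\<in>{0..T}. b \<le> E 1 t \<omega>} / T powr m) \<longlongrightarrow> 0) (at_right 0)"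
proof -
  \<comment> \<open>Then \<open>real n\<close> is at least \<open>2 * m\<close>, and the power
    \<open>n / 2 + 1 / 2\<close> of \<open>T\<close> from \<open>Q_tail\<close> exceeds
    \<open>m\<close> by at least one half.\<close>
  define n where "n = nat \<lceil>2 * m\<rceil>"
  have n: "0 < real n / 2 + 1 / 2 - m" unfolding n_def by linarith
  obtain C where C: "0 \<le> C" "\<And>r. r \<in> {0<..1} \<Longrightarrow> (\<integral>\<^sup>+\<omega>. ennreal (((h r \<omega>)\<^sup>2) ^ Suc n) \<partial>M) \<le> ennreal C"
    using moments[of n] by blast
  define y where "y = ln b"
  have y: "0 < y / 2" "y / 2 < y" using b by (simp_all add: y_def)
  \<comment> \<open>The constant of the Gaussian tail at the level \<open>y / 2\<close>, the lower
    of the two levels in \<open>sup_I_tail\<close>, with variance bound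
    \<open>sqrt T\<close>.\<close>
  define a where "a = (y / 2)\<^sup>2 / 2"
  have a: "0 < a" using y by (simp add: a_def)
  define p where "p = real n / 2 + 1 / 2 - m"
  define K where "K = 2 * 2 ^ n * C"
  let ?H = "\<lambda>T. {\<omega> \<in> space M. \<exists>t\<in>{0..T}. b \<le> E 1 t \<omega>}"
  have le: "prob (?H T) / T powr m \<le> K * T powr p + exp (- a / sqrt T) / T powr m"
    if T: "0 < T" "T < 1" for T
  proof -
    have T0: "0 \<le> T" using T by simp
    have cont: "continuous_on {0..T} (\<lambda>t. I t \<omega>)" if "\<omega> \<in> space M" for \<omega>
      by (rule continuous_on_subset[OF I_cont[OF that]]) auto
    let ?A = "{\<omega> \<in> space M. sqrt T < Q T \<omega>}"
    let ?B = "{\<omega> \<in> space M. (\<exists>t\<in>{0..T}. y \<le> I t \<omega>) \<and> Q T \<omega> \<le> sqrt T}"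
    have A: "?A \<in> events" using Q_measurable[OF T0] by measurable
    have "{\<omega> \<in> space M. \<exists>t\<in>{0..T}. y \<le> I t \<omega>} \<in> events"
      by (rule level_set_events[OF T(1) I_measurable cont])
    then have "{\<omega> \<in> space M. \<exists>t\<in>{0..T}. y \<le> I t \<omega>} - ?A \<in> events" using A by (rule sets.Diff)
    also have "{\<omega> \<in> space M. \<exists>t\<in>{0..T}. y \<le> I t \<omega>} - ?A = ?B" by (auto simp: not_less)
    finally have B: "?B \<in> events" .
    have "?H T \<subseteq> ?A \<union> ?B"
    proof (rule subsetI)
      fix \<omega> assume "\<omega> \<in> ?H T"
      then obtain t where \<omega>: "\<omega> \<in> space M" and t: "t \<in> {0..T}" "b \<le> E 1 t \<omega>" by blast
      have "y \<le> ln (E 1 t \<omega>)" unfolding y_def using b t(2) by simp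
      \<comment> \<open>The correction by half the quadratic variation only lowers the log-price, so
        a large exponential forces a large \<open>I\<close>.\<close>
      also have "\<dots> \<le> I t \<omega>" using Q_nonneg[of t \<omega>] by (simp add: E_def)
      finally have "\<exists>t\<in>{0..T}. y \<le> I t \<omega>" using t(1) by blast
      then show "\<omega> \<in> ?A \<union> ?B" using \<omega> by (cases "sqrt T < Q T \<omega>") (simp_all add: not_less)
    qed
    then have "prob (?H T) \<le> prob (?A \<union> ?B)"
      by (rule finite_measure_mono) (use A B in simp)
    also have "\<dots> \<le> prob ?A + prob ?B" by (rule measure_Un_le[OF A B])
    also have "\<dots> \<le> 2 * (2 * sqrt T) ^ n * C * sqrt T + exp (- (y / 2)\<^sup>2 / (2 * sqrt T))"
    proof (rule add_mono)
      show "prob ?A \<le> 2 * (2 * sqrt T) ^ n * C * sqrt T"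
        by (rule Q_tail[OF T(1) C(1) C(2)]) (use T in simp)
      show "prob ?B \<le> exp (- (y / 2)\<^sup>2 / (2 * sqrt T))"
        by (rule sup_I_tail[OF T(1) _ y]) (use T in simp)
    qed
    also have "2 * (2 * sqrt T) ^ n * C * sqrt T = K * T powr (real n / 2 + 1 / 2)"
    proof -
      have "sqrt T = T powr (1 / 2)" using T by (simp add: powr_half_sqrt)
      then have "(sqrt T) ^ n = T powr (real n / 2)" using T by (simp add: powr_power)
      then show ?thesis
        unfolding K_def powr_add power_mult_distrib using T by (simp add: powr_half_sqrt)
    qed
    also have "- (y / 2)\<^sup>2 / (2 * sqrt T) = - a / sqrt T" by (simp add: a_def)
    finally have "prob (?H T) / T powr m
        \<le> (K * T powr (real n / 2 + 1 / 2) + exp (- a / sqrt T)) / T powr m"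
      by (rule divide_right_mono) simp
    also have "\<dots> = K * T powr p + exp (- a / sqrt T) / T powr m"
      by (simp add: p_def powr_diff add_divide_distrib)
    finally show ?thesis .
  qed
  have "0 < p" using n by (simp add: p_def)
  then have "((\<lambda>T. T powr p) \<longlongrightarrow> 0) (at_right 0)" by real_asymp
  then have "((\<lambda>T. K * T powr p) \<longlongrightarrow> 0) (at_right 0)" by (rule tendsto_mult_right_zero)
  moreover have "((\<lambda>T. exp (- a / sqrt T) / T powr m) \<longlongrightarrow> 0) (at_right 0)"
    using a by real_asymp
  ultimately have lim: "((\<lambda>T. K * T powr p + exp (- a / sqrt T) / T powr m) \<longlongrightarrow> 0) (at_right 0)"
    by (rule tendsto_add_zero)
  have ev: "\<forall>\<^sub>F T in at_right 0. T \<in> {0<..<1::real}"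
    by (rule eventually_at_right_real) simp
  show ?thesis
  proof (rule tendsto_sandwich[OF _ _ tendsto_const lim])
    show "\<forall>\<^sub>F T in at_right 0. 0 \<le> prob (?H T) / T powr m"
      by (intro always_eventually allI) simp
    show "\<forall>\<^sub>F T in at_right 0. prob (?H T) / T powr m
        \<le> K * T powr p + exp (- a / sqrt T) / T powr m"
      using ev by eventually_elim (use le in simp)
  qed
qed

end

section \<open>Moments of the Volterra process and of the variance\<close>

lemma (in filtered_BM) ito_integral_exp_moment:
  assumes ito: "ito_integral M F Z t k Y" and t: "0 \<le> t"
    and v: "\<And>\<omega>. (LINT r:{0<..t}|lborel. (k r \<omega>)\<^sup>2) \<le> v"
  shows "(\<integral>\<^sup>+\<omega>. ennreal (exp (c * Y \<omega>)) \<partial>M) \<le> ennreal (exp (c\<^sup>2 * v / 2))"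
proof -
  let ?L = "\<lambda>\<omega>. LINT r:{0<..t}|lborel. (k r \<omega>)\<^sup>2"
  have prog: "progressive_on F t k" and Y [measurable]: "Y \<in> borel_measurable M"
    using ito by (simp_all add: ito_integral_def)
  note [measurable] = ito_energy_measurable[OF prog order_refl t]
  \<comment> \<open>The exponential inequality from time 0 with weight 1. The deterministic bound
    \<open>v\<close> on the energy then lets the compensator be taken out of the
    expectation.\<close>
  have 1: "(\<integral>\<^sup>+\<omega>. ennreal (exp (c * Y \<omega> - c\<^sup>2 * ?L \<omega> / 2)) \<partial>M) \<le> 1"
    using ito_integral_exp_le[OF ito ito_integral_at_0[OF ito t] order_refl t, of "\<lambda>_. 1" c]
    by (simp add: emeasure_space_1)
  have "(\<integral>\<^sup>+\<omega>. ennreal (exp (c * Y \<omega>)) \<partial>M)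
    \<le> (\<integral>\<^sup>+\<omega>. ennreal (exp (c\<^sup>2 * v / 2)) * ennreal (exp (c * Y \<omega> - c\<^sup>2 * ?L \<omega> / 2)) \<partial>M)"
  proof (intro nn_integral_mono)
    fix \<omega>
    have "c\<^sup>2 * ?L \<omega> \<le> c\<^sup>2 * v" by (rule mult_left_mono[OF v]) simp
    then have "exp (c * Y \<omega>) \<le> exp (c\<^sup>2 * v / 2) * exp (c * Y \<omega> - c\<^sup>2 * ?L \<omega> / 2)"
      unfolding exp_add[symmetric] by simp
    then show "ennreal (exp (c * Y \<omega>)) \<le> ennreal (exp (c\<^sup>2 * v / 2)) * ennreal (exp (c * Y \<omega> - c\<^sup>2 * ?L \<omega> / 2))"
      by (simp add: ennreal_mult[symmetric])
  qed
  also have "\<dots> = ennreal (exp (c\<^sup>2 * v / 2)) * (\<integral>\<^sup>+\<omega>. ennreal (exp (c * Y \<omega> - c\<^sup>2 * ?L \<omega> / 2)) \<partial>M)"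
    by (rule nn_integral_cmult) measurable
  also have "\<dots> \<le> ennreal (exp (c\<^sup>2 * v / 2)) * 1"
    by (rule mult_left_mono[OF 1]) simp
  finally show ?thesis by simp
qed

text \<open>The squared kernel is a power with exponent \<open>2 * H - 1\<close>, which exceeds -1;
  for \<open>H\<close> below one half it is singular at \<open>r = t\<close> but still integrable.
  The reflection of time about \<open>t\<close> moves the singularity to 0.\<close>

lemma volterra_kernel_energy_le:
  fixes H t :: real
  assumes H: "0 < H" and t: "0 < t"
  shows "(LINT r:{0<..t}|lborel. ((t - r) powr (H - 1 / 2))\<^sup>2) \<le> t powr (2 * H) / (2 * H)"
proof -
  let ?v = "t powr (2 * H) / (2 * H)"
  have sq: "((t - r) powr (H - 1 / 2))\<^sup>2 = (t - r) powr (2 * H - 1)" for r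
    unfolding power2_eq_square powr_add[symmetric] by (rule arg_cong2[where f = "(powr)"]) simp_all
  have "((\<lambda>x. x powr (2 * H - 1)) has_integral ?v) {0..t}"
    using has_integral_powr_from_0[of "2 * H - 1" t] H t by simp
  then have "(\<integral>\<^sup>+x. ennreal (x powr (2 * H - 1)) * indicator {0..t} x \<partial>lborel) = ennreal ?v"
    by (rule nn_integral_has_integral_lebesgue'[rotated]) simp
  also have "(\<integral>\<^sup>+x. ennreal (x powr (2 * H - 1)) * indicator {0..t} x \<partial>lborel)
      = (\<integral>\<^sup>+r. ennreal ((t - r) powr (2 * H - 1)) * indicator {0..t} (t - r) \<partial>lborel)"
    by (subst nn_integral_real_affine[where c = "-1" and t = t]) simp_all
  finally have eq: "(\<integral>\<^sup>+r. ennreal ((t - r) powr (2 * H - 1)) * indicator {0..t} (t - r) \<partial>lborel) = ennreal ?v" .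
  have "(LINT r:{0<..t}|lborel. ((t - r) powr (H - 1 / 2))\<^sup>2)
      = enn2real (\<integral>\<^sup>+r. ennreal (indicator {0<..t} r * (t - r) powr (2 * H - 1)) \<partial>lborel)"
    unfolding set_lebesgue_integral_def sq by (subst integral_eq_nn_integral) simp_all
  also have "\<dots> \<le> enn2real (ennreal ?v)"
  proof (rule enn2real_mono)
    show "(\<integral>\<^sup>+r. ennreal (indicator {0<..t} r * (t - r) powr (2 * H - 1)) \<partial>lborel) \<le> ennreal ?v"
      unfolding eq[symmetric] by (intro nn_integral_mono) (auto simp: indicator_def)
  qed simp
  also have "\<dots> = ?v" using H by simp
  finally show ?thesis .
qed

text \<open>The compensating factor of the variance is at most 1 and is dropped. What remains is an
  exponential moment of the Volterra integral, bounded uniformly in \<open>r\<close> because its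
  energy grows with \<open>r\<close> and \<open>r \<le> 1\<close>.\<close>

lemma (in filtered_BM) rough_Bergomi_moments:
  assumes V: "volterra_fBM M F Z H V" and H: "0 < H" and \<nu>: "0 < \<nu>"
    and r: "r \<in> {0<..1}"
  shows "(\<integral>\<^sup>+\<omega>. ennreal ((\<sigma>0\<^sup>2 * exp (\<nu> * V r \<omega> - \<nu>\<^sup>2 * r powr (2 * H) / 2)) ^ q) \<partial>M)
    \<le> ennreal ((\<sigma>0\<^sup>2) ^ q * exp ((real q * \<nu>)\<^sup>2 / 2))"
proof -
  have r0: "0 \<le> r" "0 < r" "r \<le> 1" using r by simp_all
  obtain Y where Y: "ito_integral M F Z r (\<lambda>s \<omega>. (r - s) powr (H - 1 / 2)) Y"
    and VY: "AE \<omega> in M. V r \<omega> = sqrt (2 * H) * Y \<omega>"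
    using V r0(1) unfolding volterra_fBM_def by blast
  have [measurable]: "Y \<in> borel_measurable M" using Y by (simp add: ito_integral_def)
  \<comment> \<open>The factor \<open>sqrt (2 * H)\<close> from the normalisation cancels the
    \<open>1 / (2 * H)\<close> of the kernel energy, so the bound does not depend on
    \<open>H\<close>.\<close>
  let ?c = "real q * \<nu> * sqrt (2 * H)"
  have "r powr (2 * H) \<le> 1" using r0 H by (simp add: powr_le1)
  then have "r powr (2 * H) / (2 * H) \<le> 1 / (2 * H)" using H by (simp add: divide_right_mono)
  with volterra_kernel_energy_le[OF H r0(2)]
  have "(LINT s:{0<..r}|lborel. ((r - s) powr (H - 1 / 2))\<^sup>2) \<le> 1 / (2 * H)" by (rule order_trans)
  from ito_integral_exp_moment[OF Y r0(1) this, of ?c]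
  have EY: "(\<integral>\<^sup>+\<omega>. ennreal (exp (?c * Y \<omega>)) \<partial>M) \<le> ennreal (exp ((real q * \<nu>)\<^sup>2 / 2))"
    using H by (simp add: power_mult_distrib)
  have "(\<integral>\<^sup>+\<omega>. ennreal ((\<sigma>0\<^sup>2 * exp (\<nu> * V r \<omega> - \<nu>\<^sup>2 * r powr (2 * H) / 2)) ^ q) \<partial>M)
    \<le> (\<integral>\<^sup>+\<omega>. ennreal ((\<sigma>0\<^sup>2) ^ q) * ennreal (exp (?c * Y \<omega>)) \<partial>M)"
  proof (rule nn_integral_mono_AE)
    show "AE \<omega> in M. ennreal ((\<sigma>0\<^sup>2 * exp (\<nu> * V r \<omega> - \<nu>\<^sup>2 * r powr (2 * H) / 2)) ^ q)
        \<le> ennreal ((\<sigma>0\<^sup>2) ^ q) * ennreal (exp (?c * Y \<omega>))"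
      using VY
    proof eventually_elim
      case (elim \<omega>)
      have "exp (\<nu> * V r \<omega> - \<nu>\<^sup>2 * r powr (2 * H) / 2) \<le> exp (\<nu> * V r \<omega>)" by simp
      then have "(exp (\<nu> * V r \<omega> - \<nu>\<^sup>2 * r powr (2 * H) / 2)) ^ q \<le> exp (\<nu> * V r \<omega>) ^ q"
        by (rule power_mono) simp
      also have "\<dots> = exp (?c * Y \<omega>)" unfolding elim exp_of_nat_mult[symmetric] by (simp add: ac_simps)
      finally have "(\<sigma>0\<^sup>2 * exp (\<nu> * V r \<omega> - \<nu>\<^sup>2 * r powr (2 * H) / 2)) ^ q \<le> (\<sigma>0\<^sup>2) ^ q * exp (?c * Y \<omega>)"
        unfolding power_mult_distrib by (rule mult_left_mono) simp
      then show ?case by (simp add: ennreal_mult[symmetric])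
    qed
  qed
  also have "\<dots> = ennreal ((\<sigma>0\<^sup>2) ^ q) * (\<integral>\<^sup>+\<omega>. ennreal (exp (?c * Y \<omega>)) \<partial>M)"
    by (rule nn_integral_cmult) measurable
  also have "\<dots> \<le> ennreal ((\<sigma>0\<^sup>2) ^ q) * ennreal (exp ((real q * \<nu>)\<^sup>2 / 2))"
    by (rule mult_left_mono[OF EY]) simp
  also have "\<dots> = ennreal ((\<sigma>0\<^sup>2) ^ q * exp ((real q * \<nu>)\<^sup>2 / 2))"
    by (simp add: ennreal_mult)
  finally show ?thesis .
qed

theorem mainTheorem3:
  fixes M :: "'a measure"
    and W B WH Z \<sigma> I X S :: "real \<Rightarrow> 'a \<Rightarrow> real"
    and x \<rho> \<sigma>0 \<nu> H Bstar K :: real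
    and hit :: "real \<Rightarrow> 'a set"
    and C :: "real \<Rightarrow> real"
  assumes "prob_space M"
    and "standard_BM M W" and "standard_BM M B" and "indep_processes M W B"
    and "-1 < \<rho>" and "\<rho> < 1"
    and "0 < \<sigma>0" and "0 < \<nu>" and "0 < H" and "H < 1/2"
    and "\<And>t \<omega>. Z t \<omega> = \<rho> * W t \<omega> + sqrt (1 - \<rho>\<^sup>2) * B t \<omega>"
    and "volterra_fBM M (BM_filtration M W B) W H WH"
    and "\<And>t \<omega>. \<sigma> t \<omega> = sqrt (\<sigma>0\<^sup>2 * exp (\<nu> * WH t \<omega> - \<nu>\<^sup>2 * t powr (2 * H) / 2))"
    and "ito_integral_process M (BM_filtration M W B) Z \<sigma> I"
    and "\<And>t \<omega>. X t \<omega> = x - 1/2 * (LINT s:{0..t}|lborel. (\<sigma> s \<omega>)\<^sup>2) + I t \<omega>"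
    and "\<And>t \<omega>. S t \<omega> = exp (X t \<omega>)"
    and "exp x < Bstar" and "0 < K"
    and "\<And>T. hit T = {\<omega> \<in> space M. (SUP t\<in>{0..T}. S t \<omega>) \<ge> Bstar}"
    and "\<And>T. C T = (\<integral>\<omega>. max (S T \<omega> - K) 0 * indicator (hit T) \<omega> \<partial>M)"
  shows "(\<forall>m>0. ((\<lambda>T. measure M (hit T) / T powr m) \<longlongrightarrow> 0) (at_right 0)) \<and>
         (\<forall>T>0. integrable M (\<lambda>\<omega>. max (S T \<omega> - K) 0 * indicator (hit T) \<omega>)) \<and>
         (\<forall>m>0. C \<in> o[at_right 0](\<lambda>T. T powr m))"
proof -
  interpret prob_space M by fact
  let ?F = "BM_filtration M W B"
  have "\<rho>\<^sup>2 < 1" using assms(5,6) by (simp add: abs_square_less_1)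
  then have "\<rho>\<^sup>2 + (sqrt (1 - \<rho>\<^sup>2))\<^sup>2 = 1" by simp
  from filtered_BM_combination[OF assms(2-4) this]
  have Z: "filtered_BM M ?F Z" using assms(11) by presburger
  \<comment> \<open>\<open>W\<close> is viewed in the joint filtration because the Volterra integral
    is defined with respect to it.\<close>
  interpret W: filtered_BM M ?F W
    using filtered_BM_combination[OF assms(2-4), of 1 0] by simp
  have \<sigma>2: "(\<sigma> t \<omega>)\<^sup>2 = \<sigma>0\<^sup>2 * exp (\<nu> * WH t \<omega> - \<nu>\<^sup>2 * t powr (2 * H) / 2)" for t \<omega>
    unfolding assms(13) by simp
  have \<sigma>_cont: "continuous_on {0..} (\<lambda>t. \<sigma> t \<omega>)" if "\<omega> \<in> space M" for \<omega>
  proof -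
    have "continuous_on {0..} (\<lambda>t. WH t \<omega>)"
      using assms(12) that by (simp add: volterra_fBM_def continuous_process_def)
    moreover have "continuous_on {0..} (\<lambda>t::real. t powr (2 * H))"
      using assms(9) by (intro continuous_on_powr' continuous_intros) auto
    ultimately show ?thesis
      unfolding assms(13)
      by (intro continuous_on_real_sqrt continuous_on_mult continuous_on_exp continuous_on_diff
          continuous_on_divide continuous_on_const) simp_all
  qed
  interpret X: ito_exponential M ?F Z \<sigma> I
    using Z assms(14) \<sigma>_cont by (intro ito_exponential.intro ito_exponential_axioms.intro)
  have S: "S t \<omega> = exp x * X.E 1 t \<omega>" for t \<omega>
    unfolding assms(16) assms(15) X.E_def X.Q_def exp_add[symmetric] by simp
  define b where "b = Bstar / exp x"
  \<comment> \<open>The midpoint between the normalised starting value 1 and the normalised barrier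
    \<open>b\<close>. Being above 1, it still has a hitting probability that vanishes faster than
    any power.\<close>
  define b' where "b' = (1 + b) / 2"
  have b: "1 < b" using assms(17) by (simp add: b_def)
  then have b': "1 < b'" "0 < b'" "b' < b" by (simp_all add: b'_def)
  define G where "G b T = {\<omega> \<in> space M. \<exists>t\<in>{0..T}. b \<le> X.E 1 t \<omega>}" for b T
  have G: "G b T \<in> events" if "0 < T" for b T
    unfolding G_def by (rule level_set_events[OF that X.E_measurable X.E_cont])
  \<comment> \<open>By continuity the supremum is attained and the set of values is bounded, so
    \<open>SUP\<close> is the true maximum and reaching the barrier means that some time attains
    it.\<close>
  have hit: "hit T = G b T" if T: "0 < T" for T
    unfolding assms(19) G_def
  proof (intro Collect_cong conj_cong refl iffI)
    fix \<omega> assume \<omega>: "\<omega> \<in> space M"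
    have cont: "continuous_on {0..T} (\<lambda>t. S t \<omega>)"
      unfolding S by (intro continuous_on_mult continuous_on_const X.E_cont \<omega>)
    obtain s where s: "s \<in> {0..T}" "\<And>t. t \<in> {0..T} \<Longrightarrow> S t \<omega> \<le> S s \<omega>"
      using continuous_attains_sup[OF compact_Icc _ cont] T by auto
    have iff: "Bstar \<le> S t \<omega> \<longleftrightarrow> b \<le> X.E 1 t \<omega>" for t
      unfolding S b_def by (simp add: field_simps)
    {
      assume "Bstar \<le> (SUP t\<in>{0..T}. S t \<omega>)"
      also have "\<dots> \<le> S s \<omega>" by (rule cSUP_least) (use s in auto)
      finally show "\<exists>t\<in>{0..T}. b \<le> X.E 1 t \<omega>" using s(1) iff by blast
    next
      assume "\<exists>t\<in>{0..T}. b \<le> X.E 1 t \<omega>"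
      then obtain t where t: "t \<in> {0..T}" "Bstar \<le> S t \<omega>" using iff by blast
      have "bdd_above ((\<lambda>t. S t \<omega>) ` {0..T})" using s(2) by (rule bdd_aboveI2)
      with t show "Bstar \<le> (SUP t\<in>{0..T}. S t \<omega>)" by (meson cSUP_upper order_trans)
    }
  qed
  have moments: "\<exists>c\<ge>0. \<forall>r\<in>{0<..1}. (\<integral>\<^sup>+\<omega>. ennreal (((\<sigma> r \<omega>)\<^sup>2) ^ Suc n) \<partial>M) \<le> ennreal c" for n
    unfolding \<sigma>2 using W.rough_Bergomi_moments[OF assms(12,9,8), of _ \<sigma>0 "Suc n"]
    by (intro exI[of _ "(\<sigma>0\<^sup>2) ^ Suc n * exp ((real (Suc n) * \<nu>)\<^sup>2 / 2)"] conjI ballI) simp_all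
  have little: "((\<lambda>T. prob (G c T) / T powr m) \<longlongrightarrow> 0) (at_right 0)" if "1 < c" for c m
    unfolding G_def by (rule X.hit_prob_little_o[OF moments that])
  have pos: "\<forall>\<^sub>F T in at_right 0. (0::real) < T"
    by (rule eventually_at_right_less)
  have "((\<lambda>T. prob (hit T) / T powr m) \<longlongrightarrow> 0) (at_right 0)" for m
  proof (rule Lim_transform_eventually[OF little[OF b]])
    show "\<forall>\<^sub>F T in at_right 0. prob (G b T) / T powr m = prob (hit T) / T powr m"
      using pos by eventually_elim (simp add: hit)
  qed
  moreover
  have payoff: "integrable M (\<lambda>\<omega>. max (S T \<omega> - K) 0 * indicator (hit T) \<omega>) \<and>
      C T \<le> exp x * (b + 1) * prob (G b' T)" if T: "0 < T" for T
  proof -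
    have T0: "0 \<le> T" using T by simp
    note [measurable] = X.E_measurable[OF T0, of 1] G[OF T]
    let ?f = "\<lambda>\<omega>. max (S T \<omega> - K) 0 * indicator (hit T) \<omega>"
    have f [measurable]: "?f \<in> borel_measurable M"
      unfolding S hit[OF T] by measurable
    have "(\<integral>\<^sup>+\<omega>. ennreal (?f \<omega>) \<partial>M) \<le> (\<integral>\<^sup>+\<omega>. ennreal (exp x) * (ennreal (X.E 1 T \<omega>) * indicator (G b T) \<omega>) \<partial>M)"
    proof (intro nn_integral_mono)
      fix \<omega>
      \<comment> \<open>As \<open>K\<close> is positive, the call payoff lies below the price
        itself, whose expectation on the hitting event is controlled by
        \<open>E_hit_le\<close>.\<close>
      have "0 < X.E 1 T \<omega>" by (simp add: X.E_def)
      then have "max (S T \<omega> - K) 0 \<le> exp x * X.E 1 T \<omega>"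
        unfolding S using assms(18) by simp
      then show "ennreal (?f \<omega>) \<le> ennreal (exp x) * (ennreal (X.E 1 T \<omega>) * indicator (G b T) \<omega>)"
        unfolding hit[OF T] by (cases "\<omega> \<in> G b T") (simp_all add: ennreal_mult'[symmetric])
    qed
    also have "\<dots> = ennreal (exp x) * (\<integral>\<^sup>+\<omega>\<in>G b T. ennreal (X.E 1 T \<omega>) \<partial>M)"
      by (rule nn_integral_cmult) measurable
    also have "\<dots> \<le> ennreal (exp x) * (ennreal (b + 1) * emeasure M (G b' T))"
      unfolding G_def by (intro mult_left_mono X.E_hit_le T b'(2,3)) simp
    also have "\<dots> = ennreal (exp x * (b + 1) * prob (G b' T))"
      using b by (simp add: emeasure_eq_measure ennreal_mult mult.assoc)
    finally have le: "(\<integral>\<^sup>+\<omega>. ennreal (?f \<omega>) \<partial>M) \<le> ennreal (exp x * (b + 1) * prob (G b' T))" .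
    have int: "integrable M ?f"
      by (rule integrableI_nonneg) (use le in \<open>auto intro: le_less_trans\<close>)
    \<comment> \<open>Integrability ensures that \<open>C T\<close> is the actual expectation and
      not the default value 0.\<close>
    have "ennreal (C T) = (\<integral>\<^sup>+\<omega>. ennreal (?f \<omega>) \<partial>M)"
      unfolding assms(20) by (rule nn_integral_eq_integral[symmetric, OF int]) simp
    then have "ennreal (C T) \<le> ennreal (exp x * (b + 1) * prob (G b' T))" using le by simp
    then have "C T \<le> exp x * (b + 1) * prob (G b' T)"
      using b by (subst (asm) ennreal_le_iff) simp_all
    with int show ?thesis by blast
  qed
  moreover have "C \<in> o[at_right 0](\<lambda>T. T powr m)" for m
  proof (rule smalloI_tendsto)
    have lim: "((\<lambda>T. exp x * (b + 1) * (prob (G b' T) / T powr m)) \<longlongrightarrow> 0) (at_right 0)"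
      by (rule tendsto_mult_right_zero[OF little[OF b'(1)]])
    show "((\<lambda>T. C T / T powr m) \<longlongrightarrow> 0) (at_right 0)"
    proof (rule tendsto_sandwich[OF _ _ tendsto_const lim])
      have "0 \<le> C T" for T
        unfolding assms(20) by (rule integral_nonneg_AE) simp
      then show "\<forall>\<^sub>F T in at_right 0. 0 \<le> C T / T powr m"
        by (intro always_eventually allI divide_nonneg_nonneg) simp_all
      show "\<forall>\<^sub>F T in at_right 0. C T / T powr m \<le> exp x * (b + 1) * (prob (G b' T) / T powr m)"
        using pos
      proof eventually_elim
        case (elim T)
        then have "C T / T powr m \<le> exp x * (b + 1) * prob (G b' T) / T powr m"
          using payoff[OF elim] by (intro divide_right_mono) simp_all
        then show ?case by simp
      qed
    qed
    show "\<forall>\<^sub>F T in at_right 0. T powr m \<noteq> 0"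
      using pos by eventually_elim simp
  qed
  ultimately show ?thesis by blast
qed


end
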